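(* Let $F$ be an algebraically closed field of characteristic $\neq 2,3,5$ and let $(U,\omega)$ be a finite dimensional $b$-alternative algebra over $F$. Then $U$ has a Wedderburn $b$-decomposition; that is, $U$ can be decomposed as a direct sum of vector spaces $U=S\oplus V\oplus \mathrm{rad}(U)$, where $S$ is a $b$-semisimple $b$-subalgebra of $U$ and $V$ is a vector subspace of $\mathrm{bar}(U)$ such that $V^2\subseteq \mathrm{rad}(U)$.
   Context: Algebras over a field $F$ are not assumed associative, commutative or unital. An algebra $U$ is alternative if $(x,x,y)=(y,x,x)=0$ for all $x,y\in U$, where $(x,y,z)=(xy)z-x(yz)$. A $b$-algebra (baric algebra) is a pair $(U,\omega)$, where $U$ is an $F$-algebra and $\omega:U\to F$ is a nonzero algebra homomorphism (the weight). A $b$-alternative algebra is a $b$-algebra $(U,\omega)$ with $U$ alternative. A $b$-subalgebra of $(U,\omega)$ is a subalgebra $B$ of $U$ with $B\not\subseteq\ker\omega$; it is itself a $b$-algebra with weight $\omega|_B$. Put $\mathrm{bar}(B)=\{x\in B : \omega(x)=0\}$; in particular $\mathrm{bar}(U)=\ker\omega$. A $b$-subalgebra $B$ is normal if $\mathrm{bar}(B)$ is a two-sided ideal of $\mathrm{bar}(U)$. A maximal normal $b$-subalgebra of $U$ is a normal $b$-subalgebra $B\ne U$ such that there is no normal $b$-subalgebra $C$ with $B\subsetneq C\subsetneq U$. The $b$-algebra $(U,\omega)$ is $b$-simple if every normal $b$-subalgebra $B$ of $U$ satisfies $\mathrm{bar}(B)=(0)$ or $\mathrm{bar}(B)=\mathrm{bar}(U)$.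 The $b$-radical (bar-radical) is $\mathrm{rad}(U)=(0)$ if $(U,\omega)$ is $b$-simple, and otherwise $\mathrm{rad}(U)=\bigcap \mathrm{bar}(B)$, where $B$ runs over the maximal normal $b$-subalgebras of $U$. $U$ is $b$-semisimple if $\mathrm{rad}(U)=(0)$. For a subspace $V$, $V^2$ is the span of all products $vw$ with $v,w\in V$. *)

theory Defs
  imports "HOL-Computational_Algebra.Polynomial"
begin

locale nonassoc_algebra = vector_space scale
  for scale :: "'f::field \<Rightarrow> 'u::ab_group_add \<Rightarrow> 'u" +
  fixes mult :: "'u \<Rightarrow> 'u \<Rightarrow> 'u"  (infixl \<open>\<star>\<close> 70)
  assumes mult_linear_left: "Vector_Spaces.linear scale scale (\<lambda>x. x \<star> y)"
    and mult_linear_right: "Vector_Spaces.linear scale scale (\<lambda>y. x \<star> y)"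
begin

definition associator :: "'u \<Rightarrow> 'u \<Rightarrow> 'u \<Rightarrow> 'u" where
  "associator x y z = (x \<star> y) \<star> z - x \<star> (y \<star> z)"

definition subalgebra :: "'u set \<Rightarrow> bool" where
  "subalgebra B \<longleftrightarrow> subspace B \<and> (\<forall>x\<in>B. \<forall>y\<in>B. x \<star> y \<in> B)"

definition two_sided_ideal :: "'u set \<Rightarrow> 'u set \<Rightarrow> bool" where
  "two_sided_ideal A I \<longleftrightarrow>
     subspace I \<and> I \<subseteq> A \<and> (\<forall>a\<in>A. \<forall>x\<in>I. a \<star> x \<in> I \<and> x \<star> a \<in> I)"

definition square :: "'u set \<Rightarrow> 'u set" where
  "square V = span {v \<star> w | v w. v \<in> V \<and> w \<in> V}"

definition direct_sum3 :: "'u set \<Rightarrow> 'u set \<Rightarrow> 'u set \<Rightarrow> 'u set \<Rightarrow> bool" where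
  "direct_sum3 U A B C \<longleftrightarrow>
     subspace A \<and> subspace B \<and> subspace C \<and> A \<subseteq> U \<and> B \<subseteq> U \<and> C \<subseteq> U \<and>
     (\<forall>x\<in>U. \<exists>!(a, b, c). a \<in> A \<and> b \<in> B \<and> c \<in> C \<and> x = a + b + c)"

end

locale b_algebra = nonassoc_algebra scale mult
  for scale :: "'f::field \<Rightarrow> 'u::ab_group_add \<Rightarrow> 'u"
    and mult :: "'u \<Rightarrow> 'u \<Rightarrow> 'u"  (infixl \<open>\<star>\<close> 70) +
  fixes \<omega> :: "'u \<Rightarrow> 'f"
  assumes weight_linear: "Vector_Spaces.linear scale (*) \<omega>"
    and weight_mult: "\<omega> (x \<star> y) = \<omega> x * \<omega> y"
    and weight_nonzero: "\<exists>x. \<omega> x \<noteq> 0"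
begin

text \<open>The whole \<open>b\<close>-algebra is \<^term>\<open>UNIV\<close>. A \<open>b\<close>-subalgebra is again a \<open>b\<close>-algebra, with the
  restricted weight, so the notions below take the carrier \<open>U\<close> of the \<open>b\<close>-algebra
  to which they refer as an argument.\<close>

definition bar :: "'u set \<Rightarrow> 'u set" where
  "bar B = {x \<in> B. \<omega> x = 0}"

definition b_subalgebra :: "'u set \<Rightarrow> 'u set \<Rightarrow> bool" where
  "b_subalgebra U B \<longleftrightarrow> subalgebra B \<and> B \<subseteq> U \<and> \<not> B \<subseteq> {x. \<omega> x = 0}"

definition normal_b_subalgebra :: "'u set \<Rightarrow> 'u set \<Rightarrow> bool" where
  "normal_b_subalgebra U B \<longleftrightarrow> b_subalgebra U B \<and> two_sided_ideal (bar U) (bar B)"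

definition maximal_normal_b_subalgebra :: "'u set \<Rightarrow> 'u set \<Rightarrow> bool" where
  "maximal_normal_b_subalgebra U B \<longleftrightarrow>
     normal_b_subalgebra U B \<and> B \<noteq> U \<and>
     \<not> (\<exists>C. normal_b_subalgebra U C \<and> B \<subset> C \<and> C \<subset> U)"

definition b_simple :: "'u set \<Rightarrow> bool" where
  "b_simple U \<longleftrightarrow> (\<forall>B. normal_b_subalgebra U B \<longrightarrow> bar B = {0} \<or> bar B = bar U)"

text \<open>In finite dimension a \<open>b\<close>-algebra that is not \<open>b\<close>-simple has a maximal normal
  \<open>b\<close>-subalgebra, and the intersection is then over a nonempty family.
  Intersecting with \<^term>\<open>bar U\<close> only matters for an empty family.\<close>

definition b_radical :: "'u set \<Rightarrow> 'u set" where
  "b_radical U =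
     (if b_simple U then {0}
      else bar U \<inter> (\<Inter>B \<in> {B. maximal_normal_b_subalgebra U B}. bar B))"

definition b_semisimple :: "'u set \<Rightarrow> bool" where
  "b_semisimple U \<longleftrightarrow> b_radical U = {0}"

definition wedderburn_b_decomposition :: "'u set \<Rightarrow> 'u set \<Rightarrow> 'u set \<Rightarrow> bool" where
  "wedderburn_b_decomposition U S V \<longleftrightarrow>
     direct_sum3 U S V (b_radical U) \<and>
     b_subalgebra U S \<and> b_semisimple S \<and>
     V \<subseteq> bar U \<and> square V \<subseteq> b_radical U"

end

locale b_alternative_algebra = b_algebra scale mult \<omega>
  for scale :: "'f::field \<Rightarrow> 'u::ab_group_add \<Rightarrow> 'u"
    and mult :: "'u \<Rightarrow> 'u \<Rightarrow> 'u"  (infixl \<open>\<star>\<close> 70)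
    and \<omega> :: "'u \<Rightarrow> 'f" +
  assumes left_alternative: "associator x x y = 0"
    and right_alternative: "associator y x x = 0"

end

theory Submission
  imports Defs
begin

text \<open>The argument has two independent halves: a Wedderburn principal theorem for alternative algebras,
  and a description of the \<open>b\<close>-radical by ideals.

  Since an element of weight one is not nilpotent, every subalgebra of nonzero
  weight contains an idempotent of weight one. Therefore the bars of the normal \<open>b\<close>-subalgebras of
  \<open>U\<close> are exactly the ideals of \<open>U\<close> inside \<open>bar U\<close>, and \<open>rad U\<close> is the intersection of the maximal
  ones among those that differ from \<open>bar U\<close> (\<open>b_radical_eq\<close>).

  For the principal theorem, take a set \<open>E\<close> of orthogonal idempotents that is as large as possible.
  Each \<open>a\<close> in \<open>E\<close> is primitive, so the Peirce component \<open>P\<^sub>a\<^sub>a\<close> is local: an element is a scalar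
  multiple of \<open>a\<close>, its residue, plus a nilpotent one. The sum of the residues of the diagonal components
  is a trace form, and it is symmetric and associative (\<open>tr_commute\<close>, \<open>tr_assoc\<close>); its radical \<open>J\<close> is
  thus an ideal. Jacobson's theorem on weakly closed sets of nilpotent operators shows that \<open>J\<close> is
  nilpotent (\<open>J_nilpotent\<close>). A complementary subalgebra \<open>S\<close> is written down explicitly
  (\<open>wedderburn_principal\<close>): call two idempotents linked if \<open>P\<^sub>a\<^sub>b\<close> is not contained in \<open>J\<close>. A class of
  linked idempotents carries matrix units that multiply exactly as they should. These span a complement
  to \<open>J\<close> unless the class consists of two idempotents and the trace form on \<open>P\<^sub>a\<^sub>b \<times> P\<^sub>b\<^sub>a\<close> has rank
  above one. In that case two orthogonal dual pairs \<open>(x\<^sub>1, y\<^sub>1)\<close> and \<open>(x\<^sub>2, y\<^sub>2)\<close> can be chosen, and then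
  \<open>(y\<^sub>2 y\<^sub>1, x\<^sub>1 x\<^sub>2)\<close> is a third one; the relations of the split octonions hold for them on the nose,
  and the rank is three. So nothing has to be lifted through powers of the radical.

  The two halves meet in a form argument in the style of Dieudonne: orthogonal complements of ideals give
  \<open>rad A \<subseteq> J\<close> for every subalgebra \<open>A\<close> with \<open>A + J = U\<close> (\<open>b_radical_in_J\<close>). For \<open>A = S\<close> this says
  that \<open>S\<close> is \<open>b\<close>-semisimple, as \<open>S\<close> meets \<open>J\<close> trivially; for \<open>A = U\<close> it puts \<open>rad U\<close> inside \<open>J\<close>. As \<open>J\<close> is
  nilpotent, \<open>J\<^sup>2\<close> lies in \<open>rad U\<close> (\<open>square_J_in_b_radical\<close>). Hence any linear complement \<open>V\<close> of
  \<open>rad U\<close> in \<open>J\<close> completes the decomposition.\<close>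

section \<open>Alternative algebras and powers\<close>

locale alternative_algebra =
  nonassoc_algebra scale mult + finite_dimensional_vector_space scale Basis
  for scale :: "'f::field \<Rightarrow> 'u::ab_group_add \<Rightarrow> 'u" (infixr \<open>*s\<close> 75)
    and mult :: "'u \<Rightarrow> 'u \<Rightarrow> 'u" (infixl \<open>\<star>\<close> 70)
    and Basis :: "'u set" +
  assumes left_alternative: "associator x x y = 0"
    and right_alternative: "associator y x x = 0"
    and two_neq_zero: "(2::'f) \<noteq> 0"
begin

lemma mult_add_left: "(x + y) \<star> z = x \<star> z + y \<star> z"
  and mult_scale_left: "(c *s x) \<star> z = c *s (x \<star> z)"
  and mult_add_right: "z \<star> (x + y) = z \<star> x + z \<star> y"
  and mult_scale_right: "z \<star> (c *s x) = c *s (z \<star> x)"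
proof -
  interpret l: Vector_Spaces.linear scale scale "\<lambda>x. x \<star> z" by (rule mult_linear_left)
  interpret r: Vector_Spaces.linear scale scale "\<lambda>x. z \<star> x" by (rule mult_linear_right)
  show "(x + y) \<star> z = x \<star> z + y \<star> z" "(c *s x) \<star> z = c *s (x \<star> z)"
    "z \<star> (x + y) = z \<star> x + z \<star> y" "z \<star> (c *s x) = c *s (z \<star> x)"
    by (rule l.add l.scale r.add r.scale)+
qed

lemma mult_zero [simp]: "0 \<star> x = 0" "x \<star> 0 = 0"
  using mult_scale_left[of 0] mult_scale_right[of _ 0] by (metis scale_zero_left)+

lemma mult_minus_left: "(- x) \<star> y = - (x \<star> y)"
  and mult_minus_right: "x \<star> (- y) = - (x \<star> y)"
  using mult_scale_left[of "-1"] mult_scale_right[of _ "-1"] by auto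

lemma mult_diff_left: "(x - y) \<star> z = x \<star> z - y \<star> z"
  using mult_add_left[of x "-y" z] by (simp add: mult_minus_left)

lemma mult_diff_right: "x \<star> (y - z) = x \<star> y - x \<star> z"
  using mult_add_right[of x y "-z"] by (simp add: mult_minus_right)

lemmas mult_simps = mult_add_left mult_add_right mult_diff_left mult_diff_right
  mult_scale_left mult_scale_right mult_minus_left mult_minus_right

lemma mult_sum_left: "sum f A \<star> x = (\<Sum>a\<in>A. f a \<star> x)"
  and mult_sum_right: "x \<star> sum f A = (\<Sum>a\<in>A. x \<star> f a)"
  by (induct A rule: infinite_finite_induct) (auto simp: mult_simps)

lemma two_scale: "x + x = 2 *s x"
  using scale_left_distrib[of 1 1 x] by simp

lemma double_cancel: "x + x = y + y \<Longrightarrow> x = (y::'u)"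
  unfolding two_scale using two_neq_zero by (metis scale_cancel_left)

lemma double_zero: "x + x = 0 \<Longrightarrow> x = (0::'u)"
  using double_cancel[of x 0] by simp

text \<open>Linearising the two alternative laws shows that the associator is alternating; everything
  below about products of Peirce components is read off from this.\<close>

lemma associator_swap_left: "associator x y z = - associator y x z"
proof -
  have "associator (x + y) (x + y) z = associator x x z + associator y y z
      + (associator x y z + associator y x z)"
    unfolding associator_def by (simp add: mult_simps algebra_simps)
  then show ?thesis
    by (simp add: left_alternative eq_neg_iff_add_eq_0)
qed

lemma associator_swap_right: "associator x y z = - associator x z y"
proof -
  have "associator x (y + z) (y + z) = associator x y y + associator x z z
      + (associator x y z + associator x z y)"
    unfolding associator_def by (simp add: mult_simps algebra_simps)
  then show ?thesis
    by (simp add: right_alternative eq_neg_iff_add_eq_0)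
qed

lemma associator_cycle: "associator x y z = associator y z x"
  using associator_swap_left[of x y z] associator_swap_right[of y x z] by simp

lemma associator_swap_outer: "associator x y z = - associator z y x"
  using associator_cycle[of x y z] associator_swap_left[of y z x] by simp

lemma flexible: "(x \<star> y) \<star> x = x \<star> (y \<star> x)"
  using associator_cycle[of x y x] right_alternative[of y x] unfolding associator_def by simp

lemma left_alt: "x \<star> (x \<star> y) = (x \<star> x) \<star> y"
  using left_alternative[of x y] unfolding associator_def by simp

lemma right_alt: "(y \<star> x) \<star> x = y \<star> (x \<star> x)"
  using right_alternative[of y x] unfolding associator_def by simp

text \<open>Left and right multiplication are homomorphisms for the Jordan product. This replaces
  associativity for powers, and makes sets closed under the Jordan product weakly closed in the sense
  of Jacobson.\<close>

lemma jordan_left: "(x \<star> y + y \<star> x) \<star> z = x \<star> (y \<star> z) + y \<star> (x \<star> z)"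
  using associator_swap_left[of x y z] unfolding associator_def
  by (simp add: mult_simps algebra_simps)

lemma jordan_right: "z \<star> (x \<star> y + y \<star> x) = (z \<star> x) \<star> y + (z \<star> y) \<star> x"
  using associator_swap_right[of z x y] unfolding associator_def
  by (simp add: mult_simps algebra_simps)

text \<open>The power \<open>x\<^bsup>k+1\<^esup>\<close>; the shift avoids a unit.\<close>
definition npow :: "'u \<Rightarrow> nat \<Rightarrow> 'u" where
  "npow x k = ((\<star>) x ^^ k) x"

definition nilp :: "'u \<Rightarrow> bool" where
  "nilp x \<longleftrightarrow> (\<exists>k. npow x k = 0)"

lemma npow_0 [simp]: "npow x 0 = x"
  and npow_Suc: "npow x (Suc k) = x \<star> npow x k"
  by (simp_all add: npow_def)

lemma npow_mult: "npow x k \<star> y = ((\<star>) x ^^ Suc k) y"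
proof (induction k arbitrary: y)
  case (Suc k)
  have comm: "npow x k \<star> x = x \<star> npow x k"
    unfolding Suc[of x] by (simp add: npow_def)
  have "npow x (Suc k) \<star> y + npow x (Suc k) \<star> y = (x \<star> npow x k + npow x k \<star> x) \<star> y"
    by (simp add: npow_Suc comm mult_simps)
  also have "\<dots> = x \<star> (npow x k \<star> y) + npow x k \<star> (x \<star> y)"
    by (rule jordan_left)
  also have "\<dots> = ((\<star>) x ^^ Suc (Suc k)) y + ((\<star>) x ^^ Suc (Suc k)) y"
    using Suc[of y] Suc[of "x \<star> y"] by (simp add: funpow_swap1)
  finally show ?case by (rule double_cancel)
qed simp

lemma npow_commute: "npow x k \<star> x = npow x (Suc k)"
  by (simp only: npow_mult) (simp add: npow_def)

lemma npow_add: "npow x j \<star> npow x k = npow x (Suc (j + k))"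
proof -
  have "npow x j \<star> npow x k = ((\<star>) x ^^ Suc j) (((\<star>) x ^^ k) x)"
    by (simp add: npow_mult) (simp add: npow_def)
  also have "\<dots> = ((\<star>) x ^^ (Suc j + k)) x"
    by (simp only: funpow_add o_apply)
  finally show ?thesis by (simp add: npow_def)
qed

lemma mult_npow: "y \<star> npow x k = ((\<lambda>z. z \<star> x) ^^ Suc k) y"
proof (induction k arbitrary: y)
  case (Suc k)
  have "y \<star> npow x (Suc k) + y \<star> npow x (Suc k) = y \<star> (x \<star> npow x k + npow x k \<star> x)"
    by (simp add: npow_Suc[symmetric] npow_commute mult_simps)
  also have "\<dots> = (y \<star> x) \<star> npow x k + (y \<star> npow x k) \<star> x"
    by (rule jordan_right)
  also have "\<dots> = ((\<lambda>z. z \<star> x) ^^ Suc (Suc k)) y + ((\<lambda>z. z \<star> x) ^^ Suc (Suc k)) y"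
    using Suc[of y] Suc[of "y \<star> x"] funpow_swap1[of "\<lambda>z. z \<star> x" k y] by simp
  finally show ?case by (rule double_cancel)
qed simp

lemma nilp_0 [simp]: "nilp 0"
  unfolding nilp_def by (rule exI[of _ 0]) simp

text \<open>By \<open>npow_mult\<close> and \<open>mult_npow\<close> a nilpotent element acts by nilpotent operators.\<close>

lemma nilp_eigen_left:
  assumes "nilp p" "p \<star> z = c *s z" "z \<noteq> 0" shows "c = 0"
proof -
  obtain k where k: "npow p k = 0" using assms(1) unfolding nilp_def by blast
  have "((\<star>) p ^^ n) z = c ^ n *s z" for n
    by (induction n) (auto simp: assms mult_simps mult.commute)
  from this[of "Suc k"] npow_mult[of p k z] k have "c ^ Suc k *s z = 0" by simp
  with assms(3) show ?thesis by (simp del: power_Suc)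
qed

lemma nilp_eigen_right:
  assumes "nilp p" "z \<star> p = c *s z" "z \<noteq> 0" shows "c = 0"
proof -
  obtain k where k: "npow p k = 0" using assms(1) unfolding nilp_def by blast
  have "((\<lambda>z. z \<star> p) ^^ n) z = c ^ n *s z" for n
    by (induction n) (auto simp: assms mult_simps mult.commute)
  from this[of "Suc k"] mult_npow[of z p k] k have "c ^ Suc k *s z = 0" by simp
  with assms(3) show ?thesis by (simp del: power_Suc)
qed

lemma nilp_top_power:
  assumes "nilp x" "x \<noteq> 0"
  obtains m where "npow x m \<noteq> 0" "npow x (Suc m) = 0"
proof -
  define k where "k = (LEAST k. npow x k = 0)"
  have k: "npow x k = 0"
    using assms(1) unfolding nilp_def k_def by (rule LeastI_ex)
  then have "k \<noteq> 0" using assms(2) by (metis npow_0)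
  then obtain m where m: "k = Suc m" using not0_implies_Suc by blast
  have "npow x m \<noteq> 0" using not_less_Least[of m "\<lambda>k. npow x k = 0"] m k_def by simp
  with that k m show thesis by simp
qed

lemma idempotent_not_nilp:
  assumes "f \<star> f = f" "f \<noteq> 0" shows "\<not> nilp f"
proof
  assume "nilp f"
  from nilp_eigen_left[OF this, of f 1] assms show False by simp
qed

lemma span_linear_image: 
  assumes "Vector_Spaces.linear scale scale f" shows "span (f ` S) = f ` span S"
proof -
  interpret f: Vector_Spaces.linear scale scale f by fact
  show ?thesis by (rule f.span_image)
qed

lemma inj_endo_surj:
  assumes f: "Vector_Spaces.linear scale scale f" and W: "subspace W" "f ` W \<subseteq> W"
    and inj: "\<And>x. x \<in> W \<Longrightarrow> f x = 0 \<Longrightarrow> x = 0"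
  shows "f ` W = W"
proof (rule subspace_dim_equal)
  interpret p: finite_dimensional_vector_space_pair_1 scale Basis scale by unfold_locales
  interpret f: Vector_Spaces.linear scale scale f by fact
  show "subspace (f ` W)" by (rule f.subspace_image[OF W(1)])
  have "inj_on f (span W)"
    using inj W(1) by (subst f.inj_on_iff_eq_0) (auto simp: span_eq_iff[THEN iffD2])
  from p.dim_image_eq[OF f this] show "dim W \<le> dim (f ` W)" by simp
qed (use W in auto)

text \<open>Powers of \<open>x\<close> associate with everything, and their span is commutative. Fitting's lemma for
  \<open>L\<^sub>x\<close> on the eventually constant chain of spans of \<open>{x\<^sup>j | j > k}\<close> then yields an idempotent.\<close>

lemma idempotent_from_non_nilpotent:
  assumes "\<not> nilp x"
  obtains f k where "f \<in> span (range (npow x))" "f \<noteq> 0" "f \<star> f = f" "npow x k \<star> f = npow x k"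
proof -
  define W where "W k = span (npow x ` {k..})" for k
  define k where "k = (ARG_MIN (\<lambda>k. dim (W k)) k. True)"
  have k: "dim (W k) \<le> dim (W m)" for m
    unfolding k_def by (rule arg_min_nat_le) simp
  have W_eq: "W m = W k" if "k \<le> m" for m
    unfolding W_def
    by (rule subspace_dim_equal) (use that k[of m] in \<open>auto intro!: span_mono simp: W_def\<close>)
  have WS: "W k \<subseteq> span (range (npow x))"
    unfolding W_def by (rule span_mono) auto
  have img: "(\<star>) (npow x k) ` W k = W k"
  proof -
    have "(\<star>) (npow x k) ` W k = span ((\<star>) (npow x k) ` (npow x ` {k..}))"
      unfolding W_def by (rule span_linear_image[OF mult_linear_right, symmetric])
    also have "(\<star>) (npow x k) ` (npow x ` {k..}) = npow x ` {Suc (k + k)..}"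
      unfolding image_image npow_add
    proof (intro equalityI subsetI)
      fix y assume "y \<in> npow x ` {Suc (k + k)..}"
      then obtain j where "y = npow x j" "Suc (k + k) \<le> j" by auto
      then show "y \<in> (\<lambda>j. npow x (Suc (k + j))) ` {k..}"
        by (intro image_eqI[of _ _ "j - Suc k"]) auto
    qed auto
    also have "span \<dots> = W k" using W_eq[of "Suc (k + k)"] unfolding W_def by simp
    finally show ?thesis .
  qed
  have comm: "f \<star> npow x k = npow x k \<star> f" if "f \<in> span (range (npow x))" for f
    using that
    by (induction rule: span_induct_alt) (auto simp: mult_simps npow_add add.commute)
  \<comment> \<open>\<open>L\<^sub>x\<close> and its powers act surjectively on the stable span \<open>W k\<close>; a preimage of \<open>x\<^bsup>k+1\<^esup>\<close>
    under multiplication by \<open>x\<^bsup>k+1\<^esup>\<close> is a unit for \<open>W k\<close>.\<close>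
  have assoc: "f \<star> (npow x k \<star> v) = (f \<star> npow x k) \<star> v" if "f \<in> span (range (npow x))" for f v
    using that
  proof (induction rule: span_induct_alt)
    case (step c y z)
    then obtain i where y: "y = npow x i" by auto
    have "y \<star> (npow x k \<star> v) = ((\<star>) x ^^ (Suc i + Suc k)) v"
      by (simp only: y npow_mult funpow_add o_apply)
    also have "\<dots> = npow x (Suc (i + k)) \<star> v" by (simp only: npow_mult) simp
    finally have "y \<star> (npow x k \<star> v) = (y \<star> npow x k) \<star> v" by (simp add: y npow_add)
    with step show ?case by (simp add: mult_simps)
  qed simp
  have "npow x k \<in> W k" unfolding W_def by (rule span_base) auto
  with img obtain f where f: "f \<in> W k" "npow x k \<star> f = npow x k" by (metis imageE)
  from f(1) WS have fS: "f \<in> span (range (npow x))" by blast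
  from f(1) img obtain v where v: "f = npow x k \<star> v" by (metis imageE)
  have "f \<star> f = (f \<star> npow x k) \<star> v" using assoc[OF fS] v by simp
  also have "\<dots> = f" using comm[OF fS] f(2) v by simp
  finally have ff: "f \<star> f = f" .
  have "f \<noteq> 0" using f(2) assms unfolding nilp_def by auto
  with that fS ff f(2) show thesis by blast
qed

lemma npow_in_subalgebra: 
  assumes "subalgebra A" "x \<in> A" shows "npow x k \<in> A"
  by (induction k) (use assms in \<open>auto simp: npow_Suc subalgebra_def\<close>)

lemma span_npow_in_subalgebra:
  assumes "subalgebra A" "x \<in> A" shows "span (range (npow x)) \<subseteq> A"
  by (rule span_minimal) (use assms npow_in_subalgebra in \<open>auto simp: subalgebra_def\<close>)

end

section \<open>Weakly closed sets of nilpotent elements\<close>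

context alternative_algebra begin

text \<open>The images of \<open>M\<close> modulo \<open>M'\<close> under words of length \<open>k\<close> in the left multiplications by
  elements of \<open>W\<close>. Carrying \<open>M'\<close> along replaces passing to the quotient \<open>M / M'\<close>.\<close>
primrec descent :: "'u set \<Rightarrow> 'u set \<Rightarrow> 'u set \<Rightarrow> nat \<Rightarrow> 'u set" where
  "descent W M M' 0 = M"
| "descent W M M' (Suc k) = span (M' \<union> {b \<star> m | b m. b \<in> W \<and> m \<in> descent W M M' k})"

lemma descent_mono:
  assumes "W \<subseteq> W'" "M \<subseteq> L" "M' \<subseteq> L'"
  shows "descent W M M' k \<subseteq> descent W' L L' k"
proof (induction k)
  case (Suc k)
  show ?case unfolding descent.simps by (rule span_mono) (use Suc assms in blast)
qed (use assms in auto)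

lemma mult_span_left:
  assumes "\<And>b. b \<in> W \<Longrightarrow> b \<star> m \<in> T" "subspace T" "x \<in> span W" shows "x \<star> m \<in> T"
  using assms(3)
  by (induction rule: span_induct_alt)
    (auto simp: mult_simps assms subspace_0 intro!: subspace_add subspace_scale)

lemma mult_span_right:
  assumes "\<And>m. m \<in> M \<Longrightarrow> b \<star> m \<in> T" "subspace T" "x \<in> span M" shows "b \<star> x \<in> T"
  using assms(3)
  by (induction rule: span_induct_alt)
    (auto simp: mult_simps assms subspace_0 intro!: subspace_add subspace_scale)

lemma descent_step: "b \<in> W \<Longrightarrow> m \<in> descent W M M' k \<Longrightarrow> b \<star> m \<in> descent W M M' (Suc k)"
  unfolding descent.simps by (rule span_base) blast

lemma descent_base: "subspace M \<Longrightarrow> M' \<subseteq> M \<Longrightarrow> M' \<subseteq> descent W M M' k"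
  by (cases k) (auto intro: span_base)

lemma subspace_descent: "subspace M \<Longrightarrow> subspace (descent W M M' k)"
  by (cases k) auto

lemma descent_span: 
  assumes "subspace M" shows "descent (span W) M M' k \<subseteq> descent W M M' k"
proof (induction k)
  case (Suc k)
  have "b \<star> m \<in> descent W M M' (Suc k)" if "b \<in> span W" "m \<in> descent (span W) M M' k" for b m
    using that(1) by (rule mult_span_left[rotated 2]) (use that Suc descent_step assms in auto)
  moreover have "M' \<subseteq> descent W M M' (Suc k)" by (auto intro: span_base)
  ultimately show ?case
    unfolding descent.simps(2)[of "span W"]
    by (intro span_minimal subspace_descent[OF assms]) auto
qed simp

lemma descent_in:
  assumes "subspace M" "M' \<subseteq> M" "\<And>b m. b \<in> W \<Longrightarrow> m \<in> M \<Longrightarrow> b \<star> m \<in> M"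
  shows "descent W M M' k \<subseteq> M"
proof (induction k)
  case (Suc k)
  show ?case unfolding descent.simps by (rule span_minimal) (use assms Suc in auto)
qed simp

lemma descent_compose:
  assumes "descent W M K j \<subseteq> K" "descent W K M' k \<subseteq> M'" "M' \<subseteq> K"
  shows "descent W M M' (j + k) \<subseteq> M'"
proof -
  have "descent W M M' (j + i) \<subseteq> descent W K M' i" for i
  proof (induction i)
    case 0
    show ?case using descent_mono[of W W M M M' K j] assms by auto
  next
    case (Suc i)
    show ?case unfolding descent.simps add_Suc_right by (rule span_mono) (use Suc in blast)
  qed
  with assms(2) show ?thesis by blast
qed

lemma descent_decreasing:
  assumes "subspace M" "M' \<subseteq> M" "\<And>b m. b \<in> W \<Longrightarrow> m \<in> M \<Longrightarrow> b \<star> m \<in> M" "i \<le> j"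
  shows "descent W M M' j \<subseteq> descent W M M' i"
proof -
  have "descent W M M' (Suc k) \<subseteq> descent W M M' k" for k
  proof (induction k)
    case 0
    show ?case using descent_in[OF assms(1,2,3), where k = "Suc 0"] by simp
  next
    case (Suc k)
    show ?case unfolding descent.simps(2)[of _ _ _ "Suc k"] descent.simps(2)[of _ _ _ "k"]
      by (rule span_mono) (use Suc in auto)
  qed
  from decseq_SucI[of "descent W M M'", OF this] assms(4) show ?thesis by (rule decseqD)
qed

text \<open>Jacobson's theorem on weakly closed sets of nilpotent operators, for left multiplications.
  Among the subsets of \<open>W\<close> that are closed under the Jordan product and act nilpotently on
  \<open>M / M'\<close>, one with the largest span already spans \<open>W\<close>: otherwise some element \<open>x\<close> outside its
  span multiplies it into its span, and \<open>x\<close> can be added by applying the induction hypothesis to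
  the stabiliser of the proper submodule that the subset generates.\<close>

theorem jacobson_weakly_closed:
  assumes "\<And>x y. x \<in> W \<Longrightarrow> y \<in> W \<Longrightarrow> x \<star> y + y \<star> x \<in> W"
    and "\<And>x. x \<in> W \<Longrightarrow> nilp x"
    and "subspace M" "subspace M'" "M' \<subseteq> M"
    and "\<And>x m. x \<in> W \<Longrightarrow> m \<in> M \<Longrightarrow> x \<star> m \<in> M"
    and "\<And>x m. x \<in> W \<Longrightarrow> m \<in> M' \<Longrightarrow> x \<star> m \<in> M'"
  shows "\<exists>k. descent W M M' k \<subseteq> M'"
  using assms
proof (induction "dim M - dim M'" arbitrary: W M M' rule: less_induct)
  case less
  note jordan = less.prems(1) and nil = less.prems(2) and sM = less.prems(3) and sM' = less.prems(4)
    and M'M = less.prems(5) and WM = less.prems(6) and WM' = less.prems(7)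
  show ?case
  proof (cases "M = M'")
    case True
    then show ?thesis by (intro exI[of _ 0]) simp
  next
    case False
    then have dimM: "dim M' < dim M" using M'M sM sM' by (metis leI subspace_dim_equal)
    define ok where "ok X \<longleftrightarrow> X \<subseteq> W \<and> (\<forall>x\<in>X. \<forall>y\<in>X. x \<star> y + y \<star> x \<in> X)
      \<and> (\<exists>k. descent X M M' k \<subseteq> M')" for X
    have "ok {}"
      unfolding ok_def using sM' by (auto intro!: exI[of _ "Suc 0"] simp: span_eq_iff[THEN iffD2])
    moreover have "\<forall>X. ok X \<longrightarrow> dim X \<le> dimension"
      using dim_subset_UNIV by blast
    ultimately obtain X where X: "ok X" and Xmax: "\<And>Y. ok Y \<Longrightarrow> dim Y \<le> dim X"
      using ex_has_greatest_nat[of ok "{}" dim] by (metis less_Suc_eq_le)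
    have XW: "X \<subseteq> W" and Xj: "\<And>x y. x \<in> X \<Longrightarrow> y \<in> X \<Longrightarrow> x \<star> y + y \<star> x \<in> X"
      using X unfolding ok_def by blast+
    obtain n where n: "descent X M M' n \<subseteq> M'" using X unfolding ok_def by blast
    have maximal: "Y \<subseteq> span X" if "ok Y" "X \<subseteq> Y" for Y
    proof -
      have "span X = span Y" using that Xmax[OF that(1)] by (intro dim_eq_span) auto
      then show ?thesis using span_superset by blast
    qed
    \<comment> \<open>The elements acting as zero on \<open>M / M'\<close> can be added to \<open>X\<close>, so they lie in its span.\<close>
    define K where "K = {x \<in> W. \<forall>m\<in>M. x \<star> m \<in> M'}"
    have KJ: "x \<star> y + y \<star> x \<in> K" if "x \<in> K" "y \<in> W" for x y
      using that jordan WM WM' unfolding K_def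
      by (auto simp: jordan_left intro!: subspace_add[OF sM'])
    have "ok (X \<union> K)"
    proof -
      have "descent (X \<union> K) M M' k \<subseteq> descent X M M' k" for k
      proof (induction k)
        case (Suc k)
        have "b \<star> m \<in> descent X M M' (Suc k)" if "b \<in> X \<union> K" "m \<in> descent (X \<union> K) M M' k" for b m
        proof (cases "b \<in> X")
          case True
          with that Suc show ?thesis by (intro descent_step) auto
        next
          case False
          have "m \<in> M" using that(2) descent_in[OF sM M'M, of "X \<union> K" k] WM XW
            unfolding K_def by blast
          with False that(1) have "b \<star> m \<in> M'" unfolding K_def by blast
          then show ?thesis by (auto intro: span_base)
        qed
        then show ?case unfolding descent.simps(2)[of "X \<union> K"]
          by (intro span_minimal subspace_descent[OF sM]) (auto intro: span_base)
      qed simp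
      moreover have "x \<star> y + y \<star> x \<in> X \<union> K" if "x \<in> X \<union> K" "y \<in> X \<union> K" for x y
        using that Xj[of x y] KJ[of x y] KJ[of y x] XW unfolding K_def
        by (auto simp: add.commute)
      ultimately show ?thesis using n XW unfolding ok_def K_def by blast
    qed
    then have KX: "K \<subseteq> span X" using maximal by blast
    have "W \<subseteq> span X"
    proof (rule ccontr)
      assume "\<not> W \<subseteq> span X"
      then obtain x0 where x0: "x0 \<in> W" "x0 \<notin> span X" by blast
      define C where "C = descent X M M'"
      have C_step: "b \<star> m \<in> C (Suc q)" if "b \<in> X" "m \<in> C q" for b m q
        unfolding C_def by (rule descent_step) (use that C_def in auto)
      have C_dec: "C j \<subseteq> C i" if "i \<le> j" for i j
        unfolding C_def by (rule descent_decreasing[OF sM M'M]) (use WM XW that in auto)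
      have C_sub: "subspace (C i)" for i unfolding C_def by (rule subspace_descent[OF sM])
      have C_base: "M' \<subseteq> C i" for i unfolding C_def by (rule descent_base[OF sM M'M])
      have C_in: "C i \<subseteq> M" for i using C_dec[of 0 i] by (simp add: C_def)
      \<comment> \<open>A Jordan product with \<open>k\<close> factors from \<open>X\<close> lowers the level in the chain by \<open>k\<close>, up to
        a bounded loss; for large \<open>k\<close> it therefore maps \<open>M\<close> into \<open>M'\<close>.\<close>
      have "\<exists>x\<in>W. x \<notin> span X \<and> (\<forall>b\<in>X. x \<star> b + b \<star> x \<in> span X)"
      proof (rule ccontr)
        assume contra: "\<not> ?thesis"
        have "\<exists>y\<in>W. y \<notin> span X \<and> (\<forall>q. \<forall>m\<in>C q. y \<star> m \<in> C (k + q - n))" for k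
        proof (induction k)
          case 0
          have "x0 \<star> m \<in> C (q - n)" if "m \<in> C q" for m q
          proof (cases "q \<le> n")
            case True
            then show ?thesis using that x0 WM C_in[of q] by (auto simp: C_def)
          next
            case False
            then have "m \<in> M'" using that C_dec[of n q] n by (auto simp: C_def)
            then show ?thesis using WM' x0 C_base by blast
          qed
          with x0 show ?case by (intro bexI[of _ x0]) auto
        next
          case (Suc k)
          then obtain y where y: "y \<in> W" "y \<notin> span X" "\<And>q m. m \<in> C q \<Longrightarrow> y \<star> m \<in> C (k + q - n)"
            by blast
          with contra obtain b where b: "b \<in> X" "y \<star> b + b \<star> y \<notin> span X" by blast
          have "(y \<star> b + b \<star> y) \<star> m \<in> C (Suc k + q - n)" if "m \<in> C q" for q m
          proof -
            have "y \<star> (b \<star> m) \<in> C (k + Suc q - n)" by (rule y(3)) (rule C_step[OF b(1) that])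
            moreover have "b \<star> (y \<star> m) \<in> C (Suc (k + q - n))"
              by (rule C_step[OF b(1)]) (rule y(3)[OF that])
            then have "b \<star> (y \<star> m) \<in> C (Suc k + q - n)"
              by (rule subsetD[OF C_dec, rotated]) linarith
            ultimately show ?thesis by (simp add: jordan_left subspace_add[OF C_sub])
          qed
          with b y(1) XW jordan show ?case by (intro bexI[of _ "y \<star> b + b \<star> y"]) auto
        qed
        from this[of "n + n"] obtain y where y: "y \<in> W" "y \<notin> span X"
          "\<And>q m. m \<in> C q \<Longrightarrow> y \<star> m \<in> C (n + n + q - n)" by blast
        have "y \<star> m \<in> M'" if "m \<in> M" for m
          using y(3)[of m 0] that n by (auto simp: C_def)
        with y KX show False unfolding K_def by blast
      qed
      then obtain x where x: "x \<in> W" "x \<notin> span X" "\<And>b. b \<in> X \<Longrightarrow> x \<star> b + b \<star> x \<in> span X"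
        by blast
      define L where "L = C (Suc 0)"
      have sL: "subspace L" and M'L: "M' \<subseteq> L" and LM: "L \<subseteq> M"
        unfolding L_def using C_sub C_base C_in by blast+
      have XL: "b \<star> m \<in> L" if "b \<in> span X" "m \<in> M" for b m
        using that(1) by (rule mult_span_left[rotated 2]) (use that C_step[of _ m 0] sL in \<open>auto simp: L_def C_def\<close>)
      show False
      proof (cases "L = M'")
        case True
        \<comment> \<open>Here \<open>X\<close> acts as zero, and it can be enlarged by the multiples of the powers of \<open>x\<close>.\<close>
        define P where "P = K \<union> {y \<in> W. \<exists>c k. y = c *s npow x k}"
        have "X \<subseteq> P" using XL XW True unfolding P_def K_def by (auto intro: span_base)
        moreover have "ok P"
        proof -
          obtain r where r: "npow x r = 0" using nil[OF x(1)] unfolding nilp_def by blast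
          define Q where "Q j = span (M' \<union> {((\<star>) x ^^ i) m | i m. j \<le> i \<and> m \<in> M})" for j
          have PM: "b \<star> m \<in> M" if "b \<in> P" "m \<in> M" for b m
            using that WM unfolding P_def K_def by blast
          have "descent P M M' j \<subseteq> Q j" for j
          proof (induction j)
            case 0
            have "\<exists>i l. m = ((\<star>) x ^^ i) l \<and> 0 \<le> i \<and> l \<in> M" if "m \<in> M" for m
              using that by (intro exI[of _ "0::nat"] exI[of _ m]) simp
            then show ?case unfolding Q_def by (auto intro!: span_base)
          next
            case (Suc j)
            have "b \<star> m \<in> Q (Suc j)" if b: "b \<in> P" and m: "m \<in> descent P M M' j" for b m
            proof (cases "b \<in> K")
              case True
              have "m \<in> M" using m descent_in[OF sM M'M PM, of P j] by blast
              with True have "b \<star> m \<in> M'" unfolding K_def by blast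
              then show ?thesis unfolding Q_def by (auto intro: span_base)
            next
              case False
              with b obtain c k where bc: "b = c *s npow x k" and bW: "b \<in> W"
                unfolding P_def by blast
              have "m \<in> Q j" using m Suc by blast
              then show ?thesis unfolding Q_def
              proof (rule mult_span_right[rotated 2])
                fix v assume "v \<in> M' \<union> {((\<star>) x ^^ i) m | i m. j \<le> i \<and> m \<in> M}"
                then show "b \<star> v \<in> span (M' \<union> {((\<star>) x ^^ i) m | i m. Suc j \<le> i \<and> m \<in> M})"
                proof
                  assume "v \<in> M'"
                  then show ?thesis using WM' bW by (auto intro: span_base)
                next
                  assume "v \<in> {((\<star>) x ^^ i) m | i m. j \<le> i \<and> m \<in> M}"
                  then obtain i m where v: "v = ((\<star>) x ^^ i) m" "j \<le> i" "m \<in> M" by blast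
                  have "b \<star> v = c *s ((\<star>) x ^^ (Suc k + i)) m"
                    by (simp only: bc v npow_mult mult_scale_left funpow_add o_apply)
                  moreover have "((\<star>) x ^^ (Suc k + i)) m
                      \<in> span (M' \<union> {((\<star>) x ^^ i) m | i m. Suc j \<le> i \<and> m \<in> M})"
                    by (rule span_base) (use v in fastforce)
                  ultimately show ?thesis by (simp only: span_scale)
                qed
              qed auto
            qed
            then show ?case unfolding descent.simps Q_def[symmetric]
              by (intro span_minimal) (auto simp: Q_def intro: span_base)
          qed
          moreover have "Q (Suc r) \<subseteq> M'"
          proof -
            have "((\<star>) x ^^ i) m = 0" if "Suc r \<le> i" for i m
            proof -
              obtain l where l: "i = l + Suc r" using \<open>Suc r \<le> i\<close> le_iff_add by (metis add.commute)
              have "((\<star>) x ^^ i) m = ((\<star>) x ^^ l) (npow x r \<star> m)"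
                by (simp only: l npow_mult funpow_add o_apply)
              moreover have "((\<star>) x ^^ l) 0 = 0" by (induction l) auto
              ultimately show ?thesis using r by simp
            qed
            then show ?thesis unfolding Q_def
              by (intro span_minimal sM') (auto simp: subspace_0[OF sM'])
          qed
          ultimately have "descent P M M' (Suc r) \<subseteq> M'" by blast
          moreover have "u \<star> v + v \<star> u \<in> P" if u: "u \<in> P" and v: "v \<in> P" for u v
          proof -
            have uvW: "u \<in> W" "v \<in> W" using u v unfolding P_def K_def by blast+
            show ?thesis
            proof (cases "u \<in> K \<or> v \<in> K")
              case True
              then show ?thesis using KJ[of u v] KJ[of v u] uvW unfolding P_def
                by (auto simp: add.commute)
            next
              case False
              with u v obtain c k d l where "u = c *s npow x k" "v = d *s npow x l"
                unfolding P_def by blast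
              then have "u \<star> v + v \<star> u = (c * d + d * c) *s npow x (Suc (k + l))"
                by (simp only: mult_simps npow_add scale_left_distrib scale_scale add.commute[of l] mult.commute[of d])
              then show ?thesis using jordan[OF uvW] unfolding P_def by blast
            qed
          qed
          moreover have "P \<subseteq> W" unfolding P_def K_def by blast
          ultimately show ?thesis unfolding ok_def by blast
        qed
        moreover have "x = 1 *s npow x 0" by simp
        then have "x \<in> P" unfolding P_def using x(1) by blast
        ultimately show False using maximal x(2) by blast
      next
        case False
        have "L \<noteq> M"
        proof
          assume "L = M"
          have "C k = M" for k
          proof (induction k)
            case (Suc k)
            then have "C (Suc k) = L" unfolding L_def C_def by simp
            with \<open>L = M\<close> show ?case by simp
          qed (simp add: C_def)
          with n M'M \<open>M \<noteq> M'\<close> show False unfolding C_def by blast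
        qed
        with LM sL sM have d1: "dim L < dim M" by (metis leI subspace_dim_equal)
        from False M'L sL sM' have d2: "dim M' < dim L" by (metis leI subspace_dim_equal)
        define Y where "Y = {y \<in> W. \<forall>m\<in>L. y \<star> m \<in> L}"
        have YJ: "u \<star> v + v \<star> u \<in> Y" if "u \<in> Y" "v \<in> Y" for u v
          using that jordan unfolding Y_def by (auto simp: jordan_left intro!: subspace_add[OF sL])
        have YW: "Y \<subseteq> W" and YL: "\<And>y m. y \<in> Y \<Longrightarrow> m \<in> L \<Longrightarrow> y \<star> m \<in> L"
          unfolding Y_def by auto
        have "\<exists>k. descent Y M L k \<subseteq> L"
          by (rule less.hyps) (use d1 d2 YJ YW YL nil sM sL LM WM in auto)
        then obtain j where j: "descent Y M L j \<subseteq> L" by blast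
        have "\<exists>k. descent Y L M' k \<subseteq> M'"
          by (rule less.hyps) (use d1 d2 YJ YW YL nil sM' sL M'L WM' in auto)
        then obtain k where k: "descent Y L M' k \<subseteq> M'" by blast
        have "ok Y" using descent_compose[OF j k M'L] YJ YW unfolding ok_def by blast
        moreover have "X \<subseteq> Y"
          using XL XW LM unfolding Y_def by (auto intro: span_base)
        ultimately have "Y \<subseteq> span X" by (rule maximal)
        moreover have "x \<in> Y"
        proof -
          have "x \<star> m \<in> L" if "m \<in> L" for m
          proof -
            from that have "m \<in> span (M' \<union> {b \<star> m | b m. b \<in> X \<and> m \<in> M})"
              by (simp add: L_def C_def)
            then show ?thesis
            proof (rule mult_span_right[rotated 2])
              fix v assume "v \<in> M' \<union> {b \<star> m | b m. b \<in> X \<and> m \<in> M}"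
              then show "x \<star> v \<in> L"
              proof
                assume "v \<in> M'"
                then show ?thesis using WM'[OF x(1)] M'L by blast
              next
                assume "v \<in> {b \<star> m | b m. b \<in> X \<and> m \<in> M}"
                then obtain b m where v: "v = b \<star> m" "b \<in> X" "m \<in> M" by blast
                have "x \<star> v = (x \<star> b + b \<star> x) \<star> m - b \<star> (x \<star> m)"
                  by (simp add: v jordan_left)
                moreover have "(x \<star> b + b \<star> x) \<star> m \<in> L" by (rule XL[OF x(3)[OF v(2)] v(3)])
                moreover have "b \<star> (x \<star> m) \<in> L"
                  by (rule XL) (use v x WM in \<open>auto intro: span_base\<close>)
                ultimately show ?thesis by (simp add: subspace_diff[OF sL])
              qed
            qed (rule sL)
          qed
          then show ?thesis using x(1) unfolding Y_def by blast
        qed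
        ultimately show False using x(2) by blast
      qed
    qed
    then have "descent W M M' n \<subseteq> descent X M M' n"
      using descent_mono[of W "span X" M M M' M' n] descent_span[OF sM, of X M' n] by auto
    with n show ?thesis by blast
  qed
qed

end

section \<open>Eigenvectors and orthogonal idempotents\<close>

locale alg_closed_alternative_algebra = alternative_algebra scale mult Basis
  for scale :: "'f::alg_closed_field \<Rightarrow> 'u::ab_group_add \<Rightarrow> 'u" (infixr \<open>*s\<close> 75)
    and mult :: "'u \<Rightarrow> 'u \<Rightarrow> 'u" (infixl \<open>\<star>\<close> 70)
    and Basis :: "'u set"
begin

text \<open>Annihilating polynomial of \<open>v\<close> of least degree: splitting off a root leaves an eigenvector.\<close>

lemma eigenvector_exists:
  assumes T: "Vector_Spaces.linear scale scale T" and W: "subspace W" "\<And>w. w \<in> W \<Longrightarrow> T w \<in> W"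
    and v: "v \<in> W" "v \<noteq> 0"
  obtains c z where "z \<in> W" "z \<noteq> 0" "T z = c *s z"
proof -
  interpret T: Vector_Spaces.linear scale scale T by fact
  define pe where "pe p = (\<Sum>i\<le>degree p. coeff p i *s (T ^^ i) v)" for p
  have pe_0: "pe 0 = 0" by (simp add: pe_def)
  have pe_pCons: "pe (pCons a p) = a *s v + T (pe p)" for a p
    by (cases "p = 0") (simp_all add: pe_def sum.atMost_Suc_shift T.sum T.scale del: sum.atMost_Suc)
  have pe_add: "pe (p + q) = pe p + pe q" for p q
    by (induction p q rule: poly_induct2) (auto simp: pe_pCons pe_0 T.add algebra_simps)
  have pe_smult: "pe (smult c p) = c *s pe p" for c p
    by (induction p rule: pCons_induct) (auto simp: pe_pCons pe_0 T.scale algebra_simps)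
  have pe_W: "pe p \<in> W" for p
    by (induction p rule: pCons_induct)
      (auto simp: pe_pCons pe_0 subspace_0 W v intro!: subspace_add subspace_scale)
  have pe_monom: "pe (monom 1 n) = (T ^^ n) v" for n
    by (induction n) (auto simp: monom_0 monom_Suc pe_pCons pe_0)
  have "\<exists>n. (T ^^ n) v \<in> span ((\<lambda>i. (T ^^ i) v) ` {..<n})"
  proof (rule ccontr)
    assume "\<not> ?thesis"
    then have "dim ((\<lambda>i. (T ^^ i) v) ` {..<n}) = n" for n
      by (induction n) (auto simp: lessThan_Suc dim_insert)
    from this[of "Suc dimension"] show False
      using dim_subset_UNIV by (metis Suc_n_not_le_n)
  qed
  then obtain n where "(T ^^ n) v \<in> span ((\<lambda>i. (T ^^ i) v) ` {..<n})" by blast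
  moreover have "\<exists>q. y = pe q \<and> coeff q n = 0" if "y \<in> span ((\<lambda>i. (T ^^ i) v) ` {..<n})" for y
    using that
  proof (induction rule: span_induct_alt)
    case base
    show ?case by (intro exI[of _ 0]) (simp add: pe_0)
  next
    case (step c x y)
    then obtain i q where "x = (T ^^ i) v" "i < n" "y = pe q" "coeff q n = 0" by auto
    then show ?case
      by (intro exI[of _ "smult c (monom 1 i) + q"]) (simp add: pe_add pe_smult pe_monom)
  qed
  ultimately obtain q where q: "(T ^^ n) v = pe q" "coeff q n = 0" by blast
  define p where "p = monom 1 n + smult (- 1) q"
  have "pe p = 0" by (simp add: p_def pe_add pe_smult pe_monom q del: smult_minus_left)
  moreover have "p \<noteq> 0"
  proof
    assume "p = 0"
    then have "coeff p n = 0" by simp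
    with q show False by (simp add: p_def)
  qed
  ultimately have "\<exists>p. pe p = 0 \<and> p \<noteq> 0" by blast
  then obtain m where m: "pe m = 0" "m \<noteq> 0" "\<And>r. pe r = 0 \<Longrightarrow> r \<noteq> 0 \<Longrightarrow> degree m \<le> degree r"
    using ex_has_least_nat[of "\<lambda>p. pe p = 0 \<and> p \<noteq> 0" _ degree] by blast
  have "degree m > 0"
  proof (rule ccontr)
    assume "\<not> degree m > 0"
    then obtain a where "m = [:a:]" using degree_eq_zeroE by blast
    with m v show False by (simp add: pe_pCons pe_0)
  qed
  then obtain c where "poly m c = 0" using alg_closed_imp_poly_has_root by blast
  then obtain r where r: "m = [:- c, 1:] * r" by (metis dvdE poly_eq_0_iff_dvd)
  then have "r \<noteq> 0" using m by auto
  then have "degree m = Suc (degree r)" unfolding r by (subst degree_mult_eq) auto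
  with m(3) \<open>r \<noteq> 0\<close> have nz: "pe r \<noteq> 0" by fastforce
  have "m = smult (- c) r + pCons 0 r" by (simp add: r)
  with m(1) have "0 = (- c) *s pe r + T (pe r)"
    by (simp add: pe_add pe_smult pe_pCons del: smult_minus_left)
  then have "T (pe r) = c *s pe r" by simp
  with that nz pe_W show thesis by blast
qed

definition orthogonal_idempotents :: "'u set \<Rightarrow> bool" where
  "orthogonal_idempotents D \<longleftrightarrow> finite D \<and> 0 \<notin> D \<and> (\<forall>a\<in>D. a \<star> a = a)
     \<and> (\<forall>a\<in>D. \<forall>b\<in>D. a \<noteq> b \<longrightarrow> a \<star> b = 0)"

lemma orthogonal_idempotents_card_le:
  assumes "orthogonal_idempotents D" shows "card D \<le> dimension"
proof -
  have fin: "finite D" and id: "\<And>a. a \<in> D \<Longrightarrow> a \<star> a = a" "0 \<notin> D"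
    and orth: "\<And>a b. a \<in> D \<Longrightarrow> b \<in> D \<Longrightarrow> a \<noteq> b \<Longrightarrow> a \<star> b = 0"
    using assms unfolding orthogonal_idempotents_def by auto
  have "a \<notin> span (D - {a})" if a: "a \<in> D" for a
  proof
    assume "a \<in> span (D - {a})"
    then have "a \<star> a \<in> {0}"
      by (rule mult_span_right[rotated 2]) (use a orth in auto)
    with id a show False by auto
  qed
  then have "independent D" unfolding dependent_def by blast
  then show ?thesis using dim_eq_card_independent dim_subset_UNIV by metis
qed

lemma maximal_orthogonal_idempotents:
  "\<exists>E. orthogonal_idempotents E \<and> (\<forall>D. orthogonal_idempotents D \<longrightarrow> card D \<le> card E)"
proof -
  have "orthogonal_idempotents {}" unfolding orthogonal_idempotents_def by simp
  moreover have "\<forall>D. orthogonal_idempotents D \<longrightarrow> card D \<le> dimension"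
    using orthogonal_idempotents_card_le by blast
  ultimately show ?thesis
    using ex_has_greatest_nat[of orthogonal_idempotents "{}" card] by (metis less_Suc_eq_le)
qed

end

section \<open>Peirce decomposition\<close>

text \<open>The index \<open>0\<close> stands for the missing complementary idempotent \<open>1 - \<Sum>E\<close>, so that the
  Peirce components are indexed by \<open>insert 0 E\<close>.\<close>

locale maximal_frame = alg_closed_alternative_algebra scale mult Basis
  for scale :: "'f::alg_closed_field \<Rightarrow> 'u::ab_group_add \<Rightarrow> 'u" (infixr \<open>*s\<close> 75)
    and mult :: "'u \<Rightarrow> 'u \<Rightarrow> 'u" (infixl \<open>\<star>\<close> 70)
    and Basis :: "'u set" +
  fixes E :: "'u set"
  assumes frame: "orthogonal_idempotents E"
    and frame_max: "orthogonal_idempotents D \<Longrightarrow> card D \<le> card E"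
begin

lemma finite_E [simp]: "finite E"
  and E_nonzero: "a \<in> E \<Longrightarrow> a \<noteq> 0"
  and E_idem: "a \<in> E \<Longrightarrow> a \<star> a = a"
  and E_orth: "a \<in> E \<Longrightarrow> b \<in> E \<Longrightarrow> a \<noteq> b \<Longrightarrow> a \<star> b = 0"
  using frame unfolding orthogonal_idempotents_def by auto

lemma zero_notin_E [simp]: "0 \<notin> E"
  using E_nonzero by blast

abbreviation I :: "'u set" where "I \<equiv> insert 0 E"

definition P :: "'u \<Rightarrow> 'u \<Rightarrow> 'u set" where
  "P a b = {x. \<forall>k\<in>E. k \<star> x = (if k = a then x else 0) \<and> x \<star> k = (if k = b then x else 0)}"

lemma P_left: "x \<in> P a b \<Longrightarrow> k \<in> E \<Longrightarrow> k \<star> x = (if k = a then x else 0)"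
  and P_right: "x \<in> P a b \<Longrightarrow> k \<in> E \<Longrightarrow> x \<star> k = (if k = b then x else 0)"
  unfolding P_def by auto

lemma P_left_unit: "x \<in> P a b \<Longrightarrow> a \<in> E \<Longrightarrow> a \<star> x = x"
  and P_right_unit: "x \<in> P a b \<Longrightarrow> b \<in> E \<Longrightarrow> x \<star> b = x"
  by (simp_all add: P_left P_right)

lemma PI:
  assumes "\<And>k. k \<in> E \<Longrightarrow> k \<star> x = (if k = a then x else 0)"
    "\<And>k. k \<in> E \<Longrightarrow> x \<star> k = (if k = b then x else 0)"
  shows "x \<in> P a b"
  unfolding P_def using assms by blast

lemma subspace_P: "subspace (P a b)"
  by (rule subspaceI) (auto simp: P_def mult_simps)

lemma E_in_P: "a \<in> E \<Longrightarrow> a \<in> P a a"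
  by (rule PI) (use E_idem E_orth in auto)

lemma mult_idem_left: "a \<in> E \<Longrightarrow> a \<star> (a \<star> x) = a \<star> x"
  by (simp add: left_alt E_idem)

lemma mult_idem_right: "a \<in> E \<Longrightarrow> (x \<star> a) \<star> a = x \<star> a"
  by (simp add: right_alt E_idem)

text \<open>By the Jordan identity \<open>L\<^sub>a\<close> and \<open>L\<^sub>b\<close> anticommute; two anticommuting idempotent operators have
  product zero away from characteristic two.\<close>

lemma mult_orth_left:
  assumes "a \<in> E" "b \<in> E" "a \<noteq> b" shows "a \<star> (b \<star> x) = 0"
proof -
  have anti: "a \<star> (b \<star> y) = - (b \<star> (a \<star> y))" for y
    using jordan_left[of a b y] E_orth assms by (simp add: eq_neg_iff_add_eq_0)
  define u where "u = a \<star> (b \<star> x)"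
  have "a \<star> u = u" by (simp add: u_def mult_idem_left assms)
  moreover have "b \<star> u = u"
    by (simp add: u_def anti[of x] mult_minus_right mult_idem_left assms)
  ultimately have "u = - u" using anti[of u] by simp
  then show ?thesis using double_zero[of u] by (simp add: u_def eq_neg_iff_add_eq_0)
qed

lemma mult_orth_right:
  assumes "a \<in> E" "b \<in> E" "a \<noteq> b" shows "(x \<star> a) \<star> b = 0"
proof -
  have anti: "(y \<star> a) \<star> b = - ((y \<star> b) \<star> a)" for y
    using jordan_right[of y a b] E_orth assms by (simp add: eq_neg_iff_add_eq_0)
  define u where "u = (x \<star> a) \<star> b"
  have "u \<star> b = u" by (simp add: u_def mult_idem_right assms)
  moreover have "u \<star> a = u"
    by (simp add: u_def anti[of x] mult_minus_left mult_idem_right assms)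
  ultimately have "u = - u" using anti[of u] by simp
  then show ?thesis using double_zero[of u] by (simp add: u_def eq_neg_iff_add_eq_0)
qed

lemma mult_E_assoc:
  assumes "a \<in> E" "b \<in> E" shows "(a \<star> x) \<star> b = a \<star> (x \<star> b)"
proof (cases "a = b")
  case False
  have "associator a x b = - associator a b x" by (rule associator_swap_right)
  also have "\<dots> = 0"
    using E_orth[OF assms False] mult_orth_left[OF assms False] by (simp add: associator_def)
  finally show ?thesis by (simp add: associator_def)
qed (simp add: flexible)

definition left_part :: "'u \<Rightarrow> 'u \<Rightarrow> 'u" where
  "left_part a x = (if a = 0 then x - (\<Sum>k\<in>E. k \<star> x) else a \<star> x)"

definition right_part :: "'u \<Rightarrow> 'u \<Rightarrow> 'u" where
  "right_part b x = (if b = 0 then x - (\<Sum>k\<in>E. x \<star> k) else x \<star> b)"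

definition component :: "'u \<Rightarrow> 'u \<Rightarrow> 'u \<Rightarrow> 'u" where
  "component a b x = left_part a (right_part b x)"

lemma left_part_linear:
  "left_part a (x + y) = left_part a x + left_part a y"
  "left_part a (c *s x) = c *s left_part a x"
  "left_part a 0 = 0"
  by (simp_all add: left_part_def mult_simps sum.distrib scale_sum_right algebra_simps)

lemma right_part_linear:
  "right_part a (x + y) = right_part a x + right_part a y"
  "right_part a (c *s x) = c *s right_part a x"
  "right_part a 0 = 0"
  by (simp_all add: right_part_def mult_simps sum.distrib scale_sum_right algebra_simps)

lemma component_linear:
  "component a b (x + y) = component a b x + component a b y"
  "component a b (c *s x) = c *s component a b x"
  "component a b 0 = 0"
  by (simp_all add: component_def left_part_linear right_part_linear)

lemma left_part_eigen:
  assumes "a \<in> I" "k \<in> E" shows "k \<star> left_part a x = (if k = a then left_part a x else 0)"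
proof (cases "a = 0")
  case True
  have "(\<Sum>l\<in>E. k \<star> (l \<star> x)) = (\<Sum>l\<in>E. if k = l then k \<star> x else 0)"
    by (rule sum.cong) (use assms mult_idem_left mult_orth_left in auto)
  then show ?thesis using True assms
    by (auto simp: left_part_def mult_simps mult_sum_right)
next
  case False
  then show ?thesis using assms mult_idem_left mult_orth_left by (auto simp: left_part_def)
qed

lemma right_part_eigen:
  assumes "b \<in> I" "k \<in> E" shows "right_part b x \<star> k = (if k = b then right_part b x else 0)"
proof (cases "b = 0")
  case True
  have "(\<Sum>l\<in>E. (x \<star> l) \<star> k) = (\<Sum>l\<in>E. if k = l then x \<star> k else 0)"
    by (rule sum.cong) (use assms mult_idem_right mult_orth_right in auto)
  then show ?thesis using True assms
    by (auto simp: right_part_def mult_simps mult_sum_left)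
next
  case False
  then show ?thesis using assms mult_idem_right mult_orth_right by (auto simp: right_part_def)
qed

lemma left_part_mult_E: "a \<in> I \<Longrightarrow> k \<in> E \<Longrightarrow> left_part a x \<star> k = left_part a (x \<star> k)"
  by (auto simp: left_part_def mult_simps mult_sum_left mult_E_assoc)

lemma component_in_P:
  assumes "a \<in> I" "b \<in> I" shows "component a b x \<in> P a b"
  unfolding component_def
  by (rule PI) (use assms left_part_eigen right_part_eigen left_part_mult_E left_part_linear in auto)

lemma sum_left_part: "(\<Sum>a\<in>I. left_part a x) = x"
proof -
  have "(\<Sum>a\<in>E. left_part a x) = (\<Sum>a\<in>E. a \<star> x)"
    by (rule sum.cong) (auto simp: left_part_def)
  then show ?thesis by (simp add: left_part_def)
qed

lemma sum_right_part: "(\<Sum>a\<in>I. right_part a x) = x"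
proof -
  have "(\<Sum>a\<in>E. right_part a x) = (\<Sum>a\<in>E. x \<star> a)"
    by (rule sum.cong) (auto simp: right_part_def)
  then show ?thesis by (simp add: right_part_def)
qed

lemma component_sum: "(\<Sum>b\<in>I. \<Sum>a\<in>I. component a b x) = x"
  unfolding component_def sum_left_part sum_right_part ..

lemma left_part_P:
  assumes "x \<in> P c d" "a \<in> I" "c \<in> I" shows "left_part a x = (if a = c then x else 0)"
proof -
  have "(\<Sum>k\<in>E. k \<star> x) = (\<Sum>k\<in>E. if k = c then x else 0)"
    by (rule sum.cong) (use P_left assms in auto)
  then show ?thesis using assms P_left by (auto simp: left_part_def)
qed

lemma right_part_P:
  assumes "x \<in> P c d" "a \<in> I" "d \<in> I" shows "right_part a x = (if a = d then x else 0)"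
proof -
  have "(\<Sum>k\<in>E. x \<star> k) = (\<Sum>k\<in>E. if k = d then x else 0)"
    by (rule sum.cong) (use P_right assms in auto)
  then show ?thesis using assms P_right by (auto simp: right_part_def)
qed

lemma component_P:
  assumes "x \<in> P c d" "a \<in> I" "b \<in> I" "c \<in> I" "d \<in> I"
  shows "component a b x = (if a = c \<and> b = d then x else 0)"
  unfolding component_def using left_part_P[of x c d a] right_part_P[of x c d b] assms
  by (auto simp: left_part_linear)

lemma peirce_induct [case_names homogeneous add]:
  assumes "\<And>a b x. a \<in> I \<Longrightarrow> b \<in> I \<Longrightarrow> x \<in> P a b \<Longrightarrow> Q x"
    and "\<And>x y. Q x \<Longrightarrow> Q y \<Longrightarrow> Q (x + y)"
  shows "Q x"
proof -
  have "0 \<in> P 0 0" using subspace_P subspace_0 by blast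
  then have Q0: "Q 0" using assms(1)[of 0 0 0] by simp
  have sum: "Q (sum f A)" if "finite A" "\<And>a. a \<in> A \<Longrightarrow> Q (f a)" for f :: "'u \<Rightarrow> 'u" and A
    using that by (induction A rule: finite_induct) (auto simp: Q0 assms(2))
  have "Q (\<Sum>b\<in>I. \<Sum>a\<in>I. component a b x)"
    by (intro sum) (use assms(1) component_in_P in auto)
  then show ?thesis by (simp only: component_sum)
qed

lemma P_zero_if:
  assumes "k \<in> E" "k \<star> z = z" "l \<in> E" "l \<star> z = z" "k \<noteq> l" shows "z = 0"
  using mult_orth_left[of k l z] assms by simp

text \<open>The multiplication rules: \<open>e\<^sub>m\<close> acts on \<open>xy\<close>, for homogeneous \<open>x\<close> and \<open>y\<close>, by an integer which
  must be \<open>0\<close> or \<open>1\<close> since the operators are idempotent. Besides the associative products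
  \<open>P\<^sub>a\<^sub>b P\<^sub>b\<^sub>d \<subseteq> P\<^sub>a\<^sub>d\<close>, only \<open>P\<^sub>a\<^sub>b P\<^sub>a\<^sub>b \<subseteq> P\<^sub>b\<^sub>a\<close> survives.\<close>

lemma mult_eigen_left:
  assumes "x \<in> P a b" "y \<in> P c d" "k \<in> E"
  shows "k \<star> (x \<star> y) = (if k = a then x \<star> y else 0) + (if k = b then x \<star> y else 0)
    - (if k = c then x \<star> y else 0)"
  using associator_swap_left[of k x y] P_left[OF assms(1,3)] P_right[OF assms(1,3)]
    P_left[OF assms(2,3)]
  by (auto simp: associator_def algebra_simps split: if_splits)

lemma mult_eigen_right:
  assumes "x \<in> P a b" "y \<in> P c d" "k \<in> E"
  shows "(x \<star> y) \<star> k = (if k = d then x \<star> y else 0) + (if k = c then x \<star> y else 0)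
    - (if k = b then x \<star> y else 0)"
  using associator_swap_right[of x y k] P_right[OF assms(1,3)] P_left[OF assms(2,3)]
    P_right[OF assms(2,3)]
  by (auto simp: associator_def algebra_simps split: if_splits)

lemma P_mult: "x \<in> P a b \<Longrightarrow> y \<in> P b d \<Longrightarrow> x \<star> y \<in> P a d"
  by (rule PI) (simp_all only: mult_eigen_left[of x a b y b d] mult_eigen_right[of x a b y b d], auto)

lemma P_mult_same: "x \<in> P a b \<Longrightarrow> y \<in> P a b \<Longrightarrow> x \<star> y \<in> P b a"
  by (rule PI) (simp_all only: mult_eigen_left[of x a b y a b] mult_eigen_right[of x a b y a b], auto)

lemma P_mult_zero:
  assumes I: "a \<in> I" "b \<in> I" "c \<in> I" "d \<in> I" and x: "x \<in> P a b" and y: "y \<in> P c d"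
    and bc: "b \<noteq> c" and ne: "\<not> (c = a \<and> d = b)"
  shows "x \<star> y = 0"
proof -
  define z where "z = x \<star> y"
  note L = mult_eigen_left[OF x y, folded z_def] and R = mult_eigen_right[OF x y, folded z_def]
  have neg: "z = 0" if "k \<star> z = - z \<or> z \<star> k = - z" "k \<in> E" for k
  proof -
    have "- (- z) = - z"
      using that mult_idem_left[of k z] mult_idem_right[of k z]
      by (metis mult_minus_left mult_minus_right)
    then show ?thesis using double_zero[of z] by (simp add: eq_neg_iff_add_eq_0)
  qed
  have two: "z = 0" if "k \<star> z = z + z \<or> z \<star> k = z + z" "k \<in> E" for k
  proof -
    have "(z + z) + (z + z) = z + z"
      using that mult_idem_left[of k z] mult_idem_right[of k z]
      by (metis mult_add_left mult_add_right)
    then have "z + z = 0" by simp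
    then show ?thesis by (rule double_zero)
  qed
  from ne consider "c \<noteq> a" | "d \<noteq> b" by blast
  then have "z = 0"
  proof cases
    case 1
    show ?thesis
    proof (cases "c = 0")
      case False
      then have "c \<in> E" using I by auto
      then show ?thesis using neg[of c] L[of c] 1 bc by auto
    next
      case True
      then have aE: "a \<in> E" and bE: "b \<in> E" using I 1 bc by auto
      show ?thesis
      proof (cases "a = b")
        case True
        then show ?thesis using two[of a] L[of a] aE 1 by auto
      next
        case False
        then show ?thesis using L[of a] L[of b] aE bE 1 bc P_zero_if[of a z b] by auto
      qed
    qed
  next
    case 2
    show ?thesis
    proof (cases "b = 0")
      case False
      then have "b \<in> E" using I by auto
      then show ?thesis using neg[of b] R[of b] 2 bc by auto
    next
      case True
      then have cE: "c \<in> E" and dE: "d \<in> E" using I 2 bc by auto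
      show ?thesis
      proof (cases "c = d")
        case True
        then show ?thesis using two[of c] R[of c] cE bc 2 by auto
      next
        case False
        then have "z \<star> c = z" "z \<star> d = z" using R[of c] R[of d] cE dE 2 bc by auto
        then show ?thesis using mult_orth_right[OF cE dE False, of z] by simp
      qed
    qed
  qed
  then show ?thesis by (simp add: z_def)
qed

text \<open>An associator changes at most its sign under permutations of its arguments, so it vanishes
  once the two products in one of the arrangements do.\<close>

lemma P_assoc:
  assumes I: "a \<in> I" "b \<in> I" "c \<in> I" "d \<in> I"
    and x: "x \<in> P a b" and y: "y \<in> P b c" and z: "z \<in> P c d"
    and ne: "\<not> (b = c \<and> c = d)" "\<not> (a = b \<and> b = c)" "\<not> (c = a \<and> d = b)"
  shows "(x \<star> y) \<star> z = x \<star> (y \<star> z)"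
proof -
  have xz: "x \<star> z = 0" if "b \<noteq> c" by (rule P_mult_zero[OF _ _ _ _ x z]) (use I ne that in auto)
  have zy: "z \<star> y = 0" if "d \<noteq> b" by (rule P_mult_zero[OF _ _ _ _ z y]) (use I ne that in auto)
  have yx: "y \<star> x = 0" if "c \<noteq> a" by (rule P_mult_zero[OF _ _ _ _ y x]) (use I ne that in auto)
  consider "b \<noteq> c" "d \<noteq> b" | "b \<noteq> c" "c \<noteq> a" | "d \<noteq> b" "c \<noteq> a" using ne by blast
  then have "associator x y z = 0"
  proof cases
    case 1
    then show ?thesis using associator_swap_right[of x y z] xz zy by (simp add: associator_def)
  next
    case 2
    then show ?thesis using associator_swap_left[of x y z] xz yx by (simp add: associator_def)
  next
    case 3
    then show ?thesis using associator_swap_outer[of x y z] zy yx by (simp add: associator_def)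
  qed
  then show ?thesis by (simp add: associator_def)
qed

text \<open>The square lies in \<open>P\<^sub>b\<^sub>a\<close>, and the idempotent acting there as a unit kills it by alternativity.\<close>

lemma offdiag_square_zero:
  assumes "x \<in> P a b" "a \<noteq> b" "a \<in> I" "b \<in> I" shows "x \<star> x = 0"
proof (cases "a = 0")
  case False
  then have a: "a \<in> E" using assms by auto
  have "x \<star> x = (x \<star> x) \<star> a" using P_right_unit[OF P_mult_same a] assms by simp
  also have "\<dots> = x \<star> (x \<star> a)" using left_alt by simp
  finally show ?thesis using P_right[OF assms(1) a] assms(2) by simp
next
  case True
  then have b: "b \<in> E" using assms by auto
  have "x \<star> x = b \<star> (x \<star> x)" using P_left_unit[OF P_mult_same b] assms by simp
  also have "\<dots> = (b \<star> x) \<star> x" using right_alt by simp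
  finally show ?thesis using P_left[OF assms(1) b] assms(2) by simp
qed

lemma offdiag_anticommute:
  assumes "x \<in> P a b" "y \<in> P a b" "a \<noteq> b" "a \<in> I" "b \<in> I" shows "x \<star> y = - (y \<star> x)"
proof -
  have "(x + y) \<star> (x + y) = 0"
    by (rule offdiag_square_zero[of _ a b]) (use assms subspace_add[OF subspace_P] in auto)
  then show ?thesis using offdiag_square_zero[of x a b] offdiag_square_zero[of y a b] assms
    by (simp add: mult_simps eq_neg_iff_add_eq_0 add.commute)
qed

end

section \<open>Local Peirce algebras and the trace form\<close>

context maximal_frame begin

lemma subalgebra_P: "subalgebra (P a a)"
  unfolding subalgebra_def using subspace_P P_mult by blast

text \<open>Otherwise replacing \<open>a\<close> by the two idempotents \<open>f\<close> and \<open>a - f\<close> would enlarge the frame.\<close>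

lemma frame_primitive:
  assumes a: "a \<in> E" and f: "f \<in> P a a" "f \<star> f = f" shows "f = 0 \<or> f = a"
proof (rule ccontr)
  assume "\<not> ?thesis"
  then have f0: "f \<noteq> 0" and fa: "f \<noteq> a" by auto
  have af: "a \<star> f = f" "f \<star> a = f" using P_left_unit P_right_unit f a by auto
  define g where "g = a - f"
  have g: "g \<in> P a a" "g \<star> g = g" "f \<star> g = 0" "g \<star> f = 0" "g \<noteq> 0"
    using f fa af E_idem[OF a] subspace_diff[OF subspace_P E_in_P[OF a] f(1)]
    by (auto simp: g_def mult_simps)
  have fg: "f \<noteq> g" using g f f0 by auto
  have notin: "h \<notin> E - {a}" if "h \<in> P a a" "h \<noteq> 0" for h
    using that P_left[of h a a h] E_idem[of h] by (auto split: if_splits)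
  have "orthogonal_idempotents (insert f (insert g (E - {a})))"
    unfolding orthogonal_idempotents_def
    using f g f0 E_idem E_orth P_left[OF f(1)] P_right[OF f(1)] P_left[OF g(1)] P_right[OF g(1)]
    by auto
  from frame_max[OF this] show False
    using notin f f0 g fg a card_Suc_Diff1[OF finite_E a] by simp
qed

lemma P00_idempotent:
  assumes f: "f \<in> P 0 0" "f \<star> f = f" shows "f = 0"
proof (rule ccontr)
  assume f0: "f \<noteq> 0"
  have "f \<notin> E" using P_left[OF f(1), of f] f f0 by auto
  moreover have "orthogonal_idempotents (insert f E)"
    unfolding orthogonal_idempotents_def
    using f f0 E_idem E_orth P_left[OF f(1)] P_right[OF f(1)] by auto
  ultimately show False using frame_max by fastforce
qed

lemma nilp_P00: "x \<in> P 0 0 \<Longrightarrow> nilp x"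
  using idempotent_from_non_nilpotent[of x] span_npow_in_subalgebra[OF subalgebra_P, of x 0]
    P00_idempotent by (metis subsetD)

text \<open>For an eigenvector \<open>z\<close> of \<open>x\<close> the shifted element kills \<open>z\<close>. Were it not nilpotent, the idempotent
  in the span of its powers would have to be the unit \<open>a\<close>, which does not kill \<open>z\<close>.\<close>

lemma local_eigenvalue:
  assumes a: "a \<in> E" and x: "x \<in> P a a" obtains c where "nilp (x - c *s a)"
proof -
  have aP: "a \<in> P a a" by (rule E_in_P[OF a])
  from eigenvector_exists[OF mult_linear_right[of x] subspace_P[of a a] _ aP E_nonzero[OF a]]
  obtain c z where z: "z \<in> P a a" "z \<noteq> 0" "x \<star> z = c *s z" using x P_mult by metis
  define y where "y = x - c *s a"
  have yP: "y \<in> P a a" unfolding y_def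
    by (intro subspace_diff subspace_scale subspace_P x aP)
  have yz: "y \<star> z = 0" using z P_left_unit[OF z(1) a] by (simp add: y_def mult_simps)
  have "nilp y"
  proof (rule ccontr)
    assume "\<not> nilp y"
    then obtain f k where f: "f \<in> span (range (npow y))" "f \<noteq> 0" "f \<star> f = f"
      using idempotent_from_non_nilpotent by metis
    have "f \<in> P a a" using span_npow_in_subalgebra[OF subalgebra_P yP] f(1) by blast
    with f frame_primitive[OF a] have "f = a" by blast
    have zero: "((\<star>) y ^^ i) 0 = 0" for i by (induction i) auto
    have "npow y i \<star> z = 0" for i
      by (simp add: npow_mult funpow_Suc_right yz zero del: funpow.simps)
    then have "f \<star> z \<in> {0}" by (intro mult_span_left[OF _ _ f(1)]) auto
    with \<open>f = a\<close> P_left_unit[OF z(1) a] z(2) show False by simp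
  qed
  with that show thesis unfolding y_def by blast
qed

text \<open>The highest nonzero power of \<open>x\<close> is annihilated by \<open>x y\<close> and by \<open>y x\<close> on one side, so the
  eigenvalues of these two elements are zero.\<close>

lemma nilp_mult_P:
  assumes a: "a \<in> E" and x: "x \<in> P a a" "nilp x" and y: "y \<in> P a a"
  shows "nilp (x \<star> y)" "nilp (y \<star> x)"
proof -
  have "nilp (x \<star> y) \<and> nilp (y \<star> x)"
  proof (cases "x = 0")
    case False
    from nilp_top_power[OF x(2) this]
    obtain m where m: "npow x m \<noteq> 0" "npow x (Suc m) = 0" by blast
    define z where "z = npow x m"
    have z: "z \<in> P a a" unfolding z_def by (rule npow_in_subalgebra[OF subalgebra_P x(1)])
    have "z \<star> (x \<star> y) = ((\<star>) x ^^ Suc (Suc m)) y"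
      by (simp only: z_def npow_mult) (simp add: funpow_swap1)
    then have 1: "z \<star> (x \<star> y) = 0"
      using m npow_mult[of x "Suc m" y] by simp
    have "(y \<star> x) \<star> z = ((\<lambda>w. w \<star> x) ^^ Suc (Suc m)) y"
      by (simp only: z_def mult_npow) (simp add: funpow_swap1[of "\<lambda>w. w \<star> x"])
    then have 2: "(y \<star> x) \<star> z = 0"
      using m mult_npow[of y x "Suc m"] by simp
    obtain c where c: "nilp (x \<star> y - c *s a)"
      using local_eigenvalue[OF a P_mult[OF x(1) y]] by blast
    have "z \<star> (x \<star> y - c *s a) = (- c) *s z"
      using 1 P_right_unit[OF z a] by (simp add: mult_simps)
    from nilp_eigen_right[OF c this] m have "c = 0" by (simp add: z_def)
    moreover obtain d where d: "nilp (y \<star> x - d *s a)"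
      using local_eigenvalue[OF a P_mult[OF y x(1)]] by blast
    have "(y \<star> x - d *s a) \<star> z = (- d) *s z"
      using 2 P_left_unit[OF z a] by (simp add: mult_simps)
    from nilp_eigen_left[OF d this] m have "d = 0" by (simp add: z_def)
    ultimately show ?thesis using c d by simp
  qed simp
  then show "nilp (x \<star> y)" "nilp (y \<star> x)" by auto
qed

lemma nilp_scale:
  assumes "a \<in> E" "x \<in> P a a" "nilp x" shows "nilp (c *s x)"
  using nilp_mult_P(1)[OF assms, of "c *s a"] subspace_scale[OF subspace_P E_in_P[OF assms(1)]]
    P_right_unit[OF assms(2,1)] by (simp add: mult_simps)

lemma local_inverse:
  assumes a: "a \<in> E" and u: "u \<in> P a a" "\<not> nilp u"
  obtains w where "w \<in> P a a" "u \<star> w = a"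
proof -
  obtain c where c: "nilp (u - c *s a)" using local_eigenvalue[OF a u(1)] by blast
  have c0: "c \<noteq> 0" using c u(2) by auto
  have "z = 0" if "z \<in> P a a" "u \<star> z = 0" for z
  proof (rule ccontr)
    assume "z \<noteq> 0"
    have "(u - c *s a) \<star> z = (- c) *s z" using that P_left_unit[OF _ a] by (simp add: mult_simps)
    from nilp_eigen_left[OF c this \<open>z \<noteq> 0\<close>] c0 show False by simp
  qed
  then have "(\<star>) u ` P a a = P a a"
    by (intro inj_endo_surj mult_linear_right subspace_P) (use u P_mult in auto)
  then show thesis using that E_in_P[OF a] by (metis imageE)
qed

text \<open>If \<open>x + y\<close> had a right inverse \<open>w\<close>, then \<open>a = x w + y w\<close> would be a sum of two nilpotent elements
  \<open>g\<close> and \<open>h\<close>; on the highest nonzero power of \<open>h\<close> the element \<open>g = a - h\<close> would act as the identity.\<close>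

lemma nilp_add:
  assumes a: "a \<in> E" and x: "x \<in> P a a" "nilp x" and y: "y \<in> P a a" "nilp y"
  shows "nilp (x + y)"
proof (rule ccontr)
  assume "\<not> nilp (x + y)"
  from local_inverse[OF a _ this] obtain w where w: "w \<in> P a a" "(x + y) \<star> w = a"
    using subspace_add[OF subspace_P] x y by metis
  define g h where "g = x \<star> w" and "h = y \<star> w"
  have g: "nilp g" and h: "nilp h" "h \<in> P a a" and gh: "g = a - h"
    using nilp_mult_P(1)[OF a x w(1)] nilp_mult_P(1)[OF a y w(1)] P_mult[OF y(1) w(1)] w(2)
    by (auto simp: g_def h_def mult_simps)
  show False
  proof (cases "h = 0")
    case True
    with g gh idempotent_not_nilp[OF E_idem[OF a] E_nonzero[OF a]] show False by simp
  next
    case False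
    from nilp_top_power[OF h(1) this]
    obtain m where m: "npow h m \<noteq> 0" "npow h (Suc m) = 0" by blast
    have "npow h m \<in> P a a" by (rule npow_in_subalgebra[OF subalgebra_P h(2)])
    then have "npow h m \<star> g = 1 *s npow h m"
      using P_right_unit[OF _ a] m npow_commute[of h m] by (simp add: gh mult_simps)
    from nilp_eigen_right[OF g this m(1)] show False by simp
  qed
qed

text \<open>The residue of a local Peirce algebra \<open>P\<^sub>a\<^sub>a = F a + nil\<close>, set to zero on \<open>P\<^sub>0\<^sub>0\<close>.\<close>
definition residue :: "'u \<Rightarrow> 'u \<Rightarrow> 'f" where
  "residue a x = (if a \<in> E then SOME c. nilp (x - c *s a) else 0)"

lemma nilp_residue:
  assumes "a \<in> I" "x \<in> P a a" shows "nilp (x - residue a x *s a)"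
proof (cases "a \<in> E")
  case True
  obtain c where "nilp (x - c *s a)" by (rule local_eigenvalue[OF True assms(2)])
  then have "nilp (x - (SOME c. nilp (x - c *s a)) *s a)"
    by (rule someI[of "\<lambda>c. nilp (x - c *s a)"])
  then show ?thesis using True by (simp add: residue_def)
next
  case False
  then show ?thesis using assms nilp_P00 by simp
qed

lemma nilp_part_in_P: "a \<in> E \<Longrightarrow> x \<in> P a a \<Longrightarrow> x - c *s a \<in> P a a"
  by (intro subspace_diff subspace_scale subspace_P E_in_P)

lemma residue_eqI:
  assumes a: "a \<in> E" and x: "x \<in> P a a" "nilp (x - c *s a)" shows "residue a x = c"
proof -
  define d where "d = residue a x"
  have d: "nilp (x - d *s a)" unfolding d_def by (rule nilp_residue) (use assms in auto)
  have "nilp ((-1) *s (x - d *s a))"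
    by (rule nilp_scale[OF a nilp_part_in_P[OF a x(1)] d])
  then have "nilp ((x - c *s a) + (-1) *s (x - d *s a))"
    by (intro nilp_add[OF a] nilp_part_in_P x subspace_scale[OF subspace_P]) (use a in auto)
  moreover have "(x - c *s a) + (-1) *s (x - d *s a) = (d - c) *s a"
    by (simp add: algebra_simps)
  ultimately have "nilp ((d - c) *s a)" by simp
  from nilp_eigen_left[OF this, of a "d - c"] show ?thesis
    using E_nonzero[OF a] E_idem[OF a] by (simp add: mult_simps d_def)
qed

lemma residue_add:
  assumes "a \<in> I" "x \<in> P a a" "y \<in> P a a" shows "residue a (x + y) = residue a x + residue a y"
proof (cases "a \<in> E")
  case True
  have "nilp ((x - residue a x *s a) + (y - residue a y *s a))"
    by (intro nilp_add[OF True] nilp_part_in_P nilp_residue) (use True assms in auto)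
  then have "nilp ((x + y) - (residue a x + residue a y) *s a)" by (simp add: algebra_simps)
  then show ?thesis by (rule residue_eqI[OF True subspace_add[OF subspace_P assms(2,3)]])
qed (simp add: residue_def)

lemma residue_scale:
  assumes "a \<in> I" "x \<in> P a a" shows "residue a (c *s x) = c * residue a x"
proof (cases "a \<in> E")
  case True
  have "nilp (c *s (x - residue a x *s a))"
    by (intro nilp_scale[OF True] nilp_part_in_P nilp_residue) (use True assms in auto)
  then have "nilp (c *s x - (c * residue a x) *s a)" by (simp add: algebra_simps)
  then show ?thesis by (rule residue_eqI[OF True subspace_scale[OF subspace_P assms(2)]])
qed (simp add: residue_def)

lemma residue_self: "a \<in> E \<Longrightarrow> residue a a = 1"
  by (rule residue_eqI) (simp_all add: E_in_P)

lemma residue_nilp: "a \<in> E \<Longrightarrow> x \<in> P a a \<Longrightarrow> nilp x \<Longrightarrow> residue a x = 0"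
  by (rule residue_eqI) simp_all

lemma residue_mult:
  assumes "a \<in> I" "x \<in> P a a" "y \<in> P a a" shows "residue a (x \<star> y) = residue a x * residue a y"
proof (cases "a \<in> E")
  case True
  define p q where "p = x - residue a x *s a" and "q = y - residue a y *s a"
  have pq: "p \<in> P a a" "q \<in> P a a" "nilp p" "nilp q"
    unfolding p_def q_def using True assms nilp_part_in_P nilp_residue by auto
  have "x \<star> y = x \<star> q + residue a y *s x"
    using P_right_unit[OF assms(2) True] by (simp add: q_def mult_simps)
  moreover have "residue a (x \<star> q) = 0"
    by (rule residue_nilp[OF True P_mult[OF assms(2) pq(2)] nilp_mult_P(2)[OF True pq(2,4) assms(2)]])
  ultimately show ?thesis
    using assms residue_add[of a "x \<star> q" "residue a y *s x"] residue_scale[of a x "residue a y"]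
      P_mult[OF assms(2) pq(2)] subspace_scale[OF subspace_P assms(2)] by (simp add: mult.commute)
qed (simp add: residue_def)

text \<open>Both sides are eigenvalues: if \<open>p = xy - \<lambda>\<close> and \<open>q = yx - \<mu>\<close> are the nilpotent parts, then
  \<open>p x - x q = (\<mu> - \<lambda>) x\<close>, and \<open>L\<^sub>p\<close> and \<open>R\<^sub>q\<close> are commuting nilpotent operators on \<open>P\<^sub>a\<^sub>b\<close>.\<close>

lemma residue_swap:
  assumes I: "a \<in> I" "b \<in> I" "a \<noteq> b" and x: "x \<in> P a b" and y: "y \<in> P b a"
  shows "residue a (x \<star> y) = residue b (y \<star> x)"
proof (cases "x = 0")
  case True
  have "residue k 0 = 0" if "k \<in> I" for k
    using residue_scale[of k 0 0] that subspace_0[OF subspace_P] by auto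
  then show ?thesis using True I by simp
next
  case False
  define l m where "l = residue a (x \<star> y)" and "m = residue b (y \<star> x)"
  define p q where "p = x \<star> y - l *s a" and "q = y \<star> x - m *s b"
  have Paa: "x \<star> y \<in> P a a" and Pbb: "y \<star> x \<in> P b b" using P_mult x y by auto
  have ka: "k *s a \<in> P a a" if "a \<in> I" for k a
    using that subspace_scale[OF subspace_P E_in_P] subspace_0[OF subspace_P] by auto
  have p: "p \<in> P a a" "nilp p" and q: "q \<in> P b b" "nilp q"
    unfolding p_def q_def l_def m_def
    using nilp_residue[of a] nilp_residue[of b] I Paa Pbb subspace_diff[OF subspace_P] ka by auto
  have lx: "l *s (a \<star> x) = l *s x"
    using I P_left_unit[OF x] by (auto simp: l_def residue_def mult_simps)
  have mx: "m *s (x \<star> b) = m *s x"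
    using I P_right_unit[OF x] by (auto simp: m_def residue_def mult_simps)
  have rel: "p \<star> x = x \<star> q + (m - l) *s x"
  proof -
    have "p \<star> x = x \<star> (y \<star> x) - l *s x" by (simp only: p_def mult_simps flexible lx)
    moreover have "x \<star> q = x \<star> (y \<star> x) - m *s x" by (simp only: q_def mult_simps mx)
    ultimately show ?thesis by (simp add: algebra_simps)
  qed
  have iter: "((\<star>) p ^^ k) x \<in> P a b" for k
    by (induction k) (use x p P_mult in auto)
  have comm: "((\<star>) p ^^ k) (x \<star> q) = ((\<star>) p ^^ k) x \<star> q" for k
  proof (induction k)
    case (Suc k)
    have "(p \<star> ((\<star>) p ^^ k) x) \<star> q = p \<star> (((\<star>) p ^^ k) x \<star> q)"
      by (rule P_assoc[OF _ _ _ _ p(1) iter q(1)]) (use I in auto)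
    with Suc show ?case by simp
  qed simp
  have lin: "((\<star>) p ^^ k) (u + c *s v) = ((\<star>) p ^^ k) u + c *s ((\<star>) p ^^ k) v" for k u c v
    by (induction k) (auto simp: mult_simps)
  obtain r where "npow p r = 0" using p unfolding nilp_def by blast
  then have "((\<star>) p ^^ Suc r) x = 0" using npow_mult[of p r x] by simp
  then have "\<exists>k. ((\<star>) p ^^ k) x = 0" by blast
  then obtain k where k: "((\<star>) p ^^ k) x = 0" "\<And>j. j < k \<Longrightarrow> ((\<star>) p ^^ j) x \<noteq> 0"
    using exists_least_iff[of "\<lambda>k. ((\<star>) p ^^ k) x = 0"] by blast
  with False obtain j where j: "k = Suc j" by (cases k) auto
  define z where "z = ((\<star>) p ^^ j) x"
  have z0: "z \<noteq> 0" using k j z_def by simp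
  have "0 = ((\<star>) p ^^ j) (p \<star> x)" using k(1) by (simp add: j funpow_swap1)
  also have "\<dots> = z \<star> q + (m - l) *s z" by (simp add: rel lin comm z_def)
  finally have "z \<star> q = (l - m) *s z" by (simp add: algebra_simps eq_neg_iff_add_eq_0)
  from nilp_eigen_right[OF q(2) this z0] show ?thesis by (simp add: l_def m_def)
qed

text \<open>Modulo the radical this is the reduced trace. Traces of multiplication operators would
  carry multiplicities that may vanish in positive characteristic.\<close>
definition tr :: "'u \<Rightarrow> 'f" where
  "tr x = (\<Sum>a\<in>E. residue a (component a a x))"

lemma tr_add: "tr (x + y) = tr x + tr y"
  by (simp add: tr_def component_linear residue_add component_in_P sum.distrib)

lemma tr_scale: "tr (c *s x) = c * tr x"
  by (simp add: tr_def component_linear residue_scale component_in_P sum_distrib_left)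

lemma tr_0 [simp]: "tr 0 = 0"
  using tr_scale[of 0 0] by simp

lemma tr_minus: "tr (- x) = - tr x"
  using tr_scale[of "- 1" x] by simp

lemma tr_diff: "tr (x - y) = tr x - tr y"
  using tr_add[of x "- y"] by (simp add: tr_minus)

lemma tr_diag:
  assumes "a \<in> I" "x \<in> P a a" shows "tr x = residue a x"
proof -
  have z: "residue k 0 = 0" if "k \<in> E" for k
    using residue_scale[of k 0 0] that subspace_0[OF subspace_P] by auto
  have "tr x = (\<Sum>k\<in>E. if k = a then residue a x else 0)"
    unfolding tr_def by (rule sum.cong) (use assms component_P[OF assms(2)] z in auto)
  then show ?thesis using assms by (auto simp: residue_def)
qed

lemma tr_offdiag:
  assumes "a \<in> I" "b \<in> I" "a \<noteq> b" "x \<in> P a b" shows "tr x = 0"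
proof -
  have z: "residue k 0 = 0" if "k \<in> E" for k
    using residue_scale[of k 0 0] that subspace_0[OF subspace_P] by auto
  show ?thesis unfolding tr_def
    by (rule sum.neutral) (use assms component_P[OF assms(4)] z in auto)
qed

lemma tr_mult_zero:
  assumes I: "a \<in> I" "b \<in> I" "c \<in> I" "d \<in> I" and x: "x \<in> P a b" and y: "y \<in> P c d"
    and ne: "\<not> (b = c \<and> d = a)"
  shows "tr (x \<star> y) = 0"
proof (cases "b = c")
  case True
  with ne x y I P_mult[of x a b y d] tr_offdiag[of a d] show ?thesis by auto
next
  case False
  show ?thesis
  proof (cases "c = a \<and> d = b")
    case True
    with False x y I P_mult_same[of x a b y] tr_offdiag[of b a] show ?thesis by auto
  next
    case ne2: False
    from P_mult_zero[OF I x y False ne2] show ?thesis by simp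
  qed
qed

theorem tr_commute: "tr (x \<star> y) = tr (y \<star> x)"
proof (induction x arbitrary: y rule: peirce_induct)
  case (homogeneous a b x)
  note I = homogeneous(1,2) and x = homogeneous(3)
  show ?case
  proof (induction y rule: peirce_induct)
    case (homogeneous c d y)
    show ?case
    proof (cases "b = c \<and> d = a")
      case True
      then have y: "y \<in> P b a" using homogeneous by simp
      show ?thesis
      proof (cases "a = b")
        case True
        then show ?thesis using x y I P_mult[of x a a y a] P_mult[of y a a x a]
          by (simp add: tr_diag[of a] residue_mult mult.commute)
      next
        case False
        then show ?thesis using x y I P_mult[OF x y] P_mult[OF y x] residue_swap[OF I False x y]
          by (simp add: tr_diag[of a] tr_diag[of b])
      qed
    next
      case False
      then show ?thesis using tr_mult_zero[OF I homogeneous(1,2) x homogeneous(3)]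
        tr_mult_zero[OF homogeneous(1,2) I homogeneous(3) x] by auto
    qed
  qed (simp add: mult_simps tr_add)
qed (simp add: mult_simps tr_add)

text \<open>The trace sees only the products \<open>P\<^sub>a\<^sub>b P\<^sub>b\<^sub>c P\<^sub>c\<^sub>a\<close>, which are associative unless \<open>a = b = c\<close>, where
  the residue is multiplicative, and the products \<open>P\<^sub>a\<^sub>b P\<^sub>a\<^sub>b P\<^sub>a\<^sub>b\<close>, where it is an alternating
  trilinear form.\<close>

theorem tr_assoc: "tr ((x \<star> y) \<star> z) = tr (x \<star> (y \<star> z))"
proof (induction x arbitrary: y z rule: peirce_induct)
  case (homogeneous a b x)
  note Ix = homogeneous(1,2) and x = homogeneous(3)
  show ?case
  proof (induction y arbitrary: z rule: peirce_induct)
    case (homogeneous c d y)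
    note Iy = homogeneous(1,2) and y = homogeneous(3)
    show ?case
    proof (induction z rule: peirce_induct)
      case (homogeneous m n z)
      note Iz = homogeneous(1,2) and z = homogeneous(3)
      consider (cyc) "b = c" "d = m" "n = a"
        | (same) "a \<noteq> b" "c = a" "d = b" "m = a" "n = b"
        | (other) "\<not> (b = c \<and> d = m \<and> n = a)" "\<not> (a \<noteq> b \<and> c = a \<and> d = b \<and> m = a \<and> n = b)"
        by blast
      then show ?case
      proof cases
        case cyc
        then have y: "y \<in> P b d" and z: "z \<in> P d a" using y z by auto
        show ?thesis
        proof (cases "a = b \<and> b = d")
          case True
          then have "x \<in> P a a" "y \<in> P a a" "z \<in> P a a" using x y z by auto
          moreover from this have "x \<star> y \<in> P a a" "y \<star> z \<in> P a a"
            "(x \<star> y) \<star> z \<in> P a a" "x \<star> (y \<star> z) \<in> P a a"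
            by (blast intro: P_mult)+
          ultimately show ?thesis using Ix by (simp add: tr_diag[of a] residue_mult mult.assoc)
        next
          case False
          have "(x \<star> y) \<star> z = x \<star> (y \<star> z)"
            by (rule P_assoc[OF _ _ _ _ x y z]) (use Ix Iy False in auto)
          then show ?thesis by simp
        qed
      next
        case same
        then have y: "y \<in> P a b" and z: "z \<in> P a b" using y z by auto
        have "tr ((x \<star> y) \<star> z) = - tr ((y \<star> x) \<star> z)"
          using offdiag_anticommute[OF x y same(1) Ix] by (simp add: mult_simps tr_minus)
        moreover have "tr ((y \<star> x) \<star> z) = - tr ((y \<star> z) \<star> x)"
        proof -
          have "(x + z) \<star> (x + z) = 0"
            by (rule offdiag_square_zero[of _ a b]) (use x z Ix same subspace_add[OF subspace_P] in auto)
          then have "(y \<star> (x + z)) \<star> (x + z) = 0" by (simp only: right_alt mult_zero)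
          moreover have "(y \<star> x) \<star> x = 0" "(y \<star> z) \<star> z = 0"
            using right_alt offdiag_square_zero[of x a b] offdiag_square_zero[of z a b] x z Ix same
            by auto
          ultimately have "(y \<star> x) \<star> z + (y \<star> z) \<star> x = 0" by (simp add: mult_simps add.commute)
          then show ?thesis using tr_minus by (metis eq_neg_iff_add_eq_0)
        qed
        ultimately show ?thesis using tr_commute[of "y \<star> z" x] by simp
      next
        case other
        have "tr ((x \<star> y) \<star> z) = 0"
        proof (cases "b = c")
          case True
          then show ?thesis using tr_mult_zero[of a d m n "x \<star> y" z] P_mult[of x a b y d] x y z Ix Iy Iz other
            by auto
        next
          case False
          show ?thesis
          proof (cases "c = a \<and> d = b")
            case True
            then show ?thesis using tr_mult_zero[of b a m n "x \<star> y" z] P_mult_same[of x a b y] x y z Ix Iz other False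
              by auto
          next
            case F: False
            show ?thesis using P_mult_zero[OF Ix Iy x y False F] by simp
          qed
        qed
        moreover have "tr (x \<star> (y \<star> z)) = 0"
        proof (cases "d = m")
          case True
          then show ?thesis using tr_mult_zero[of a b c n x "y \<star> z"] P_mult[of y c d z n] x y z Ix Iy Iz other
            by auto
        next
          case False
          show ?thesis
          proof (cases "m = c \<and> n = d")
            case True
            then show ?thesis using tr_mult_zero[of a b d c x "y \<star> z"] P_mult_same[of y c d z] x y z Ix Iy Iz other False
              by auto
          next
            case F: False
            show ?thesis using P_mult_zero[OF Iy Iz y z False F] by simp
          qed
        qed
        ultimately show ?thesis by simp
      qed
    qed (simp add: mult_simps tr_add)
  qed (simp add: mult_simps tr_add)
qed (simp add: mult_simps tr_add)

end

section \<open>The radical of the trace form\<close>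

context maximal_frame begin

definition J :: "'u set" where
  "J = {x. \<forall>y. tr (x \<star> y) = 0}"

lemma subspace_J: "subspace J"
  by (rule subspaceI) (auto simp: J_def mult_simps tr_add tr_scale)

lemma J_mult: "x \<in> J \<Longrightarrow> x \<star> y \<in> J" "x \<in> J \<Longrightarrow> y \<star> x \<in> J"
proof -
  assume x: "x \<in> J"
  then show "x \<star> y \<in> J" by (simp add: J_def tr_assoc)
  have "tr ((y \<star> x) \<star> z) = 0" for z
  proof -
    have "tr ((y \<star> x) \<star> z) = tr (z \<star> (y \<star> x))" by (rule tr_commute)
    also have "\<dots> = tr ((z \<star> y) \<star> x)" by (rule tr_assoc[symmetric])
    also have "\<dots> = tr (x \<star> (z \<star> y))" by (rule tr_commute)
    finally show ?thesis using x by (simp add: J_def)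
  qed
  then show "y \<star> x \<in> J" by (simp add: J_def)
qed

lemma ideal_J: "two_sided_ideal UNIV J"
  unfolding two_sided_ideal_def using subspace_J J_mult by auto

lemma ideal_component:
  assumes "two_sided_ideal UNIV K" "x \<in> K" shows "component a b x \<in> K"
proof -
  have K: "subspace K" "\<And>x y. x \<in> K \<Longrightarrow> x \<star> y \<in> K" "\<And>x y. x \<in> K \<Longrightarrow> y \<star> x \<in> K"
    using assms(1) unfolding two_sided_ideal_def by auto
  have "right_part b x \<in> K" if "x \<in> K" for x
    using that by (auto simp: right_part_def intro!: subspace_diff subspace_sum K(1) intro: K(2))
  moreover have "left_part a x \<in> K" if "x \<in> K" for x
    using that by (auto simp: left_part_def intro!: subspace_diff subspace_sum K(1) intro: K(3))
  ultimately show ?thesis using assms(2) unfolding component_def by blast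
qed

lemma in_J_if_homogeneous:
  assumes I: "a \<in> I" "b \<in> I" and x: "x \<in> P a b" and tr0: "\<And>y. y \<in> P b a \<Longrightarrow> tr (x \<star> y) = 0"
  shows "x \<in> J"
proof -
  have "tr (x \<star> y) = 0" for y
  proof (induction y rule: peirce_induct)
    case (homogeneous c d y)
    then show ?case using tr0 tr_mult_zero[OF I homogeneous(1,2) x homogeneous(3)] by auto
  qed (simp add: mult_simps tr_add)
  then show ?thesis by (simp add: J_def)
qed

lemma J_diag_iff: "a \<in> I \<Longrightarrow> x \<in> P a a \<Longrightarrow> x \<in> J \<longleftrightarrow> residue a x = 0"
proof
  assume a: "a \<in> I" and x: "x \<in> P a a"
  { assume "x \<in> J"
    then have "tr (x \<star> a) = 0" by (simp add: J_def)
    then show "residue a x = 0"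
      using a x P_right_unit[OF x] tr_diag[OF a x] by (auto simp: residue_def) }
  { assume "residue a x = 0"
    then show "x \<in> J"
      by (intro in_J_if_homogeneous[OF a a x]) (use a x P_mult in \<open>simp add: tr_diag[of a] residue_mult\<close>) }
qed

lemma nilpotent_part_in_J:
  assumes a: "a \<in> E" and x: "x \<in> P a a" shows "x - tr x *s a \<in> J"
proof -
  have "residue a (x - tr x *s a) = 0"
    using residue_eqI[of a "x - tr x *s a" 0] nilp_residue[of a x] nilp_part_in_P[OF a x] a x
    by (simp add: tr_diag[of a])
  then show ?thesis using J_diag_iff[of a] nilp_part_in_P[OF a x] a by blast
qed

lemma nilp_J_diag: "a \<in> I \<Longrightarrow> x \<in> P a a \<Longrightarrow> x \<in> J \<Longrightarrow> nilp x"
  using nilp_residue[of a x] J_diag_iff[of a x] by simp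

text \<open>By symmetry of the trace one may look at the product lying in \<open>P\<^sub>0\<^sub>0\<close>, where the trace is zero.\<close>

lemma P_zero_in_J:
  assumes "a \<in> I" "b \<in> I" "a = 0 \<or> b = 0" "x \<in> P a b" shows "x \<in> J"
proof (rule in_J_if_homogeneous[OF assms(1,2,4)])
  fix y assume y: "y \<in> P b a"
  have "tr (x \<star> y) = residue a (x \<star> y)" "tr (y \<star> x) = residue b (y \<star> x)"
    using assms P_mult y by (auto intro!: tr_diag)
  then show "tr (x \<star> y) = 0" using assms(3) tr_commute[of x y] by (auto simp: residue_def)
qed

text \<open>In positive characteristic the trace of an idempotent may
  vanish, so it does not show at once that \<open>J\<close> is nil. The homogeneous elements of \<open>J\<close> together
  with the diagonal ones are nilpotent for trivial reasons, however, and closed under the Jordan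
  product, so that Jacobson's theorem applies.\<close>

definition diagonal :: "'u set" where
  "diagonal = {x. \<exists>f. (\<forall>a\<in>I. f a \<in> P a a) \<and> x = (\<Sum>a\<in>I. f a)}"

lemma diagonal_mult_P:
  assumes I: "a \<in> I" "b \<in> I" and d: "d \<in> diagonal" and x: "x \<in> P a b"
  shows "d \<star> x \<in> P a b" "x \<star> d \<in> P a b"
proof -
  obtain f where f: "\<And>a. a \<in> I \<Longrightarrow> f a \<in> P a a" and d: "d = (\<Sum>a\<in>I. f a)"
    using d unfolding diagonal_def by blast
  have "f k \<star> x \<in> P a b" if k: "k \<in> I" for k
  proof (cases "k = a")
    case True
    then show ?thesis using f[OF k] x P_mult by auto
  next
    case False
    then show ?thesis
      using P_mult_zero[OF k k I f[OF k] x] subspace_0[OF subspace_P] by auto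
  qed
  then show "d \<star> x \<in> P a b" unfolding d mult_sum_left by (intro subspace_sum subspace_P)
  have "x \<star> f k \<in> P a b" if k: "k \<in> I" for k
  proof (cases "k = b")
    case True
    then show ?thesis using f[OF k] x P_mult by auto
  next
    case False
    then show ?thesis
      using P_mult_zero[OF I k k x f[OF k]] subspace_0[OF subspace_P] by auto
  qed
  then show "x \<star> d \<in> P a b" unfolding d mult_sum_right by (intro subspace_sum subspace_P)
qed

lemma diagonal_product:
  assumes f: "\<And>a. a \<in> I \<Longrightarrow> f a \<in> P a a" and g: "\<And>a. a \<in> I \<Longrightarrow> g a \<in> P a a"
  shows "(\<Sum>a\<in>I. f a) \<star> (\<Sum>a\<in>I. g a) = (\<Sum>a\<in>I. f a \<star> g a)"
proof -
  have "(\<Sum>b\<in>I. f a \<star> g b) = f a \<star> g a" if a: "a \<in> I" for a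
  proof -
    have "(\<Sum>b\<in>I. f a \<star> g b) = (\<Sum>b\<in>I. if b = a then f a \<star> g a else 0)"
      by (rule sum.cong) (use P_mult_zero[OF a a _ _ f[OF a] g] a in auto)
    then show ?thesis using a by (auto simp: sum.delta)
  qed
  then have "(\<Sum>a\<in>I. \<Sum>b\<in>I. f a \<star> g b) = (\<Sum>a\<in>I. f a \<star> g a)" by (rule sum.cong[OF refl])
  then show ?thesis by (subst mult_sum_left) (simp only: mult_sum_right)
qed

lemma P_in_diagonal:
  assumes "a \<in> I" "x \<in> P a a" shows "x \<in> diagonal"
proof -
  have "x = (\<Sum>k\<in>I. if k = a then x else 0)" using assms(1) by (subst sum.delta) auto
  then show ?thesis unfolding diagonal_def using assms subspace_0[OF subspace_P]
    by (intro CollectI exI[of _ "\<lambda>k. if k = a then x else 0"]) auto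
qed

lemma diagonal_add:
  assumes "x \<in> diagonal" "y \<in> diagonal" shows "x + y \<in> diagonal"
proof -
  obtain f g where "\<forall>a\<in>I. f a \<in> P a a" "x = (\<Sum>a\<in>I. f a)" "\<forall>a\<in>I. g a \<in> P a a" "y = (\<Sum>a\<in>I. g a)"
    using assms unfolding diagonal_def by blast
  then show ?thesis unfolding diagonal_def using subspace_add[OF subspace_P]
    by (intro CollectI exI[of _ "\<lambda>a. f a + g a"]) (simp add: sum.distrib)
qed

lemma diagonal_times:
  assumes "x \<in> diagonal" "y \<in> diagonal" shows "x \<star> y \<in> diagonal"
proof -
  obtain f g where f: "\<And>a. a \<in> I \<Longrightarrow> f a \<in> P a a" "x = (\<Sum>a\<in>I. f a)"
    and g: "\<And>a. a \<in> I \<Longrightarrow> g a \<in> P a a" "y = (\<Sum>a\<in>I. g a)"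
    using assms unfolding diagonal_def by blast
  have "x \<star> y = (\<Sum>a\<in>I. f a \<star> g a)" unfolding f(2) g(2) by (rule diagonal_product[OF f(1) g(1)])
  moreover have "f a \<star> g a \<in> P a a" if "a \<in> I" for a using f(1) g(1) P_mult that by blast
  ultimately show ?thesis unfolding diagonal_def by (intro CollectI exI[of _ "\<lambda>a. f a \<star> g a"]) auto
qed

lemma nilp_diagonal_J:
  assumes x: "x \<in> diagonal" "x \<in> J" shows "nilp x"
proof -
  obtain f where f: "\<And>a. a \<in> I \<Longrightarrow> f a \<in> P a a" "x = (\<Sum>a\<in>I. f a)"
    using x unfolding diagonal_def by blast
  have fJ: "f a \<in> J" if a: "a \<in> I" for a
  proof -
    have lin: "component a a (sum f A) = (\<Sum>k\<in>A. component a a (f k))" for A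
      by (induction A rule: infinite_finite_induct) (auto simp: component_linear)
    have "component a a x = (\<Sum>k\<in>I. if k = a then f a else 0)"
      unfolding f(2) lin by (rule sum.cong) (use component_P[OF f(1)] a in auto)
    also have "\<dots> = f a" using a by (subst sum.delta) auto
    finally show ?thesis using ideal_component[OF ideal_J x(2)] by metis
  qed
  have "\<exists>k. npow (f a) k = 0" if "a \<in> I" for a
    using nilp_J_diag[OF that f(1)[OF that] fJ[OF that]] unfolding nilp_def .
  then obtain r where r: "\<And>a. a \<in> I \<Longrightarrow> npow (f a) (r a) = 0" by metis
  define n where "n = sum r I"
  have 0: "npow (f a) n = 0" if a: "a \<in> I" for a
  proof -
    have "r a \<le> n" unfolding n_def by (rule member_le_sum[OF a]) auto
    moreover have "npow (f a) (r a + j) = 0" for j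
      by (induction j) (auto simp: r[OF a] npow_Suc)
    ultimately show ?thesis using le_Suc_ex by metis
  qed
  have "npow x k = (\<Sum>a\<in>I. npow (f a) k)" for k
  proof (induction k)
    case (Suc k)
    have "npow x (Suc k) = (\<Sum>a\<in>I. f a) \<star> (\<Sum>a\<in>I. npow (f a) k)"
      using Suc f(2) by (simp add: npow_Suc)
    also have "\<dots> = (\<Sum>a\<in>I. f a \<star> npow (f a) k)"
      by (rule diagonal_product[OF f(1)]) (use npow_in_subalgebra[OF subalgebra_P f(1)] in auto)
    finally show ?case by (simp add: npow_Suc)
  qed (simp add: f(2))
  with 0 show ?thesis unfolding nilp_def by (intro exI[of _ n]) simp
qed

text \<open>For \<open>x \<in> P\<^sub>a\<^sub>b\<close> and \<open>y \<in> P\<^sub>b\<^sub>a\<close> the element \<open>x y + y x\<close> is not homogeneous but diagonal, which is why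
  all diagonal elements of \<open>J\<close> have to be included in the weakly closed set.\<close>

theorem J_nilpotent: "\<exists>k. descent J UNIV {0} k \<subseteq> {0}"
proof -
  define W where "W = J \<inter> (diagonal \<union> (\<Union>a\<in>I. \<Union>b\<in>I - {a}. P a b))"
  have W_diag: "x \<in> W" if "x \<in> J" "x \<in> diagonal" for x using that W_def by blast
  have W_off: "x \<in> W" if "x \<in> J" "a \<in> I" "b \<in> I" "x \<in> P a b" "a \<noteq> b" for x a b
    using that W_def by blast
  have W_cases: "(x \<in> J \<and> x \<in> diagonal) \<or> (\<exists>a b. x \<in> J \<and> a \<in> I \<and> b \<in> I \<and> a \<noteq> b \<and> x \<in> P a b)"
    if "x \<in> W" for x using that W_def by blast
  have zero: "0 \<in> W"
    by (rule W_diag) (use subspace_J subspace_0 subspace_P P_in_diagonal in blast)+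
  have J_jordan: "x \<star> y + y \<star> x \<in> J" if "x \<in> J" "y \<in> J" for x y
    using that subspace_add[OF subspace_J] J_mult by blast
  have mixed: "x \<star> y + y \<star> x \<in> W"
    if "x \<in> J" "x \<in> diagonal" "y \<in> J" "a \<in> I" "b \<in> I" "a \<noteq> b" "y \<in> P a b" for x y a b
    by (rule W_off[of _ a b])
      (use that J_jordan diagonal_mult_P[of a b x y] subspace_add[OF subspace_P] in auto)
  have jordan: "x \<star> y + y \<star> x \<in> W" if xW: "x \<in> W" and yW: "y \<in> W" for x y
  proof -
    have xJ: "x \<in> J" and yJ: "y \<in> J" using xW yW W_def by auto
    consider "x \<in> diagonal" "y \<in> diagonal"
      | a b where "x \<in> diagonal" "a \<in> I" "b \<in> I" "a \<noteq> b" "y \<in> P a b"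
      | a b where "y \<in> diagonal" "a \<in> I" "b \<in> I" "a \<noteq> b" "x \<in> P a b"
      | a b c d where "a \<in> I" "b \<in> I" "a \<noteq> b" "x \<in> P a b" "c \<in> I" "d \<in> I" "c \<noteq> d" "y \<in> P c d"
      using W_cases[OF xW] W_cases[OF yW] by metis
    then show ?thesis
    proof cases
      case 1
      then show ?thesis by (intro W_diag J_jordan xJ yJ diagonal_add diagonal_times)
    next
      case (2 a b)
      then show ?thesis using mixed xJ yJ by blast
    next
      case (3 a b)
      then show ?thesis using mixed[of y x a b] xJ yJ by (simp add: add.commute)
    next
      case (4 a b c d)
      note I = 4(1,2) and I' = 4(5,6) and x = 4(4) and y = 4(8)
      have xy: "x \<star> y = 0" if "b \<noteq> c" "\<not> (c = a \<and> d = b)" by (rule P_mult_zero[OF I I' x y that])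
      have yx: "y \<star> x = 0" if "d \<noteq> a" "\<not> (a = c \<and> b = d)" by (rule P_mult_zero[OF I' I y x that])
      consider "b = c" "d = a" | "b = c" "d \<noteq> a" | "b \<noteq> c" "d = a" | "c = a" "d = b"
        | "b \<noteq> c" "d \<noteq> a" "\<not> (c = a \<and> d = b)" by blast
      then show ?thesis
      proof cases
        case 1
        then have "x \<star> y \<in> P a a" "y \<star> x \<in> P b b" using P_mult x y by auto
        then show ?thesis
          by (intro W_diag J_jordan xJ yJ diagonal_add) (use I P_in_diagonal in auto)
      next
        case 2
        then have "x \<star> y + y \<star> x \<in> P a d" using yx P_mult x y 4 by auto
        with 2 show ?thesis using W_off J_jordan xJ yJ I I' by blast
      next
        case 3
        then have "x \<star> y + y \<star> x \<in> P c b" using xy P_mult[of y c d x b] x y 4 by auto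
        with 3 show ?thesis using W_off J_jordan xJ yJ I I' by blast
      next
        case 4
        then show ?thesis using zero offdiag_anticommute[of x a b y] x y I \<open>a \<noteq> b\<close> by simp
      next
        case 5
        then show ?thesis using xy yx zero by auto
      qed
    qed
  qed
  have nil: "nilp x" if "x \<in> W" for x
    using W_cases[OF that]
  proof
    assume "x \<in> J \<and> x \<in> diagonal"
    then show ?thesis using nilp_diagonal_J by blast
  next
    assume "\<exists>a b. x \<in> J \<and> a \<in> I \<and> b \<in> I \<and> a \<noteq> b \<and> x \<in> P a b"
    then have "npow x 1 = 0" using offdiag_square_zero by (auto simp: npow_def)
    then show ?thesis unfolding nilp_def by blast
  qed
  have "\<exists>k. descent W UNIV {0} k \<subseteq> {0}"
    by (rule jacobson_weakly_closed) (use jordan nil in auto)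
  then obtain k where k: "descent W UNIV {0} k \<subseteq> {0}" by blast
  have "J \<subseteq> span W"
  proof
    fix x assume x: "x \<in> J"
    have "component a b x \<in> W" if "a \<in> I" "b \<in> I" for a b
      using W_diag W_off component_in_P[OF that] ideal_component[OF ideal_J x] that P_in_diagonal
      by (cases "a = b") blast+
    then have "(\<Sum>b\<in>I. \<Sum>a\<in>I. component a b x) \<in> span W" by (intro span_sum span_base)
    then show "x \<in> span W" by (simp only: component_sum)
  qed
  then have "descent J UNIV {0} k \<subseteq> descent (span W) UNIV {0} k" by (intro descent_mono) auto
  also have "\<dots> \<subseteq> descent W UNIV {0} k" by (rule descent_span) simp
  finally show ?thesis using k by blast
qed

lemma nilp_J: assumes x: "x \<in> J" shows "nilp x"
proof -
  have "npow x k \<in> descent J UNIV {0} k" for k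
    by (induction k) (use x descent_step in \<open>auto simp: npow_Suc simp del: descent.simps(2)\<close>)
  then show ?thesis using J_nilpotent unfolding nilp_def by blast
qed

text \<open>An ideal on which the trace form vanishes lies in its radical: a homogeneous \<open>x\<close> and a
  partner \<open>y\<close> with \<open>tr (x y) \<noteq> 0\<close> would produce the element \<open>z = x y\<close> of some \<open>P\<^sub>a\<^sub>a\<close> in the ideal
  with \<open>tr (z z) = (tr z)\<^sup>2 \<noteq> 0\<close>.\<close>

lemma isotropic_ideal_in_J:
  assumes K: "two_sided_ideal UNIV K" and iso: "\<And>x y. x \<in> K \<Longrightarrow> y \<in> K \<Longrightarrow> tr (x \<star> y) = 0"
  shows "K \<subseteq> J"
proof
  fix x assume x: "x \<in> K"
  have KM: "\<And>x y. x \<in> K \<Longrightarrow> x \<star> y \<in> K" using K unfolding two_sided_ideal_def by auto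
  have "component a b x \<in> J" if I: "a \<in> I" "b \<in> I" for a b
  proof (rule in_J_if_homogeneous[OF I component_in_P[OF I]])
    fix y assume y: "y \<in> P b a"
    define z where "z = component a b x \<star> y"
    have z: "z \<in> P a a" unfolding z_def by (rule P_mult[OF component_in_P[OF I] y])
    have "z \<in> K" unfolding z_def using ideal_component[OF K x] KM by blast
    then have "tr (z \<star> z) = 0" using iso by blast
    then have "residue a z = 0" using z I P_mult by (simp add: tr_diag[of a] residue_mult)
    then show "tr (component a b x \<star> y) = 0" using z I by (simp add: tr_diag[of a] flip: z_def)
  qed
  then have "(\<Sum>b\<in>I. \<Sum>a\<in>I. component a b x) \<in> J" by (intro subspace_sum subspace_J)
  then show "x \<in> J" by (simp only: component_sum)
qed

end

section \<open>Matrix units and split octonions\<close>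

context maximal_frame begin

definition linked :: "'u \<Rightarrow> 'u \<Rightarrow> bool" where
  "linked a b \<longleftrightarrow> (\<exists>x\<in>P a b. \<exists>y\<in>P b a. x \<star> y = a \<and> y \<star> x = b)"

text \<open>The element \<open>y x\<close> is a nonzero idempotent of the local algebra \<open>P\<^sub>b\<^sub>b\<close>.\<close>

lemma one_sided_inverse:
  assumes ab: "a \<in> E" "b \<in> E" "a \<noteq> b" and x: "x \<in> P a b" and y: "y \<in> P b a" and xy: "x \<star> y = a"
  shows "y \<star> x = b"
proof -
  define f where "f = y \<star> x"
  have f: "f \<in> P b b" unfolding f_def by (rule P_mult[OF y x])
  have xf: "x \<star> f = x"
    using flexible[of x y] xy P_left_unit[OF x ab(1)] by (simp add: f_def)
  have "f \<star> f = y \<star> (x \<star> f)"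
    unfolding f_def by (rule P_assoc[OF _ _ _ _ y x f[unfolded f_def]]) (use ab in auto)
  then have "f \<star> f = f" using xf by (simp add: f_def)
  moreover have "f \<noteq> 0" using xf xy E_nonzero[OF ab(1)] by auto
  ultimately have "f = b" using frame_primitive[OF ab(2) f] by blast
  then show ?thesis by (simp add: f_def)
qed

text \<open>A nonzero trace means that \<open>x y\<close> is invertible in the local algebra \<open>P\<^sub>a\<^sub>a\<close>.\<close>

lemma right_normalise:
  assumes ab: "a \<in> E" "b \<in> E" "a \<noteq> b" and x: "x \<in> P a b" and y: "y \<in> P b a" and tr: "tr (x \<star> y) \<noteq> 0"
  obtains w where "w \<in> P a a" "x \<star> (y \<star> w) = a"
proof -
  have u: "x \<star> y \<in> P a a" by (rule P_mult[OF x y])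
  have "\<not> nilp (x \<star> y)" using residue_nilp[OF ab(1) u] tr u ab by (auto simp: tr_diag[of a])
  then obtain w where w: "w \<in> P a a" "(x \<star> y) \<star> w = a" using local_inverse[OF ab(1) u] by blast
  moreover have "(x \<star> y) \<star> w = x \<star> (y \<star> w)"
    by (rule P_assoc[OF _ _ _ _ x y w(1)]) (use ab in auto)
  ultimately show thesis using that by simp
qed

lemma linked_refl: "a \<in> E \<Longrightarrow> linked a a"
  unfolding linked_def using E_in_P E_idem by blast

lemma linked_sym: "linked a b \<Longrightarrow> linked b a"
  unfolding linked_def by blast

lemma not_linked_in_J:
  assumes ab: "a \<in> E" "b \<in> E" and nl: "\<not> linked a b" shows "P a b \<subseteq> J"
proof
  fix x assume x: "x \<in> P a b"
  have ne: "a \<noteq> b" using nl linked_refl ab by blast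
  show "x \<in> J"
  proof (rule in_J_if_homogeneous[OF _ _ x])
    fix y assume y: "y \<in> P b a"
    show "tr (x \<star> y) = 0"
    proof (rule ccontr)
      assume "tr (x \<star> y) \<noteq> 0"
      then obtain w where w: "w \<in> P a a" "x \<star> (y \<star> w) = a"
        using right_normalise[OF ab ne x y] by blast
      have yw: "y \<star> w \<in> P b a" by (rule P_mult[OF y w(1)])
      from one_sided_inverse[OF ab ne x yw w(2)] w(2) x yw nl show False
        unfolding linked_def by blast
    qed
  qed (use ab in auto)
qed

lemma linked_trans:
  assumes E: "a \<in> E" "b \<in> E" "c \<in> E" and ab: "linked a b" and bc: "linked b c" shows "linked a c"
proof (cases "a = b \<or> b = c \<or> a = c")
  case True
  then show ?thesis using ab bc linked_refl E by blast
next
  case False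
  then have ne: "a \<noteq> b" "b \<noteq> c" "a \<noteq> c" by auto
  obtain x y where x: "x \<in> P a b" and y: "y \<in> P b a" and xy: "x \<star> y = a" "y \<star> x = b"
    using ab unfolding linked_def by blast
  obtain u v where u: "u \<in> P b c" and v: "v \<in> P c b" and uv: "u \<star> v = b" "v \<star> u = c"
    using bc unfolding linked_def by blast
  have vy: "v \<star> y \<in> P c a" and xu: "x \<star> u \<in> P a c" using P_mult x y u v by auto
  have "(x \<star> u) \<star> (v \<star> y) = x \<star> (u \<star> (v \<star> y))"
    by (rule P_assoc[OF _ _ _ _ x u vy]) (use E ne in auto)
  also have "u \<star> (v \<star> y) = (u \<star> v) \<star> y"
    by (rule P_assoc[OF _ _ _ _ u v y, symmetric]) (use E ne in auto)
  also have "\<dots> = y" using uv P_left_unit[OF y E(2)] by simp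
  finally have "(x \<star> u) \<star> (v \<star> y) = a" using xy by simp
  with one_sided_inverse[OF E(1,3) ne(3) xu vy] xu vy show ?thesis unfolding linked_def by blast
qed

text \<open>Matrix units for each class of linked idempotents, through a representative \<open>c\<close>:
  \<open>m a b\<close> is the product of a chosen element of \<open>P\<^sub>a\<^sub>c\<close> and a chosen element of \<open>P\<^sub>c\<^sub>b\<close>.\<close>

lemma matrix_units:
  obtains m where "\<And>a. a \<in> E \<Longrightarrow> m a a = a"
    and "\<And>a b. a \<in> E \<Longrightarrow> b \<in> E \<Longrightarrow> linked a b \<Longrightarrow> m a b \<in> P a b"
    and "\<And>a b c. a \<in> E \<Longrightarrow> b \<in> E \<Longrightarrow> c \<in> E \<Longrightarrow> linked a b \<Longrightarrow> linked b c \<Longrightarrow> m a b \<star> m b c = m a c"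
proof -
  define r where "r a = (SOME c. c \<in> E \<and> linked a c)" for a
  have r: "r a \<in> E" "linked a (r a)" if "a \<in> E" for a
    using someI[of "\<lambda>c. c \<in> E \<and> linked a c" a] that linked_refl unfolding r_def by blast+
  have r_eq: "r a = r b" if "a \<in> E" "b \<in> E" "linked a b" for a b
  proof -
    have "(\<lambda>c. c \<in> E \<and> linked a c) = (\<lambda>c. c \<in> E \<and> linked b c)"
      using that linked_trans linked_sym by blast
    then show ?thesis unfolding r_def by simp
  qed
  define F where "F a x y \<longleftrightarrow>
    x \<in> P a (r a) \<and> y \<in> P (r a) a \<and> x \<star> y = a \<and> y \<star> x = r a \<and> (a = r a \<longrightarrow> x = a \<and> y = a)"
    for a x y
  have "\<exists>x y. F a x y" if a: "a \<in> E" for a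
  proof (cases "a = r a")
    case True
    then have "F a a a" unfolding F_def using E_in_P[OF a] E_idem[OF a] by simp
    then show ?thesis by blast
  next
    case False
    then show ?thesis using r(2)[OF a] unfolding linked_def F_def by blast
  qed
  then obtain p q where p: "\<And>a. a \<in> E \<Longrightarrow> p a \<in> P a (r a)" and q: "\<And>a. a \<in> E \<Longrightarrow> q a \<in> P (r a) a"
    and pq: "\<And>a. a \<in> E \<Longrightarrow> p a \<star> q a = a" and qp: "\<And>a. a \<in> E \<Longrightarrow> q a \<star> p a = r a"
    and base: "\<And>a. a \<in> E \<Longrightarrow> a = r a \<Longrightarrow> p a = a \<and> q a = a"
  proof -
    assume *: "\<And>a. a \<in> E \<Longrightarrow> \<exists>x y. F a x y"
    then obtain p where "\<And>a. a \<in> E \<Longrightarrow> \<exists>y. F a (p a) y" by metis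
    then obtain q where "\<And>a. a \<in> E \<Longrightarrow> F a (p a) (q a)" by metis
    then show thesis using that[of p q] unfolding F_def by blast
  qed
  define m where "m a b = p a \<star> q b" for a b
  have mP: "m a b \<in> P a b" if "a \<in> E" "b \<in> E" "linked a b" for a b
    unfolding m_def using P_mult[OF p[OF that(1)]] q[OF that(2)] r_eq[OF that] by simp
  show thesis
  proof (rule that[of m])
    show "m a a = a" if "a \<in> E" for a using that pq by (simp add: m_def)
    show "m a b \<in> P a b" if "a \<in> E" "b \<in> E" "linked a b" for a b using mP that .
    show "m a b \<star> m b c = m a c" if E: "a \<in> E" "b \<in> E" "c \<in> E" and l: "linked a b" "linked b c" for a b c
    proof -
      define k where "k = r b"
      have k: "k \<in> E" "r a = k" "r c = k"
        using r(1)[OF E(2)] r_eq[OF E(1,2) l(1)] r_eq[OF E(2,3) l(2)] by (simp_all add: k_def)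
      have pa: "p a \<in> P a k" and pb: "p b \<in> P b k" and qb: "q b \<in> P k b" and qc: "q c \<in> P k c"
        using p q E k by (metis k_def)+
      consider "b = k" | "a = b" | "b = c" | "b \<noteq> k" "a \<noteq> b" "b \<noteq> c" by blast
      then show ?thesis
      proof cases
        case 1
        then have "p b = k" "q b = k" using base[OF E(2)] by (auto simp: k_def)
        then show ?thesis using P_right_unit[OF pa k(1)] P_left_unit[OF qc k(1)] by (simp add: m_def)
      next
        case 2
        then have "m a b = b" using pq E by (simp add: m_def)
        then show ?thesis using P_left_unit[OF mP[OF E(2,3) l(2)] E(2)] 2 by simp
      next
        case 3
        then have "m b c = b" using pq E by (simp add: m_def)
        then show ?thesis using P_right_unit[OF mP[OF E(1,2) l(1)] E(2)] 3 by simp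
      next
        case 4
        have "(p a \<star> q b) \<star> (p b \<star> q c) = p a \<star> (q b \<star> (p b \<star> q c))"
          by (rule P_assoc[OF _ _ _ _ pa qb P_mult[OF pb qc]]) (use E k 4 in auto)
        also have "q b \<star> (p b \<star> q c) = (q b \<star> p b) \<star> q c"
          by (rule P_assoc[OF _ _ _ _ qb pb qc, symmetric]) (use E k 4 in auto)
        also have "\<dots> = q c" using qp[OF E(2)] P_left_unit[OF qc k(1)] by (simp add: k_def)
        finally show ?thesis by (simp add: m_def)
      qed
    qed
  qed
qed

text \<open>Together with \<open>a\<close> and \<open>b\<close> the spaces \<open>X\<close> and \<open>Y\<close> span a subalgebra that complements \<open>J\<close> in the
  corner belonging to these two idempotents.\<close>
definition split_pair :: "'u \<Rightarrow> 'u \<Rightarrow> 'u set \<Rightarrow> 'u set \<Rightarrow> bool" where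
  "split_pair a b X Y \<longleftrightarrow> subspace X \<and> subspace Y \<and> X \<subseteq> P a b \<and> Y \<subseteq> P b a \<and>
     X \<inter> J \<subseteq> {0} \<and> Y \<inter> J \<subseteq> {0} \<and>
     (\<forall>x\<in>P a b. \<exists>u\<in>X. x - u \<in> J) \<and> (\<forall>y\<in>P b a. \<exists>v\<in>Y. y - v \<in> J) \<and>
     (\<forall>x\<in>X. \<forall>y\<in>Y. x \<star> y \<in> span {a} \<and> y \<star> x \<in> span {b}) \<and>
     (\<forall>x\<in>X. \<forall>x'\<in>X. x \<star> x' \<in> Y) \<and> (\<forall>y\<in>Y. \<forall>y'\<in>Y. y \<star> y' \<in> X)"

lemma split_pair_sym: "split_pair a b X Y \<Longrightarrow> split_pair b a Y X"
  unfolding split_pair_def by blast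

lemma mult_span_span:
  assumes "\<And>x y. x \<in> A \<Longrightarrow> y \<in> B \<Longrightarrow> x \<star> y \<in> T" "subspace T" "x \<in> span A" "y \<in> span B"
  shows "x \<star> y \<in> T"
  by (rule mult_span_left[OF _ assms(2,3)]) (rule mult_span_right[OF _ assms(2,4)], rule assms(1))

definition dual_pair :: "'u \<Rightarrow> 'u \<Rightarrow> 'u \<Rightarrow> 'u \<Rightarrow> 'u \<Rightarrow> 'u \<Rightarrow> bool" where
  "dual_pair a b x1 y1 x2 y2 \<longleftrightarrow> x1 \<in> P a b \<and> x2 \<in> P a b \<and> y1 \<in> P b a \<and> y2 \<in> P b a \<and>
     x1 \<star> y1 = a \<and> y1 \<star> x1 = b \<and> x2 \<star> y2 = a \<and> y2 \<star> x2 = b \<and>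
     x1 \<star> y2 = 0 \<and> y2 \<star> x1 = 0 \<and> x2 \<star> y1 = 0 \<and> y1 \<star> x2 = 0"

text \<open>The relations of Zorn's vector matrices hold exactly, not just modulo the radical, once two
  of the three dual pairs are given: \<open>(y\<^sub>2 y\<^sub>1, x\<^sub>1 x\<^sub>2)\<close> serves as the third. Each product follows by
  moving one factor cyclically through an associator.\<close>

lemma dual_pair_third:
  assumes ab: "a \<in> E" "b \<in> E" "a \<noteq> b" and D: "dual_pair a b x1 y1 x2 y2"
  shows "dual_pair a b x2 y2 (y2 \<star> y1) (x1 \<star> x2)"
    "(x1 \<star> x2) \<star> y2 = x1" "x2 \<star> (y2 \<star> y1) = y1" "y1 \<star> (x1 \<star> x2) = x2" "(y2 \<star> y1) \<star> x1 = y2"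
proof -
  have x: "x1 \<in> P a b" "x2 \<in> P a b" and y: "y1 \<in> P b a" "y2 \<in> P b a"
    and xy: "x1 \<star> y1 = a" "y1 \<star> x1 = b" "x2 \<star> y2 = a" "y2 \<star> x2 = b"
      "x1 \<star> y2 = 0" "y2 \<star> x1 = 0" "x2 \<star> y1 = 0" "y1 \<star> x2 = 0"
    using D unfolding dual_pair_def by auto
  have u: "a \<star> x1 = x1" "a \<star> x2 = x2" "x1 \<star> b = x1" "x2 \<star> b = x2"
    "b \<star> y1 = y1" "b \<star> y2 = y2" "y1 \<star> a = y1" "y2 \<star> a = y2"
    "b \<star> x1 = 0" "b \<star> x2 = 0" "x1 \<star> a = 0" "x2 \<star> a = 0"
    "a \<star> y1 = 0" "a \<star> y2 = 0" "y1 \<star> b = 0" "y2 \<star> b = 0"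
    using x y ab by (auto simp: P_left P_right)
  define z w where "z = x1 \<star> x2" and "w = y2 \<star> y1"
  have z: "z \<in> P b a" and w: "w \<in> P a b"
    unfolding z_def w_def using P_mult_same x y by auto
  have sq: "x1 \<star> x1 = 0" "x2 \<star> x2 = 0" "y1 \<star> y1 = 0" "y2 \<star> y2 = 0"
    using offdiag_square_zero[of _ a b] offdiag_square_zero[of _ b a] x y ab by auto
  have anti: "z = - (x2 \<star> x1)" "w = - (y1 \<star> y2)"
    using offdiag_anticommute[of x1 a b x2] offdiag_anticommute[of y2 b a y1] x y ab
    by (auto simp: z_def w_def)
  have zy2: "z \<star> y2 = x1"
    using associator_cycle[of x1 x2 y2] by (simp add: associator_def xy u z_def)
  have zy1: "z \<star> y1 = - x2"
    using associator_cycle[of x1 x2 y1] by (simp add: associator_def xy u z_def)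
  have y1z: "y1 \<star> z = x2"
    using associator_cycle[of y1 x1 x2] by (simp add: associator_def xy u zy1 flip: z_def)
  have "- (y2 \<star> z) = x1"
    using associator_cycle[of y2 x1 x2] by (simp add: associator_def xy u zy2 flip: z_def)
  then have y2z: "y2 \<star> z = - x1" by (metis minus_minus)
  have x2w: "x2 \<star> w = y1"
    using associator_cycle[of y1 x2 y2] by (simp add: associator_def xy u w_def)
  have wx1: "w \<star> x1 = y2"
    using associator_cycle[of y2 y1 x1] by (simp add: associator_def xy u w_def)
  have wz: "w \<star> z = a"
    using associator_swap_right[of y2 y1 z]
    by (simp add: associator_def y1z y2z zy1 xy mult_simps flip: w_def)
  have zw: "z \<star> w = b" by (rule one_sided_inverse[OF ab w z wz])
  have "z \<star> x2 = 0" "x2 \<star> z = 0"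
    using right_alt[of x1 x2] left_alt[of x2 x1] anti sq by (auto simp: z_def mult_simps)
  moreover have "w \<star> y2 = 0" "y2 \<star> w = 0"
    using right_alt[of y1 y2] left_alt[of y2 y1] anti sq by (auto simp: w_def mult_simps)
  ultimately show "dual_pair a b x2 y2 (y2 \<star> y1) (x1 \<star> x2)"
    using x y xy wz zw z w unfolding dual_pair_def z_def[symmetric] w_def[symmetric] by simp
  show "(x1 \<star> x2) \<star> y2 = x1" "x2 \<star> (y2 \<star> y1) = y1" "y1 \<star> (x1 \<star> x2) = x2" "(y2 \<star> y1) \<star> x1 = y2"
    using zy2 x2w y1z wx1 by (auto simp: z_def w_def)
qed

text \<open>The vector triple product identity modulo \<open>J\<close>; it bounds the rank of the trace form on
  \<open>P\<^sub>a\<^sub>b \<times> P\<^sub>b\<^sub>a\<close> by three.\<close>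

lemma triple_product:
  assumes ab: "a \<in> E" "b \<in> E" "a \<noteq> b" and u: "u \<in> P a b" and v: "v \<in> P a b" and y: "y \<in> P b a"
  shows "(u \<star> v) \<star> y - (tr (v \<star> y) *s u - tr (u \<star> y) *s v) \<in> J"
proof -
  have vy: "v \<star> y \<in> P a a" and yu: "y \<star> u \<in> P b b" using P_mult u v y by auto
  have "u \<star> (v \<star> y) = 0"
    by (rule P_mult_zero[of a b a a]) (use ab u vy in auto)
  then have "(u \<star> v) \<star> y = (v \<star> y) \<star> u - v \<star> (y \<star> u)"
    using associator_cycle[of u v y] by (simp add: associator_def)
  moreover have "(v \<star> y - tr (v \<star> y) *s a) \<star> u \<in> J" "v \<star> (y \<star> u - tr (y \<star> u) *s b) \<in> J"
    using nilpotent_part_in_J[OF ab(1) vy] nilpotent_part_in_J[OF ab(2) yu] J_mult by auto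
  then have "(v \<star> y - tr (v \<star> y) *s a) \<star> u - v \<star> (y \<star> u - tr (y \<star> u) *s b) \<in> J"
    by (rule subspace_diff[OF subspace_J])
  moreover have "(v \<star> y - tr (v \<star> y) *s a) \<star> u - v \<star> (y \<star> u - tr (y \<star> u) *s b)
      = ((v \<star> y) \<star> u - v \<star> (y \<star> u)) - (tr (v \<star> y) *s u - tr (u \<star> y) *s v)"
    using P_left_unit[OF u ab(1)] P_right_unit[OF v ab(2)] tr_commute[of u y]
    by (simp add: mult_simps)
  ultimately show ?thesis by simp
qed

lemma tr_E: "a \<in> E \<Longrightarrow> tr a = 1"
  using tr_diag[of a a] E_in_P residue_self by simp

text \<open>The three dual pairs span copies of a three-dimensional space and its dual, with cross products
  as multiplication. That nothing else survives modulo \<open>J\<close> follows from the triple product identity.\<close>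

lemma octonion_split_pair:
  assumes ab: "a \<in> E" "b \<in> E" "a \<noteq> b" and D: "dual_pair a b x1 y1 x2 y2"
  shows "\<exists>X Y. split_pair a b X Y"
proof -
  define x3 y3 where "x3 = y2 \<star> y1" and "y3 = x1 \<star> x2"
  note T = dual_pair_third[OF ab D, folded x3_def y3_def]
  have x: "x1 \<in> P a b" "x2 \<in> P a b" "x3 \<in> P a b" and y: "y1 \<in> P b a" "y2 \<in> P b a" "y3 \<in> P b a"
    using D T(1) unfolding dual_pair_def by auto
  have sq: "x1 \<star> x1 = 0" "x2 \<star> x2 = 0" "x3 \<star> x3 = 0" "y1 \<star> y1 = 0" "y2 \<star> y2 = 0" "y3 \<star> y3 = 0"
    using offdiag_square_zero[of _ a b] offdiag_square_zero[of _ b a] x y ab by auto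
  have xx: "x1 \<star> x2 = y3" "x2 \<star> x3 = y1" "x3 \<star> x1 = y2"
    and yy: "y2 \<star> y1 = x3" "y3 \<star> y2 = x1" "y1 \<star> y3 = x2"
    using T by (auto simp: x3_def y3_def)
  have xx': "x2 \<star> x1 = - y3" "x3 \<star> x2 = - y1" "x1 \<star> x3 = - y2"
    using offdiag_anticommute[of x1 a b x2] offdiag_anticommute[of x2 a b x3]
      offdiag_anticommute[of x3 a b x1] xx x ab by auto
  have yy': "y1 \<star> y2 = - x3" "y2 \<star> y3 = - x1" "y3 \<star> y1 = - x2"
    using offdiag_anticommute[of y2 b a y1] offdiag_anticommute[of y3 b a y2]
      offdiag_anticommute[of y1 b a y3] yy y ab by auto
  have "x1 \<star> y3 = 0" "y3 \<star> x1 = 0" "x3 \<star> y1 = 0" "y1 \<star> x3 = 0"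
    using left_alt[of x1 x2] right_alt[of x2 x1] right_alt[of y2 y1] left_alt[of y1 y2] sq xx xx' yy yy'
    by (auto simp: mult_simps)
  with D T(1) have xy: "x1 \<star> y1 = a" "x2 \<star> y2 = a" "x3 \<star> y3 = a"
      "x1 \<star> y2 = 0" "x1 \<star> y3 = 0" "x2 \<star> y1 = 0" "x2 \<star> y3 = 0" "x3 \<star> y1 = 0" "x3 \<star> y2 = 0"
    and yx: "y1 \<star> x1 = b" "y2 \<star> x2 = b" "y3 \<star> x3 = b"
      "y1 \<star> x2 = 0" "y1 \<star> x3 = 0" "y2 \<star> x1 = 0" "y2 \<star> x3 = 0" "y3 \<star> x1 = 0" "y3 \<star> x2 = 0"
    unfolding dual_pair_def by auto
  note tr1 = tr_E[OF ab(1)] tr_E[OF ab(2)]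
  define X Y where "X = span {x1, x2, x3}" and "Y = span {y1, y2, y3}"
  have gX: "x1 \<in> X" "x2 \<in> X" "x3 \<in> X" and gY: "y1 \<in> Y" "y2 \<in> Y" "y3 \<in> Y"
    unfolding X_def Y_def by (auto intro: span_base)
  have sX: "subspace X" and sY: "subspace Y" unfolding X_def Y_def by auto
  have XP: "X \<subseteq> P a b" and YP: "Y \<subseteq> P b a"
    unfolding X_def Y_def by (rule span_minimal; use x y subspace_P in auto)+
  have expand: "\<exists>c1 c2 c3. v = c1 *s g1 + c2 *s g2 + c3 *s g3" if "v \<in> span {g1, g2, g3}" for v g1 g2 g3
  proof -
    from that obtain c1 c2 c3 where "v - c1 *s g1 - c2 *s g2 - c3 *s g3 = 0"
      unfolding span_breakdown_eq span_empty by (metis singletonD)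
    then have "v = c1 *s g1 + c2 *s g2 + c3 *s g3" by (simp add: algebra_simps)
    then show ?thesis by blast
  qed
  have XJ: "X \<inter> J \<subseteq> {0}"
  proof
    fix v assume v: "v \<in> X \<inter> J"
    then obtain c1 c2 c3 where c: "v = c1 *s x1 + c2 *s x2 + c3 *s x3"
      using expand unfolding X_def by blast
    have "tr (v \<star> y1) = 0" "tr (v \<star> y2) = 0" "tr (v \<star> y3) = 0" using v unfolding J_def by auto
    then show "v \<in> {0}" by (simp add: c mult_simps xy tr_add tr_scale tr1)
  qed
  have YJ: "Y \<inter> J \<subseteq> {0}"
  proof
    fix v assume v: "v \<in> Y \<inter> J"
    then obtain c1 c2 c3 where c: "v = c1 *s y1 + c2 *s y2 + c3 *s y3"
      using expand unfolding Y_def by blast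
    have "tr (v \<star> x1) = 0" "tr (v \<star> x2) = 0" "tr (v \<star> x3) = 0" using v unfolding J_def by auto
    then show "v \<in> {0}" by (simp add: c mult_simps yx tr_add tr_scale tr1)
  qed
  \<comment> \<open>Modulo \<open>J\<close>, an element orthogonal to the three dual vectors is orthogonal to everything.\<close>
  have pairing: "tr (x0 \<star> y0) = 0" if x0: "x0 \<in> P a b" "tr (x0 \<star> y1) = 0" "tr (x0 \<star> y2) = 0" "tr (x0 \<star> y3) = 0"
    and y0: "y0 \<in> P b a" "tr (x1 \<star> y0) = 0" "tr (x2 \<star> y0) = 0" "tr (x3 \<star> y0) = 0" for x0 y0
  proof -
    have "y3 \<star> y0 \<in> J" using triple_product[OF ab x(1,2) y0(1)] y0 xx by simp
    then have "(y3 \<star> y0) \<star> x0 \<in> J" by (rule J_mult)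
    moreover have "(y3 \<star> y0) \<star> x0 - (tr (y0 \<star> x0) *s y3 - tr (y3 \<star> x0) *s y0) \<in> J"
      by (rule triple_product) (use ab y y0 x0 in auto)
    ultimately have "(y3 \<star> y0) \<star> x0 - ((y3 \<star> y0) \<star> x0 - (tr (y0 \<star> x0) *s y3 - tr (y3 \<star> x0) *s y0)) \<in> J"
      by (rule subspace_diff[OF subspace_J])
    then have "tr (y0 \<star> x0) *s y3 \<in> J" using x0(4) tr_commute[of x0 y3] by simp
    then have "tr ((tr (y0 \<star> x0) *s y3) \<star> x3) = 0" unfolding J_def by blast
    then show ?thesis using tr_commute[of x0 y0] by (simp add: mult_simps yx tr_scale tr1)
  qed
  define px where "px v = v - (tr (v \<star> y1) *s x1 + tr (v \<star> y2) *s x2 + tr (v \<star> y3) *s x3)" for v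
  define py where "py v = v - (tr (x1 \<star> v) *s y1 + tr (x2 \<star> v) *s y2 + tr (x3 \<star> v) *s y3)" for v
  have px: "px v \<in> P a b" "tr (px v \<star> y1) = 0" "tr (px v \<star> y2) = 0" "tr (px v \<star> y3) = 0"
    if "v \<in> P a b" for v
    using that x by (auto simp: px_def mult_simps xy tr_add tr_scale tr_diff tr1
      intro!: subspace_diff subspace_add subspace_scale subspace_P)
  have py: "py v \<in> P b a" "tr (x1 \<star> py v) = 0" "tr (x2 \<star> py v) = 0" "tr (x3 \<star> py v) = 0"
    if "v \<in> P b a" for v
    using that y by (auto simp: py_def mult_simps xy tr_add tr_scale tr_diff tr1
      intro!: subspace_diff subspace_add subspace_scale subspace_P)
  have liftX: "\<exists>u\<in>X. v - u \<in> J" if v: "v \<in> P a b" for v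
  proof -
    have "px v \<in> J"
    proof (rule in_J_if_homogeneous[OF _ _ px(1)[OF v]])
      fix t assume t: "t \<in> P b a"
      have "tr (px v \<star> py t) = 0" using pairing px[OF v] py[OF t] by blast
      then show "tr (px v \<star> t) = 0"
        using px[OF v] by (simp add: py_def mult_simps tr_diff tr_add tr_scale)
    qed (use ab in auto)
    moreover have "tr (v \<star> y1) *s x1 + tr (v \<star> y2) *s x2 + tr (v \<star> y3) *s x3 \<in> X"
      by (intro subspace_add subspace_scale sX gX)
    ultimately show ?thesis unfolding px_def by blast
  qed
  have liftY: "\<exists>u\<in>Y. v - u \<in> J" if v: "v \<in> P b a" for v
  proof -
    have "py v \<in> J"
    proof (rule in_J_if_homogeneous[OF _ _ py(1)[OF v]])
      fix t assume t: "t \<in> P a b"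
      have "tr (px t \<star> py v) = 0" using pairing px[OF t] py[OF v] by blast
      then show "tr (py v \<star> t) = 0"
        using py[OF v] tr_commute[of t] by (simp add: px_def mult_simps tr_diff tr_add tr_scale)
    qed (use ab in auto)
    moreover have "tr (x1 \<star> v) *s y1 + tr (x2 \<star> v) *s y2 + tr (x3 \<star> v) *s y3 \<in> Y"
      by (intro subspace_add subspace_scale sY gY)
    ultimately show ?thesis unfolding py_def by blast
  qed
  have neg: "- v \<in> X" if "v \<in> X" for v using subspace_neg[OF sX that] .
  have negY: "- v \<in> Y" if "v \<in> Y" for v using subspace_neg[OF sY that] .
  have XY: "u \<star> v \<in> span {a}" if "u \<in> X" "v \<in> Y" for u v
    by (rule mult_span_span[OF _ _ that[unfolded X_def Y_def]])
      (auto simp: xy intro: span_base span_zero)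
  have YX: "v \<star> u \<in> span {b}" if "u \<in> X" "v \<in> Y" for u v
    by (rule mult_span_span[OF _ _ that(2)[unfolded Y_def] that(1)[unfolded X_def]])
      (auto simp: yx intro: span_base span_zero)
  have XX: "u \<star> v \<in> Y" if "u \<in> X" "v \<in> X" for u v
    by (rule mult_span_span[OF _ sY that[unfolded X_def]])
      (auto simp: sq xx xx' gY negY subspace_0[OF sY])
  have YY: "u \<star> v \<in> X" if "u \<in> Y" "v \<in> Y" for u v
    by (rule mult_span_span[OF _ sX that[unfolded Y_def]])
      (auto simp: sq yy yy' gX neg subspace_0[OF sX])
  have "split_pair a b X Y"
    unfolding split_pair_def using sX sY XP YP XJ YJ liftX liftY XY YX XX YY by (intro conjI ballI)
  then show ?thesis by blast
qed

end

section \<open>The Wedderburn principal theorem\<close>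

context maximal_frame begin

text \<open>For \<open>v\<close> dual to \<open>u\<close> this says that the trace form on \<open>P\<^sub>a\<^sub>b \<times> P\<^sub>b\<^sub>a\<close> has rank one.\<close>
definition narrow :: "'u \<Rightarrow> 'u \<Rightarrow> 'u \<Rightarrow> 'u \<Rightarrow> bool" where
  "narrow a b u v \<longleftrightarrow> (\<forall>x\<in>P a b. x - tr (x \<star> v) *s u \<in> J)"

lemma narrow_sym:
  assumes ab: "a \<in> E" "b \<in> E" and uv: "u \<in> P a b" "v \<in> P b a" and n: "narrow a b u v"
  shows "narrow b a v u"
  unfolding narrow_def
proof
  fix y assume y: "y \<in> P b a"
  show "y - tr (y \<star> u) *s v \<in> J"
  proof (rule in_J_if_homogeneous)
    show "y - tr (y \<star> u) *s v \<in> P b a" using y uv by (intro subspace_diff subspace_scale subspace_P)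
    fix x assume "x \<in> P a b"
    then have "tr ((x - tr (x \<star> v) *s u) \<star> y) = 0" using n unfolding narrow_def J_def by blast
    then show "tr ((y - tr (y \<star> u) *s v) \<star> x) = 0"
      using tr_commute[of x] tr_commute[of u y] by (simp add: mult_simps tr_diff tr_scale mult.commute)
  qed (use ab in auto)
qed

lemma split_pair_narrow:
  assumes ab: "a \<in> E" "b \<in> E" "a \<noteq> b" and u: "u \<in> P a b" and v: "v \<in> P b a"
    and uv: "u \<star> v = a" "v \<star> u = b" and n: "narrow a b u v"
  shows "split_pair a b (span {u}) (span {v})"
proof -
  have n': "narrow b a v u" by (rule narrow_sym[OF ab(1,2) u v n])
  have sq: "u \<star> u = 0" "v \<star> v = 0"
    using offdiag_square_zero[of u a b] offdiag_square_zero[of v b a] u v ab by auto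
  have J: "span {u} \<inter> J \<subseteq> {0}" "span {v} \<inter> J \<subseteq> {0}"
    unfolding span_singleton J_def using uv tr_E ab
    by (auto simp: mult_simps tr_scale dest: spec[of _ u] spec[of _ v])
  have P: "span {u} \<subseteq> P a b" "span {v} \<subseteq> P b a"
    by (rule span_minimal; use u v subspace_P in simp)+
  have lift: "\<exists>w\<in>span {u}. x - w \<in> J" if "x \<in> P a b" for x
    using that n unfolding narrow_def by (auto simp: span_singleton)
  have lift': "\<exists>w\<in>span {v}. x - w \<in> J" if "x \<in> P b a" for x
    using that n' unfolding narrow_def by (auto simp: span_singleton)
  show ?thesis
    unfolding split_pair_def
    using J P lift lift' uv sq subspace_span[of "{u}", unfolded span_singleton]
      subspace_span[of "{v}", unfolded span_singleton]
    by (auto simp: span_singleton mult_simps)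
qed

lemma compress_commutes:
  assumes ab: "a \<in> E" "b \<in> E" "a \<noteq> b" and u: "u \<in> P a b" and v: "v \<in> P b a"
    and uv: "u \<star> v = a" "v \<star> u = b" and x: "x \<in> P a b"
  shows "(x \<star> v) \<star> u = u \<star> (v \<star> x)"
  using associator_swap_outer[of x v u] P_left_unit[OF x ab(1)] P_right_unit[OF x ab(2)]
  by (simp add: associator_def uv)

text \<open>Both products are determined by the common element \<open>(x v) u = u (v x)\<close>.\<close>

lemma annihilates_both_sides:
  assumes ab: "a \<in> E" "b \<in> E" "a \<noteq> b" and u: "u \<in> P a b" and v: "v \<in> P b a"
    and uv: "u \<star> v = a" "v \<star> u = b" and x: "x \<in> P a b"
  shows "x \<star> v = 0 \<longleftrightarrow> v \<star> x = 0"
proof -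
  note c = compress_commutes[OF assms]
  have xv: "x \<star> v \<in> P a a" and vx: "v \<star> x \<in> P b b" using P_mult x v by auto
  have "((x \<star> v) \<star> u) \<star> v = (x \<star> v) \<star> (u \<star> v)"
    by (rule P_assoc[OF _ _ _ _ xv u v]) (use ab in auto)
  then have 1: "((x \<star> v) \<star> u) \<star> v = x \<star> v" using P_right_unit[OF xv ab(1)] uv by simp
  have "(v \<star> u) \<star> (v \<star> x) = v \<star> (u \<star> (v \<star> x))"
    by (rule P_assoc[OF _ _ _ _ v u vx]) (use ab in auto)
  then have 2: "v \<star> (u \<star> (v \<star> x)) = v \<star> x" using P_left_unit[OF vx ab(2)] uv by simp
  show ?thesis using c 1 2 by (metis mult_zero)
qed

text \<open>If \<open>P\<^sub>a\<^sub>b\<close> is not spanned by \<open>u\<close> modulo \<open>J\<close>, a second dual pair orthogonal to \<open>(u, v)\<close> exists;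
  subtracting \<open>(x v) u\<close>, rather than a scalar multiple of \<open>u\<close>, makes the orthogonality exact.\<close>

lemma second_dual_pair:
  assumes ab: "a \<in> E" "b \<in> E" "a \<noteq> b" and u: "u \<in> P a b" and v: "v \<in> P b a"
    and uv: "u \<star> v = a" "v \<star> u = b" and n: "\<not> narrow a b u v"
  shows "\<exists>x y. dual_pair a b u v x y"
proof -
  have perp: "x - (x \<star> q) \<star> p \<in> P c d" "(x - (x \<star> q) \<star> p) \<star> q = 0"
    if "c \<in> E" "d \<in> E" "c \<noteq> d" "p \<in> P c d" "q \<in> P d c" "p \<star> q = c" "x \<in> P c d" for c d p q x
  proof -
    have xq: "x \<star> q \<in> P c c" using P_mult that by blast
    then show "x - (x \<star> q) \<star> p \<in> P c d" using P_mult subspace_diff[OF subspace_P] that by blast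
    have "((x \<star> q) \<star> p) \<star> q = (x \<star> q) \<star> (p \<star> q)"
      by (rule P_assoc[OF _ _ _ _ xq that(4,5)]) (use that in auto)
    then show "(x - (x \<star> q) \<star> p) \<star> q = 0"
      using P_right_unit[OF xq that(1)] that(6) by (simp add: mult_simps)
  qed
  obtain x where x: "x \<in> P a b" "x - tr (x \<star> v) *s u \<notin> J" using n unfolding narrow_def by blast
  define x2 where "x2 = x - (x \<star> v) \<star> u"
  note x2 = perp[OF ab u v uv(1) x(1), folded x2_def]
  have vx2: "v \<star> x2 = 0" using annihilates_both_sides[OF ab u v uv x2(1)] x2(2) by blast
  have "x2 \<notin> J"
  proof
    assume "x2 \<in> J"
    have xv: "x \<star> v \<in> P a a" by (rule P_mult[OF x(1) v])
    have "x \<star> v - tr (x \<star> v) *s a \<in> J" by (rule nilpotent_part_in_J[OF ab(1) xv])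
    then have "x2 + (x \<star> v - tr (x \<star> v) *s a) \<star> u \<in> J"
      using \<open>x2 \<in> J\<close> J_mult subspace_add[OF subspace_J] by blast
    with x(2) show False using P_left_unit[OF u ab(1)] by (simp add: x2_def mult_simps)
  qed
  then obtain y where y: "y \<in> P b a" "tr (x2 \<star> y) \<noteq> 0"
    using in_J_if_homogeneous[of a b x2] x2 ab by blast
  define y' where "y' = y - (y \<star> u) \<star> v"
  note y' = perp[OF ab(2,1) ab(3)[symmetric] v u uv(2) y(1), folded y'_def]
  have "tr (x2 \<star> ((y \<star> u) \<star> v)) = tr ((y \<star> u) \<star> (v \<star> x2))"
    by (subst tr_commute) (rule tr_assoc)
  then have "tr (x2 \<star> y') \<noteq> 0" using y(2) vx2 by (simp add: y'_def mult_simps tr_diff)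
  then obtain w where w: "w \<in> P a a" "x2 \<star> (y' \<star> w) = a"
    using right_normalise[OF ab x2(1) y'(1)] by blast
  define y2 where "y2 = y' \<star> w"
  have y2: "y2 \<in> P b a" unfolding y2_def by (rule P_mult[OF y'(1) w(1)])
  have "u \<star> y' = 0" using annihilates_both_sides[OF ab(2,1) ab(3)[symmetric] v u uv(2,1) y'(1)] y'(2) by blast
  moreover have "(u \<star> y') \<star> w = u \<star> (y' \<star> w)"
    by (rule P_assoc[OF _ _ _ _ u y'(1) w(1)]) (use ab in auto)
  ultimately have uy2: "u \<star> y2 = 0" by (simp add: y2_def)
  then have "y2 \<star> u = 0" using annihilates_both_sides[OF ab(2,1) ab(3)[symmetric] v u uv(2,1) y2] by blast
  then have "dual_pair a b u v x2 y2"
    using u v uv x2 y2 vx2 uy2 w(2) one_sided_inverse[OF ab x2(1) y2] unfolding dual_pair_def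
    by (simp add: y2_def)
  then show ?thesis by blast
qed

text \<open>A third linked idempotent \<open>c\<close> forces rank one: \<open>x y\<close> can be rewritten through the index \<open>c\<close>, where
  all products associate, as \<open>(x u) m\<^sub>b\<^sub>a\<close> with \<open>u\<close> in the local algebra \<open>P\<^sub>b\<^sub>b\<close>.\<close>

lemma narrow_if_third:
  assumes E: "a \<in> E" "b \<in> E" "c \<in> E" and ne: "a \<noteq> b" "b \<noteq> c" "a \<noteq> c"
    and m: "mab \<in> P a b" "mba \<in> P b a" "mbc \<in> P b c" "mcb \<in> P c b"
    and inv: "mab \<star> mba = a" "mbc \<star> mcb = b"
  shows "narrow a b mab mba"
  unfolding narrow_def
proof
  fix x assume "x \<in> P a b"
  define x0 where "x0 = x - tr (x \<star> mba) *s mab"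
  have x0: "x0 \<in> P a b" unfolding x0_def
    using \<open>x \<in> P a b\<close> m by (intro subspace_diff subspace_scale subspace_P)
  have tr0: "tr (mba \<star> x0) = 0"
    using tr_commute[of mba x0] tr_E[OF E(1)] by (simp add: x0_def mult_simps inv tr_diff tr_scale)
  have "x0 \<in> J"
  proof (rule in_J_if_homogeneous[OF _ _ x0])
    fix y assume y: "y \<in> P b a"
    define v where "v = mcb \<star> y"
    have v: "v \<in> P c a" unfolding v_def by (rule P_mult[OF m(4) y])
    define s where "s = v \<star> mab"
    have s: "s \<in> P c b" unfolding s_def by (rule P_mult[OF v m(1)])
    define u where "u = mbc \<star> s"
    have u: "u \<in> P b b" unfolding u_def by (rule P_mult[OF m(3) s])
    have "y = (mbc \<star> mcb) \<star> y" using P_left_unit[OF y E(2)] inv by simp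
    also have "\<dots> = mbc \<star> v" unfolding v_def
      by (rule P_assoc[OF _ _ _ _ m(3,4) y]) (use E ne in auto)
    also have "v = v \<star> (mab \<star> mba)" using P_right_unit[OF v E(1)] inv by simp
    also have "\<dots> = s \<star> mba" unfolding s_def
      by (rule P_assoc[OF _ _ _ _ v m(1,2), symmetric]) (use E ne in auto)
    finally have "tr (x0 \<star> y) = tr (((x0 \<star> mbc) \<star> s) \<star> mba)" by (simp only: tr_assoc)
    also have "(x0 \<star> mbc) \<star> s = x0 \<star> u" unfolding u_def
      by (rule P_assoc[OF _ _ _ _ x0 m(3) s]) (use E ne in auto)
    also have "tr ((x0 \<star> u) \<star> mba) = tr ((mba \<star> x0) \<star> u)"
      by (subst tr_commute) (rule tr_assoc[symmetric])
    also have "\<dots> = tr (mba \<star> x0) * tr u"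
      using P_mult[OF m(2) x0] u P_mult[OF P_mult[OF m(2) x0] u] E
      by (simp add: tr_diag[of b] residue_mult)
    finally show "tr (x0 \<star> y) = 0" by (simp add: tr0)
  qed (use E in auto)
  then show "x - tr (x \<star> mba) *s mab \<in> J" by (simp add: x0_def)
qed

text \<open>Three distinct indices linked in a chain force all pairs to have rank one, so products with distinct
  indices only involve matrix units; the octonionic pairs are classes of their own.\<close>

lemma split_family:
  obtains T where "\<And>a. a \<in> E \<Longrightarrow> T a a = span {a}"
    and "\<And>a b. a \<in> E \<Longrightarrow> b \<in> E \<Longrightarrow> a \<noteq> b \<Longrightarrow> split_pair a b (T a b) (T b a)"
    and "\<And>a b c x y. a \<in> E \<Longrightarrow> b \<in> E \<Longrightarrow> c \<in> E \<Longrightarrow> x \<in> T a b \<Longrightarrow> y \<in> T b c \<Longrightarrow> x \<star> y \<in> T a c"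
proof -
  obtain m where maa: "\<And>a. a \<in> E \<Longrightarrow> m a a = a"
    and mP: "\<And>a b. a \<in> E \<Longrightarrow> b \<in> E \<Longrightarrow> linked a b \<Longrightarrow> m a b \<in> P a b"
    and mm: "\<And>a b c. a \<in> E \<Longrightarrow> b \<in> E \<Longrightarrow> c \<in> E \<Longrightarrow> linked a b \<Longrightarrow> linked b c \<Longrightarrow> m a b \<star> m b c = m a c"
  proof (rule matrix_units, goal_cases)
    case (1 m)
    show ?case by (rule 1(1)[of m]) (rule 1(2-4), assumption+)+
  qed
  have minv: "m a b \<star> m b a = a" if "a \<in> E" "b \<in> E" "linked a b" for a b
    using mm[of a b a] maa that linked_sym by simp
  define thin where "thin a b \<longleftrightarrow> narrow a b (m a b) (m b a)" for a b
  have thin_sym: "thin b a" if "a \<in> E" "b \<in> E" "linked a b" "thin a b" for a b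
    using narrow_sym[of a b "m a b" "m b a"] mP linked_sym that unfolding thin_def by blast
  have thin3: "thin a b" if "a \<in> E" "b \<in> E" "c \<in> E" "a \<noteq> b" "b \<noteq> c" "a \<noteq> c" "linked a b" "linked b c" for a b c
    unfolding thin_def
    by (rule narrow_if_third[where c = c and mbc = "m b c" and mcb = "m c b"])
      (use that mP minv linked_sym in auto)
  have "\<exists>X Y. split_pair a b X Y" if ab: "a \<in> E" "b \<in> E" "a \<noteq> b" "linked a b" "\<not> thin a b" for a b
    using second_dual_pair[OF ab(1-3) mP[OF ab(1,2,4)] mP[OF ab(2,1) linked_sym[OF ab(4)]]
        minv[OF ab(1,2,4)] minv[OF ab(2,1) linked_sym[OF ab(4)]]] octonion_split_pair[OF ab(1-3)] ab(5)
    unfolding thin_def by blast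
  then obtain X where "\<And>a b. a \<in> E \<Longrightarrow> b \<in> E \<Longrightarrow> a \<noteq> b \<Longrightarrow> linked a b \<Longrightarrow> \<not> thin a b \<Longrightarrow>
      \<exists>Y. split_pair a b (X a b) Y" by metis
  then obtain Y where XY: "\<And>a b. a \<in> E \<Longrightarrow> b \<in> E \<Longrightarrow> a \<noteq> b \<Longrightarrow> linked a b \<Longrightarrow> \<not> thin a b \<Longrightarrow>
      split_pair a b (X a b) (Y a b)" by metis
  \<comment> \<open>An enumeration of \<open>E\<close> orients each octonionic pair, so that its two halves are chosen together.\<close>
  obtain h :: "'u \<Rightarrow> nat" where h: "inj_on h E" using finite_imp_inj_to_nat_seg[OF finite_E] by metis
  define T where "T a b = (if a = b then span {a} else if \<not> linked a b then {0}
    else if thin a b then span {m a b} else if h a < h b then X a b else Y b a)" for a b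
  have pair: "split_pair a b (T a b) (T b a)" if ab: "a \<in> E" "b \<in> E" "a \<noteq> b" for a b
  proof (cases "linked a b")
    case False
    then have "\<not> linked b a" using linked_sym by blast
    then show ?thesis
      using False not_linked_in_J[OF ab(1,2) False] not_linked_in_J[OF ab(2,1)] ab(3)
        subspace_0[OF subspace_P] unfolding T_def split_pair_def by (auto simp: span_zero)
  next
    case l: True
    then have l': "linked b a" by (rule linked_sym)
    show ?thesis
    proof (cases "thin a b")
      case True
      then have "thin b a" using thin_sym ab l by blast
      then show ?thesis
        using split_pair_narrow[OF ab mP[OF ab(1,2) l] mP[OF ab(2,1) l'] minv[OF ab(1,2) l]
            minv[OF ab(2,1) l']] True l l' ab(3) unfolding T_def thin_def by simp
    next
      case False
      then have n: "\<not> thin b a" using thin_sym ab l' by blast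
      have "h a \<noteq> h b" using h ab by (auto dest: inj_onD)
      then consider "h a < h b" | "h b < h a" by linarith
      then show ?thesis
        by cases (use XY[OF ab l False] XY[OF ab(2,1) ab(3)[symmetric] l' n] split_pair_sym False n l l' ab(3)
          in \<open>auto simp: T_def\<close>)
    qed
  qed
  have diag: "T a a = span {a}" for a by (simp add: T_def)
  have TP: "T a b \<subseteq> P a b" and Tsub: "subspace (T a b)" if "a \<in> E" "b \<in> E" for a b
    using pair[OF that] that E_in_P[of a] span_minimal[OF _ subspace_P, of "{a}"] diag
    unfolding split_pair_def by (cases "a = b"; auto)+
  have mult: "x \<star> y \<in> T a c" if E: "a \<in> E" "b \<in> E" "c \<in> E" and x: "x \<in> T a b" and y: "y \<in> T b c" for a b c x y
  proof -
    consider "a = b" | "b = c" | "a \<noteq> b" "a = c" | "a \<noteq> b" "b \<noteq> c" "a \<noteq> c" by blast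
    then show ?thesis
    proof cases
      case 1
      then obtain k where "x = k *s b" using x diag by (auto simp: span_singleton)
      then show ?thesis using P_left_unit[of y b c] TP[OF E(2,3)] y E 1 subspace_scale[OF Tsub]
        by (auto simp: mult_simps)
    next
      case 2
      then obtain k where "y = k *s b" using y diag by (auto simp: span_singleton)
      then show ?thesis using P_right_unit[of x a b] TP[OF E(1,2)] x E 2 subspace_scale[OF Tsub]
        by (auto simp: mult_simps)
    next
      case 3
      then show ?thesis using pair[OF E(1,2)] x y diag unfolding split_pair_def by auto
    next
      case 4
      show ?thesis
      proof (cases "linked a b \<and> linked b c")
        case False
        then have "x = 0 \<or> y = 0" using x y 4 unfolding T_def by auto
        then show ?thesis using subspace_0[OF Tsub[OF E(1,3)]] by auto
      next
        case True
        then have l: "linked a b" "linked b c" "linked a c" using linked_trans E by blast+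
        have "thin a b" "thin b c" "thin a c"
          using thin3[OF E] thin3[OF E(2,3,1)] thin3[OF E(1,3,2)] 4 l linked_sym by auto
        then obtain k j where "x = k *s m a b" "y = j *s m b c"
          using x y 4 l unfolding T_def by (auto simp: span_singleton)
        then have "x \<star> y = (k * j) *s m a c" using mm[OF E l(1,2)] by (simp add: mult_simps)
        then show ?thesis using \<open>thin a c\<close> l 4 unfolding T_def by (auto simp: span_singleton)
      qed
    qed
  qed
  show thesis by (rule that[of T, OF diag pair mult])
qed

text \<open>The span of the family is homogeneous, so it can be compared with \<open>J\<close> one Peirce component at a
  time. The components with an index \<open>0\<close> belong to \<open>J\<close>.\<close>

theorem wedderburn_principal:
  obtains S where "subalgebra S" "S \<inter> J \<subseteq> {0}" "\<And>x. \<exists>s\<in>S. x - s \<in> J"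
proof -
  obtain T where diag: "\<And>a. a \<in> E \<Longrightarrow> T a a = span {a}"
    and pair: "\<And>a b. a \<in> E \<Longrightarrow> b \<in> E \<Longrightarrow> a \<noteq> b \<Longrightarrow> split_pair a b (T a b) (T b a)"
    and mult: "\<And>a b c x y. a \<in> E \<Longrightarrow> b \<in> E \<Longrightarrow> c \<in> E \<Longrightarrow> x \<in> T a b \<Longrightarrow> y \<in> T b c \<Longrightarrow> x \<star> y \<in> T a c"
  proof (rule split_family, goal_cases)
    case (1 T)
    show ?case by (rule 1(1)[of T]) (rule 1(2-4), assumption+)+
  qed
  have TP: "T a b \<subseteq> P a b" and Tsub: "subspace (T a b)" if "a \<in> E" "b \<in> E" for a b
    using pair[OF that] that E_in_P[of a] span_minimal[OF _ subspace_P, of "{a}"] diag[of a]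
    unfolding split_pair_def by (cases "a = b"; auto)+
  have TJ: "x = 0" if "a \<in> E" "b \<in> E" "x \<in> T a b" "x \<in> J" for a b x
  proof (cases "a = b")
    case False
    then show ?thesis using pair[OF that(1,2)] that(3,4) unfolding split_pair_def by blast
  next
    case True
    then have "x \<in> span {a}" using that diag[OF that(1)] by simp
    then obtain k where k: "x = k *s a" by (auto simp: span_singleton)
    then have "tr (x \<star> a) = k" using E_idem[OF that(1)] tr_E[OF that(1)] by (simp add: mult_simps tr_scale)
    then show ?thesis using k that(4) unfolding J_def by simp
  qed
  define G where "G = (\<Union>a\<in>E. \<Union>b\<in>E. T a b)"
  define S where "S = span G"
  have G: "T a b \<subseteq> S" if "a \<in> E" "b \<in> E" for a b
    using that unfolding S_def G_def by (auto intro!: span_base)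
  have "x \<star> y \<in> S" if "x \<in> G" "y \<in> G" for x y
  proof -
    from that obtain a b c d where E: "a \<in> E" "b \<in> E" "c \<in> E" "d \<in> E" and x: "x \<in> T a b" and y: "y \<in> T c d"
      unfolding G_def by blast
    have xP: "x \<in> P a b" and yP: "y \<in> P c d" using TP E x y by blast+
    consider "b = c" | "b \<noteq> c" "c = a" "d = b" | "b \<noteq> c" "\<not> (c = a \<and> d = b)" by blast
    then show ?thesis
    proof cases
      case 1
      then show ?thesis using mult[of a b d x y] x y E G by blast
    next
      case 2
      then have "x \<star> y \<in> T b a" using pair[OF E(1,2)] x y unfolding split_pair_def by blast
      then show ?thesis using G E by blast
    next
      case 3
      then have "x \<star> y = 0" by (intro P_mult_zero[OF _ _ _ _ xP yP]) (use E in auto)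
      then show ?thesis by (simp add: S_def span_zero)
    qed
  qed
  then have "subalgebra S" unfolding subalgebra_def S_def using mult_span_span[of G G "span G"] by blast
  moreover have "S \<inter> J \<subseteq> {0}"
  proof
    fix x assume x: "x \<in> S \<inter> J"
    have comp: "(a \<in> E \<and> b \<in> E \<longrightarrow> component a b x \<in> T a b) \<and> (\<not> (a \<in> E \<and> b \<in> E) \<longrightarrow> component a b x = 0)"
      if I: "a \<in> I" "b \<in> I" for a b
    proof -
      from x have "x \<in> span G" by (simp add: S_def)
      then show ?thesis
      proof (induction rule: span_induct_alt)
        case base
        show ?case using subspace_0[OF Tsub] by (simp add: component_linear)
      next
        case (step k g z)
        then obtain c d where cd: "c \<in> E" "d \<in> E" "g \<in> T c d" unfolding G_def by blast
        then have "component a b g = (if a = c \<and> b = d then g else 0)"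
          using TP I by (intro component_P) auto
        with step cd show ?case
          using subspace_add[OF Tsub] subspace_scale[OF Tsub] subspace_0[OF Tsub]
          by (auto simp: component_linear)
      qed
    qed
    have "component a b x = 0" if "a \<in> I" "b \<in> I" for a b
      using comp[OF that] TJ ideal_component[OF ideal_J, of x a b] x by blast
    then have "(\<Sum>b\<in>I. \<Sum>a\<in>I. component a b x) = 0" by (intro sum.neutral ballI)
    then show "x \<in> {0}" by (simp only: component_sum singleton_iff)
  qed
  moreover have "\<exists>s\<in>S. x - s \<in> J" for x
  proof (induction x rule: peirce_induct)
    case (homogeneous a b x)
    have S0: "0 \<in> S" by (simp add: S_def span_zero)
    show ?case
    proof (cases "a = 0 \<or> b = 0")
      case True
      then have "x - 0 \<in> J" using P_zero_in_J[OF homogeneous(1,2) _ homogeneous(3)] by simp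
      with S0 show ?thesis by blast
    next
      case False
      then have E: "a \<in> E" "b \<in> E" using homogeneous by auto
      show ?thesis
      proof (cases "a = b")
        case True
        then have x: "x \<in> P a a" using homogeneous by simp
        have "x - tr x *s a \<in> J" by (rule nilpotent_part_in_J[OF E(1) x])
        moreover have "tr x *s a \<in> S"
          using G[OF E(1) E(1)] diag[OF E(1)] by (auto simp: span_singleton)
        ultimately show ?thesis by blast
      next
        case False
        then show ?thesis using pair[OF E] homogeneous(3) G[OF E] unfolding split_pair_def by blast
      qed
    qed
  next
    case (add x y)
    then obtain s t where "s \<in> S" "t \<in> S" "x - s \<in> J" "y - t \<in> J" by blast
    then have "s + t \<in> S" "(x + y) - (s + t) \<in> J"
      using subspace_add[OF subspace_J, of "x - s" "y - t"] by (auto simp: S_def span_add algebra_simps)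
    then show ?case by blast
  qed
  ultimately show thesis using that by blast
qed

end

section \<open>Ideals of weight zero and the \<open>b\<close>-radical\<close>

context alternative_algebra begin

lemma subspace_complement:
  assumes R: "subspace R" and M: "subspace M" "R \<subseteq> M"
  obtains V where "subspace V" "V \<subseteq> M" "V \<inter> R \<subseteq> {0}" "\<And>x. x \<in> M \<Longrightarrow> \<exists>v\<in>V. x - v \<in> R"
proof -
  define ok where "ok V \<longleftrightarrow> subspace V \<and> V \<subseteq> M \<and> V \<inter> R \<subseteq> {0}" for V
  have "ok {0}" unfolding ok_def using subspace_0[OF M(1)] by auto
  moreover have "\<forall>V. ok V \<longrightarrow> dim V \<le> dimension" using dim_subset_UNIV by blast
  ultimately obtain V where V: "ok V" and Vmax: "\<And>Y. ok Y \<Longrightarrow> dim Y \<le> dim V"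
    using ex_has_greatest_nat[of ok "{0}" dim] by (metis less_Suc_eq_le)
  have sV: "subspace V" and VM: "V \<subseteq> M" and VR: "V \<inter> R \<subseteq> {0}" using V unfolding ok_def by auto
  have "\<exists>v\<in>V. x - v \<in> R" if x: "x \<in> M" for x
  proof (rule ccontr)
    assume no: "\<not> ?thesis"
    then have "x \<notin> V" using subspace_0[OF R] by force
    have "ok (span (insert x V))"
      unfolding ok_def
    proof (intro conjI subspace_span)
      show "span (insert x V) \<subseteq> M" using x VM by (intro span_minimal M) auto
      show "span (insert x V) \<inter> R \<subseteq> {0}"
      proof
        fix y assume y: "y \<in> span (insert x V) \<inter> R"
        then obtain k where k: "y - k *s x \<in> V"
          using sV by (auto simp: span_breakdown_eq span_eq_iff[THEN iffD2])
        have "k = 0"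
        proof (rule ccontr)
          assume "k \<noteq> 0"
          define v where "v = (- inverse k) *s (y - k *s x)"
          have "v \<in> V" unfolding v_def by (rule subspace_scale[OF sV k])
          moreover have "x - v = inverse k *s y"
            using \<open>k \<noteq> 0\<close> by (simp add: v_def algebra_simps)
          then have "x - v \<in> R" using y subspace_scale[OF R] by simp
          ultimately show False using no by blast
        qed
        with k y VR show "y \<in> {0}" by auto
      qed
    qed
    from Vmax[OF this] show False
      using \<open>x \<notin> V\<close> sV by (simp add: dim_insert span_eq_iff[THEN iffD2])
  qed
  with that sV VM VR show thesis by blast
qed

lemma ideal_subspace: "two_sided_ideal A K \<Longrightarrow> subspace K"
  unfolding two_sided_ideal_def by simp

lemma ideal_zero: "two_sided_ideal A K \<Longrightarrow> 0 \<in> K"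
  by (rule subspace_0[OF ideal_subspace])

text \<open>Expanding \<open>(a, x, y) = - (x, a, y)\<close> writes \<open>a (x y)\<close> as a combination of products of two elements of
  the ideal.\<close>

lemma square_of_ideal:
  assumes K: "two_sided_ideal UNIV K" shows "two_sided_ideal UNIV (square K)"
proof -
  have KM: "\<And>x y. x \<in> K \<Longrightarrow> x \<star> y \<in> K" "\<And>x y. x \<in> K \<Longrightarrow> y \<star> x \<in> K"
    using K unfolding two_sided_ideal_def by auto
  have sq: "x \<star> y \<in> square K" if "x \<in> K" "y \<in> K" for x y
    unfolding square_def using that by (auto intro!: span_base)
  have sub: "subspace (square K)" unfolding square_def by simp
  have gen: "a \<star> (x \<star> y) \<in> square K" "(x \<star> y) \<star> a \<in> square K" if xy: "x \<in> K" "y \<in> K" for a x y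
  proof -
    have "a \<star> (x \<star> y) = (a \<star> x) \<star> y + (x \<star> a) \<star> y - x \<star> (a \<star> y)"
      using associator_swap_left[of a x y] by (simp add: associator_def algebra_simps)
    then show "a \<star> (x \<star> y) \<in> square K"
      using xy KM sq by (simp add: subspace_add[OF sub] subspace_diff[OF sub])
    have "(x \<star> y) \<star> a = x \<star> (y \<star> a) + x \<star> (a \<star> y) - (x \<star> a) \<star> y"
      using associator_swap_right[of x y a] by (simp add: associator_def algebra_simps)
    then show "(x \<star> y) \<star> a \<in> square K"
      using xy KM sq by (simp add: subspace_add[OF sub] subspace_diff[OF sub])
  qed
  have "a \<star> x \<in> square K" if "x \<in> square K" for a x
    using that[unfolded square_def] by (rule mult_span_right[OF _ sub, rotated]) (use gen in auto)
  moreover have "x \<star> a \<in> square K" if "x \<in> square K" for a x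
    using that[unfolded square_def] by (rule mult_span_left[OF _ sub, rotated]) (use gen in auto)
  ultimately show ?thesis unfolding two_sided_ideal_def using sub by auto
qed

end

locale b_frame = maximal_frame scale mult Basis E + b_algebra scale mult \<omega>
  for scale :: "'f::alg_closed_field \<Rightarrow> 'u::ab_group_add \<Rightarrow> 'u" (infixr \<open>*s\<close> 75)
    and mult :: "'u \<Rightarrow> 'u \<Rightarrow> 'u" (infixl \<open>\<star>\<close> 70)
    and Basis :: "'u set" and E :: "'u set" and \<omega> :: "'u \<Rightarrow> 'f"
begin

lemma weight_add: "\<omega> (x + y) = \<omega> x + \<omega> y"
  and weight_scale: "\<omega> (c *s x) = c * \<omega> x"
proof -
  interpret w: Vector_Spaces.linear scale "(*)" \<omega> by (rule weight_linear)
  show "\<omega> (x + y) = \<omega> x + \<omega> y" "\<omega> (c *s x) = c * \<omega> x" by (rule w.add w.scale)+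
qed

lemma weight_0 [simp]: "\<omega> 0 = 0"
  using weight_scale[of 0 0] by simp

lemma weight_diff: "\<omega> (x - y) = \<omega> x - \<omega> y"
  using weight_add[of "x - y" y] by simp

lemma weight_npow: "\<omega> (npow x k) = \<omega> x ^ Suc k"
  by (induction k) (auto simp: npow_Suc weight_mult)

lemma weight_nilp: "nilp x \<Longrightarrow> \<omega> x = 0"
  unfolding nilp_def using weight_npow by (metis power_not_zero weight_0)

lemma subspace_bar: "subspace B \<Longrightarrow> subspace (bar B)"
  by (rule subspaceI) (auto simp: bar_def subspace_0 subspace_add subspace_scale weight_add weight_scale)

text \<open>The idempotent \<open>f\<close> obtained from an element \<open>x\<close> of nonzero weight satisfies \<open>x\<^sup>k f = x\<^sup>k\<close> for some \<open>k\<close>, so its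
  weight is one.\<close>

lemma weight_one_idempotent:
  assumes A: "b_subalgebra U A" obtains f where "f \<in> A" "f \<star> f = f" "\<omega> f = 1"
proof -
  obtain x where x: "x \<in> A" "\<omega> x \<noteq> 0" and sub: "subalgebra A"
    using A unfolding b_subalgebra_def by auto
  then have "\<not> nilp x" using weight_nilp by blast
  then obtain f k where f: "f \<in> span (range (npow x))" "f \<star> f = f" "npow x k \<star> f = npow x k"
    by (rule idempotent_from_non_nilpotent)
  from arg_cong[OF f(3), of \<omega>] x have "\<omega> f = 1" by (simp add: weight_mult weight_npow)
  with that f span_npow_in_subalgebra[OF sub x(1)] show thesis by blast
qed

text \<open>A subalgebra is spanned by its bar and any one of its elements of weight one. So inclusions between
  normal subalgebras can be tested on their bars.\<close>

lemma bar_determines: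
  assumes "b_subalgebra U B" "b_subalgebra U' C" "B \<subseteq> C" "bar C \<subseteq> bar B" shows "B = C"
proof
  show "C \<subseteq> B"
  proof
    fix c assume c: "c \<in> C"
    have sB: "subspace B" and sC: "subspace C"
      using assms unfolding b_subalgebra_def subalgebra_def by auto
    obtain f where f: "f \<in> B" "\<omega> f = 1" using weight_one_idempotent[OF assms(1)] by metis
    have "c - \<omega> c *s f \<in> bar C"
      using c f assms(3) by (auto simp: bar_def weight_diff weight_scale
        intro!: subspace_diff[OF sC] subspace_scale[OF sC])
    then have "c - \<omega> c *s f \<in> B" using assms(4) unfolding bar_def by blast
    then have "(c - \<omega> c *s f) + \<omega> c *s f \<in> B" using f by (intro subspace_add subspace_scale sB)
    then show "c \<in> B" by simp
  qed
qed (rule assms(3))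

text \<open>The bar of a normal subalgebra \<open>B\<close> of \<open>A\<close> is an ideal of all of \<open>A\<close>, since \<open>A\<close> is spanned by \<open>bar A\<close>
  and an element of \<open>B\<close> of weight one. Conversely, adding an idempotent of weight one turns an
  ideal of weight zero into a normal subalgebra (\<open>normal_with_bar\<close>).\<close>

lemma bar_normal_ideal:
  assumes A: "b_subalgebra U A" and B: "normal_b_subalgebra A B"
  shows "two_sided_ideal A (bar B)" "bar B \<subseteq> bar A"
proof -
  have subB: "subalgebra B" and BA: "B \<subseteq> A" and bB: "b_subalgebra A B"
    and id: "\<And>a x. a \<in> bar A \<Longrightarrow> x \<in> bar B \<Longrightarrow> a \<star> x \<in> bar B \<and> x \<star> a \<in> bar B"
    using B unfolding normal_b_subalgebra_def b_subalgebra_def two_sided_ideal_def by auto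
  have sA: "subspace A" and sB: "subspace B"
    using A subB unfolding b_subalgebra_def subalgebra_def by auto
  have sbB: "subspace (bar B)" by (rule subspace_bar[OF sB])
  obtain f where f: "f \<in> B" "\<omega> f = 1" using weight_one_idempotent[OF bB] by metis
  have "a \<star> x \<in> bar B \<and> x \<star> a \<in> bar B" if a: "a \<in> A" and x: "x \<in> bar B" for a x
  proof -
    define n where "n = a - \<omega> a *s f"
    have n: "n \<in> bar A" using a f BA by (auto simp: n_def bar_def weight_diff weight_scale
        intro!: subspace_diff[OF sA] subspace_scale[OF sA])
    have fx: "f \<star> x \<in> bar B" "x \<star> f \<in> bar B"
      using f x subB unfolding bar_def subalgebra_def by (auto simp: weight_mult)
    have "a = n + \<omega> a *s f" by (simp add: n_def)
    then have "a \<star> x = n \<star> x + \<omega> a *s (f \<star> x)" "x \<star> a = x \<star> n + \<omega> a *s (x \<star> f)"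
      by (metis mult_add_left mult_scale_left, metis mult_add_right mult_scale_right)
    then show ?thesis
      using id[OF n x] fx by (simp add: subspace_add[OF sbB] subspace_scale[OF sbB])
  qed
  then show "two_sided_ideal A (bar B)"
    unfolding two_sided_ideal_def using sbB BA by (auto simp: bar_def)
  show "bar B \<subseteq> bar A" using BA by (auto simp: bar_def)
qed

lemma normal_from_ideal:
  assumes A: "b_subalgebra U A" and K: "two_sided_ideal A K" "K \<subseteq> bar A"
    and B0: "b_subalgebra A B0" "bar B0 \<subseteq> K"
  shows "normal_b_subalgebra A {b + k | b k. b \<in> B0 \<and> k \<in> K}" "bar {b + k | b k. b \<in> B0 \<and> k \<in> K} = K"
proof -
  define B where "B = {b + k | b k. b \<in> B0 \<and> k \<in> K}"
  have sK: "subspace K" and KM: "\<And>a x. a \<in> A \<Longrightarrow> x \<in> K \<Longrightarrow> a \<star> x \<in> K \<and> x \<star> a \<in> K"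
    using K unfolding two_sided_ideal_def by auto
  have sB0: "subspace B0" and B0M: "\<And>x y. x \<in> B0 \<Longrightarrow> y \<in> B0 \<Longrightarrow> x \<star> y \<in> B0" and B0A: "B0 \<subseteq> A"
    and sA: "subspace A"
    using A B0 unfolding b_subalgebra_def subalgebra_def by auto
  have B0B: "B0 \<subseteq> B" unfolding B_def using subspace_0[OF sK] by force
  have KA: "K \<subseteq> A" using K(2) unfolding bar_def by blast
  have "b + k \<in> A" if "b \<in> B0" "k \<in> K" for b k
    using that B0A KA subspace_add[OF sA] by blast
  then have BA: "B \<subseteq> A" unfolding B_def by blast
  have sB: "subspace B"
    unfolding B_def using subspace_sums[OF sB0 sK] .
  have "x \<star> y \<in> B" if "x \<in> B" "y \<in> B" for x y
  proof -
    from that obtain b k c l where b: "x = b + k" "y = c + l" "b \<in> B0" "c \<in> B0" "k \<in> K" "l \<in> K"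
      unfolding B_def by blast
    have "x \<star> y = b \<star> c + (k \<star> y + b \<star> l)" by (simp add: b mult_simps algebra_simps)
    moreover have "k \<star> y + b \<star> l \<in> K"
      using KM b that BA B0A by (intro subspace_add[OF sK]) blast+
    ultimately show ?thesis unfolding B_def using B0M b by blast
  qed
  then have bB: "b_subalgebra A B"
    unfolding b_subalgebra_def subalgebra_def using sB BA B0B B0(1)[unfolded b_subalgebra_def] by blast
  have bar: "bar B = K"
  proof
    show "bar B \<subseteq> K"
    proof
      fix x assume "x \<in> bar B"
      then obtain b k where x: "x = b + k" "b \<in> B0" "k \<in> K" "\<omega> x = 0" unfolding bar_def B_def by blast
      then have "b \<in> bar B0" using K(2) by (auto simp: bar_def weight_add)
      then show "x \<in> K" using B0(2) x subspace_add[OF sK] by blast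
    qed
    show "K \<subseteq> bar B" using K(2) subspace_0[OF sB0] unfolding bar_def B_def by force
  qed
  have "two_sided_ideal (bar A) K"
    using K KM unfolding two_sided_ideal_def bar_def by blast
  then have "normal_b_subalgebra A B" unfolding normal_b_subalgebra_def using bB bar by simp
  with bar show "normal_b_subalgebra A {b + k | b k. b \<in> B0 \<and> k \<in> K}"
    "bar {b + k | b k. b \<in> B0 \<and> k \<in> K} = K" by (auto simp: B_def)
qed

lemma idempotent_line:
  assumes A: "b_subalgebra U A" shows "\<exists>B0. b_subalgebra A B0 \<and> bar B0 = {0}"
proof -
  obtain f where f: "f \<in> A" "f \<star> f = f" "\<omega> f = 1" by (rule weight_one_idempotent[OF A])
  have sA: "subspace A" using A unfolding b_subalgebra_def subalgebra_def by blast
  have "span {f} \<subseteq> A" by (rule span_minimal) (use f sA in auto)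
  moreover have "f \<in> span {f}" by (rule span_base) simp
  then have "\<not> span {f} \<subseteq> {x. \<omega> x = 0}" using f(3) by auto
  moreover have "x \<star> y \<in> span {f}" if "x \<in> span {f}" "y \<in> span {f}" for x y
    using that f(2) by (auto simp: span_singleton mult_simps)
  ultimately have "b_subalgebra A (span {f})"
    unfolding b_subalgebra_def subalgebra_def by simp
  moreover have "bar (span {f}) = {0}"
    using f by (auto simp: bar_def span_singleton weight_scale intro!: image_eqI[of _ _ 0])
  ultimately show ?thesis by blast
qed

lemma normal_with_bar:
  assumes A: "b_subalgebra U A" and K: "two_sided_ideal A K" "K \<subseteq> bar A"
  obtains B where "normal_b_subalgebra A B" "bar B = K"
proof -
  obtain B0 where B0: "b_subalgebra A B0" "bar B0 = {0}" using idempotent_line[OF A] by blast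
  have "bar B0 \<subseteq> K" using B0(2) ideal_zero[OF K(1)] by simp
  from normal_from_ideal[OF A K B0(1) this] show thesis by (rule that)
qed

definition maximal_null_ideal :: "'u set \<Rightarrow> 'u set \<Rightarrow> bool" where
  "maximal_null_ideal A K \<longleftrightarrow> two_sided_ideal A K \<and> K \<subset> bar A \<and>
     (\<forall>L. two_sided_ideal A L \<and> K \<subseteq> L \<and> L \<subset> bar A \<longrightarrow> L = K)"

lemma maximal_normal_iff:
  assumes A: "b_subalgebra U A"
  shows "bar ` {B. maximal_normal_b_subalgebra A B} = {K. maximal_null_ideal A K}"
proof (intro equalityI subsetI)
  have AA: "b_subalgebra A A" using A unfolding b_subalgebra_def by blast
  { fix K assume "K \<in> bar ` {B. maximal_normal_b_subalgebra A B}"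
    then obtain B where K: "K = bar B" and B: "normal_b_subalgebra A B" "B \<noteq> A"
      and max: "\<not> (\<exists>C. normal_b_subalgebra A C \<and> B \<subset> C \<and> C \<subset> A)"
      by (auto simp: maximal_normal_b_subalgebra_def)
    have bB: "b_subalgebra A B" using B unfolding normal_b_subalgebra_def by blast
    note id = bar_normal_ideal[OF A B(1)]
    have BA: "B \<subseteq> A" using bB unfolding b_subalgebra_def by blast
    have ne: "bar B \<noteq> bar A" using bar_determines[OF bB AA BA] B(2) by blast
    have "L = K" if L: "two_sided_ideal A L" "K \<subseteq> L" "L \<subset> bar A" for L
    proof (rule ccontr)
      assume "L \<noteq> K"
      define C where "C = {b + k | b k. b \<in> B \<and> k \<in> L}"
      have C: "normal_b_subalgebra A C" "bar C = L"
        using normal_from_ideal[OF A L(1) _ bB] L K unfolding C_def by auto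
      have sL: "0 \<in> L" by (rule ideal_zero[OF L(1)])
      then have "B \<subseteq> C" unfolding C_def by force
      moreover have "C \<subseteq> A" using C(1) unfolding normal_b_subalgebra_def b_subalgebra_def by blast
      moreover have "C \<noteq> B" "C \<noteq> A" using C(2) K L \<open>L \<noteq> K\<close> by auto
      ultimately show False using max C(1) by blast
    qed
    then show "K \<in> {K. maximal_null_ideal A K}"
      unfolding maximal_null_ideal_def using id ne K by blast }
  { fix K assume "K \<in> {K. maximal_null_ideal A K}"
    then have K: "two_sided_ideal A K" "K \<subset> bar A"
      and max: "\<And>L. two_sided_ideal A L \<Longrightarrow> K \<subseteq> L \<Longrightarrow> L \<subset> bar A \<Longrightarrow> L = K"
      unfolding maximal_null_ideal_def by auto
    obtain B where B: "normal_b_subalgebra A B" "bar B = K"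
      by (rule normal_with_bar[OF A K(1) psubset_imp_subset[OF K(2)]])
    have bB: "b_subalgebra A B" using B unfolding normal_b_subalgebra_def by blast
    have "B \<noteq> A" using B(2) K by auto
    moreover have False if C: "normal_b_subalgebra A C" "B \<subset> C" "C \<subset> A" for C
    proof -
      have bC: "b_subalgebra A C" using C unfolding normal_b_subalgebra_def by blast
      note id = bar_normal_ideal[OF A C(1)]
      have "K \<subseteq> bar C" using C(2) B(2) unfolding bar_def by blast
      moreover have "bar C \<noteq> bar A" using bar_determines[OF bC AA] C(3) by blast
      ultimately have "bar C = K" using max[OF id(1)] id(2) by blast
      then show False using bar_determines[OF bB bC] C(2) B(2) by blast
    qed
    ultimately have "maximal_normal_b_subalgebra A B"
      unfolding maximal_normal_b_subalgebra_def using B(1) by blast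
    then show "K \<in> bar ` {B. maximal_normal_b_subalgebra A B}" using B(2) by blast }
qed

text \<open>If \<open>A\<close> is \<open>b\<close>-simple, the zero ideal is maximal unless \<open>bar A\<close> is itself zero, so the same formula
  covers both clauses of the definition.\<close>

theorem b_radical_eq:
  assumes A: "b_subalgebra U A"
  shows "b_radical A = bar A \<inter> \<Inter> {K. maximal_null_ideal A K}"
proof (cases "b_simple A")
  case False
  have "(\<Inter>B\<in>{B. maximal_normal_b_subalgebra A B}. bar B) = \<Inter> {K. maximal_null_ideal A K}"
    using maximal_normal_iff[OF A] by simp
  then show ?thesis using False unfolding b_radical_def by simp
next
  case True
  have sub: "subspace (bar A)" using A subspace_bar unfolding b_subalgebra_def subalgebra_def by blast
  have zero: "0 \<in> K" if "maximal_null_ideal A K" for K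
    using that ideal_zero[of A K] unfolding maximal_null_ideal_def by simp
  have "bar A \<inter> \<Inter> {K. maximal_null_ideal A K} \<subseteq> {0}"
  proof (cases "bar A = {0}")
    case False
    have "maximal_null_ideal A {0}"
      unfolding maximal_null_ideal_def
    proof (intro conjI allI impI)
      show "two_sided_ideal A {0}"
        using A subspace_0 unfolding two_sided_ideal_def b_subalgebra_def subalgebra_def by auto
      show "{0} \<subset> bar A" using False subspace_0[OF sub] by blast
      fix L assume L: "two_sided_ideal A L \<and> {0} \<subseteq> L \<and> L \<subset> bar A"
      then have L': "two_sided_ideal A L" "L \<subseteq> bar A" by auto
      obtain B where "normal_b_subalgebra A B" "bar B = L" by (rule normal_with_bar[OF A L'])
      with True L show "L = {0}" unfolding b_simple_def by blast
    qed
    then show ?thesis by blast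
  qed simp
  then show ?thesis using True zero subspace_0[OF sub] unfolding b_radical_def by auto
qed

lemma maximal_null_ideal_above:
  assumes "two_sided_ideal A K" "K \<subset> bar A" obtains L where "maximal_null_ideal A L" "K \<subseteq> L"
proof -
  define ok where "ok L \<longleftrightarrow> two_sided_ideal A L \<and> K \<subseteq> L \<and> L \<subset> bar A" for L
  have "ok K" unfolding ok_def using assms by blast
  moreover have "\<forall>V. ok V \<longrightarrow> dim V \<le> dimension" using dim_subset_UNIV by blast
  ultimately obtain L where L: "ok L" and Lmax: "\<And>Y. ok Y \<Longrightarrow> dim Y \<le> dim L"
    using ex_has_greatest_nat[of ok K dim] by (metis less_Suc_eq_le)
  have "Y = L" if "two_sided_ideal A Y" "L \<subseteq> Y" "Y \<subset> bar A" for Y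
  proof -
    have "ok Y" using that L unfolding ok_def by blast
    from Lmax[OF this] show ?thesis
      using subspace_dim_equal[of L Y] that L unfolding ok_def two_sided_ideal_def by blast
  qed
  then have "maximal_null_ideal A L" unfolding maximal_null_ideal_def using L ok_def by blast
  then show thesis using that L unfolding ok_def by blast
qed

lemma b_radical_ideal:
  assumes A: "b_subalgebra U A" shows "two_sided_ideal A (b_radical A)" "b_radical A \<subseteq> bar A"
proof -
  show sub: "b_radical A \<subseteq> bar A" unfolding b_radical_eq[OF A] by blast
  have sA: "subspace (bar A)" using A subspace_bar unfolding b_subalgebra_def subalgebra_def by blast
  have AM: "\<And>x y. x \<in> A \<Longrightarrow> y \<in> A \<Longrightarrow> x \<star> y \<in> A" using A unfolding b_subalgebra_def subalgebra_def by blast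
  have "subspace (b_radical A)"
    unfolding b_radical_eq[OF A]
    by (intro subspace_inter sA subspace_Inter) (auto simp: maximal_null_ideal_def two_sided_ideal_def)
  moreover have "a \<star> x \<in> b_radical A \<and> x \<star> a \<in> b_radical A" if "a \<in> A" "x \<in> b_radical A" for a x
    using that AM unfolding b_radical_eq[OF A]
    by (auto simp: bar_def weight_mult maximal_null_ideal_def two_sided_ideal_def)
  ultimately show "two_sided_ideal A (b_radical A)"
    unfolding two_sided_ideal_def using sub unfolding bar_def by blast
qed

text \<open>Orthogonal projection to a subspace on which the trace form is nondegenerate modulo \<open>J\<close>. It comes
  from the operator \<open>\<Phi> x = \<Sum>\<^sub>d tr (x d) d\<close>, for a basis \<open>d\<close> of a complement of \<open>W \<inter> J\<close>; it is bijective there.\<close>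

lemma trace_projection:
  assumes W: "subspace W" and nondeg: "\<And>x. x \<in> W \<Longrightarrow> (\<And>w. w \<in> W \<Longrightarrow> tr (x \<star> w) = 0) \<Longrightarrow> x \<in> J"
  obtains r where "r \<in> W" "\<And>w. w \<in> W \<Longrightarrow> tr ((a - r) \<star> w) = 0"
proof -
  obtain V where V: "subspace V" "V \<subseteq> W" "V \<inter> (W \<inter> J) \<subseteq> {0}"
    and VW: "\<And>x. x \<in> W \<Longrightarrow> \<exists>v\<in>V. x - v \<in> W \<inter> J"
    using subspace_complement[OF subspace_inter[OF W subspace_J] W] by blast
  obtain D where D: "finite D" "D \<subseteq> V" "independent D" "span D = V" "card D = dim V"
    by (rule basis_subspace_exists[OF V(1)])
  define \<Phi> where "\<Phi> x = (\<Sum>d\<in>D. tr (x \<star> d) *s d)" for x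
  have lin: "Vector_Spaces.linear scale scale \<Phi>"
    by (rule Vector_Spaces.linear_iff[THEN iffD2])
      (auto simp: \<Phi>_def mult_simps tr_add tr_scale scale_left_distrib sum.distrib scale_sum_right
        intro: vector_space_axioms)
  have \<Phi>V: "\<Phi> x \<in> V" for x
    unfolding \<Phi>_def using D by (intro subspace_sum subspace_scale V(1)) auto
  have ker: "tr (x \<star> w) = 0" if x: "\<Phi> x = 0" and w: "w \<in> W" for x w
  proof -
    have d: "tr (x \<star> d) = 0" if "d \<in> D" for d
      using independentD[OF D(3,1) order_refl, of "\<lambda>d. tr (x \<star> d)"] x that unfolding \<Phi>_def by simp
    obtain v where v: "v \<in> V" "w - v \<in> W \<inter> J" using VW[OF w] by blast
    have "tr (x \<star> v) = 0"
    proof -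
      have "v \<in> span D" using v D by simp
      then show ?thesis
        by (induction rule: span_induct_alt) (auto simp: mult_simps tr_add tr_scale d)
    qed
    moreover have "tr (x \<star> (w - v)) = 0" using v(2) tr_commute[of x] unfolding J_def by simp
    ultimately show ?thesis by (simp add: mult_simps tr_diff)
  qed
  have "\<Phi> ` V = V"
  proof (rule inj_endo_surj[OF lin V(1)])
    show "\<Phi> ` V \<subseteq> V" using \<Phi>V by blast
    fix x assume "x \<in> V" "\<Phi> x = 0"
    then have "x \<in> J" using nondeg ker V(2) by blast
    then show "x = 0" using V \<open>x \<in> V\<close> by blast
  qed
  then obtain r where r: "r \<in> V" "\<Phi> r = \<Phi> a" using \<Phi>V[of a] by (metis imageE)
  interpret L: Vector_Spaces.linear scale scale \<Phi> by (rule lin)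
  have "\<Phi> (a - r) = 0" using r by (simp add: L.diff)
  then show thesis using that[of r] ker r V(2) by blast
qed

text \<open>In a subalgebra covering \<open>U / J\<close>, the orthogonal space of the radical is an ideal
  complementary to it modulo \<open>J\<close>, because the intersection of the two generates an isotropic ideal
  of \<open>U\<close>. If it were proper it would lie in a maximal ideal, which contains the
  radical as well.\<close>

theorem b_radical_in_J:
  assumes A: "b_subalgebra U A" and cover: "\<And>x. \<exists>s\<in>A. x - s \<in> J"
  shows "b_radical A \<subseteq> J"
proof (rule ccontr)
  assume not: "\<not> b_radical A \<subseteq> J"
  define R where "R = b_radical A"
  have sA: "subspace A" and AM: "\<And>x y. x \<in> A \<Longrightarrow> y \<in> A \<Longrightarrow> x \<star> y \<in> A"
    using A unfolding b_subalgebra_def subalgebra_def by auto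
  have RA: "R \<subseteq> bar A" and sR: "subspace R"
    and RM: "\<And>a x. a \<in> A \<Longrightarrow> x \<in> R \<Longrightarrow> a \<star> x \<in> R" "\<And>a x. a \<in> A \<Longrightarrow> x \<in> R \<Longrightarrow> x \<star> a \<in> R"
    using b_radical_ideal[OF A] unfolding R_def two_sided_ideal_def by auto
  have perp: "tr ((a \<star> x) \<star> r) = 0" "tr ((x \<star> a) \<star> r) = 0"
    if "\<And>r. r \<in> R \<Longrightarrow> tr (x \<star> r) = 0" "a \<in> A" "r \<in> R" for a x r
  proof -
    have "tr ((a \<star> x) \<star> r) = tr (r \<star> (a \<star> x))" by (rule tr_commute)
    also have "\<dots> = tr ((r \<star> a) \<star> x)" by (rule tr_assoc[symmetric])
    also have "\<dots> = tr (x \<star> (r \<star> a))" by (rule tr_commute)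
    finally show "tr ((a \<star> x) \<star> r) = 0" using that RM by simp
    show "tr ((x \<star> a) \<star> r) = 0" using that RM by (simp add: tr_assoc)
  qed
  define K0 where "K0 = {x \<in> R. \<forall>r\<in>R. tr (x \<star> r) = 0}"
  define K where "K = {x \<in> bar A. \<forall>r\<in>R. tr (x \<star> r) = 0}"
  have K0M: "a \<star> x \<in> K0" "x \<star> a \<in> K0" if "a \<in> A" "x \<in> K0" for a x
    using that perp RM unfolding K0_def by auto
  have sK0: "subspace K0"
    by (rule subspaceI) (use sR in \<open>auto simp: K0_def subspace_0 subspace_add subspace_scale mult_simps tr_add tr_scale\<close>)
  have "K0 \<subseteq> J"
  proof -
    define L where "L = {x + y | x y. x \<in> K0 \<and> y \<in> J}"
    have KL: "K0 \<subseteq> L" unfolding L_def using subspace_0[OF subspace_J] by force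
    have "two_sided_ideal UNIV L"
      unfolding two_sided_ideal_def
    proof (intro conjI ballI)
      show "subspace L" unfolding L_def by (rule subspace_sums[OF sK0 subspace_J])
      fix u z assume "z \<in> L"
      then obtain x j where z: "z = x + j" "x \<in> K0" "j \<in> J" unfolding L_def by blast
      obtain s where s: "s \<in> A" "u - s \<in> J" using cover by blast
      have "u \<star> z = s \<star> x + ((u - s) \<star> x + u \<star> j)" "z \<star> u = x \<star> s + (x \<star> (u - s) + j \<star> u)"
        by (simp_all add: z mult_simps)
      moreover have "(u - s) \<star> x + u \<star> j \<in> J" "x \<star> (u - s) + j \<star> u \<in> J"
        using J_mult s z by (auto intro!: subspace_add[OF subspace_J])
      ultimately show "u \<star> z \<in> L" "z \<star> u \<in> L" unfolding L_def using K0M[OF s(1) z(2)] by blast+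
    qed simp
    moreover have "tr (x \<star> y) = 0" if "x \<in> L" "y \<in> L" for x y
    proof -
      from that obtain u i v j where "x = u + i" "y = v + j" "u \<in> K0" "v \<in> K0" "i \<in> J" "j \<in> J"
        unfolding L_def by blast
      moreover from this have "tr (u \<star> v) = 0" "tr (i \<star> y) = 0" "tr (j \<star> u) = 0"
        unfolding K0_def J_def by auto
      ultimately show ?thesis using tr_commute[of j u] by (simp add: mult_simps tr_add)
    qed
    ultimately show ?thesis using isotropic_ideal_in_J KL by blast
  qed
  have "two_sided_ideal A K"
    unfolding two_sided_ideal_def
  proof (intro conjI ballI)
    show "subspace K"
      by (rule subspaceI) (use subspace_bar[OF sA] in
        \<open>auto simp: K_def subspace_0 subspace_add subspace_scale mult_simps tr_add tr_scale\<close>)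
    show "K \<subseteq> A" unfolding K_def bar_def by blast
    fix a x assume "a \<in> A" "x \<in> K"
    then show "a \<star> x \<in> K" "x \<star> a \<in> K"
      using perp AM unfolding K_def bar_def by (auto simp: weight_mult)
  qed
  moreover have "K \<subset> bar A"
    using not RA \<open>K0 \<subseteq> J\<close> unfolding K_def K0_def R_def by blast
  ultimately obtain M where M: "maximal_null_ideal A M" "K \<subseteq> M" by (rule maximal_null_ideal_above)
  have sM: "subspace M" using M(1) unfolding maximal_null_ideal_def two_sided_ideal_def by blast
  have RM': "R \<subseteq> M" using M(1) unfolding R_def b_radical_eq[OF A] by blast
  have "bar A \<subseteq> M"
  proof
    fix n assume n: "n \<in> bar A"
    obtain r where r: "r \<in> R" "\<And>w. w \<in> R \<Longrightarrow> tr ((n - r) \<star> w) = 0"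
      using trace_projection[OF sR, of n] \<open>K0 \<subseteq> J\<close> unfolding K0_def by blast
    have "n - r \<in> K" unfolding K_def using r n RA subspace_diff[OF subspace_bar[OF sA]] by blast
    then have "(n - r) + r \<in> M" using M(2) RM' r(1) subspace_add[OF sM] by blast
    then show "n \<in> M" by simp
  qed
  then show False using M(1) unfolding maximal_null_ideal_def by blast
qed

end

section \<open>The decomposition\<close>

context b_frame begin

lemma J_weight: "J \<subseteq> bar UNIV"
  using nilp_J weight_nilp unfolding bar_def by blast

text \<open>A maximal ideal not containing the ideal \<open>J\<^sup>2\<close> would satisfy \<open>bar U = M + J\<^sup>2\<close>, and iterating
  this \<open>bar U \<subseteq> M + J (J (\<dots> J))\<close>.\<close>

lemma square_J_in_b_radical: "square J \<subseteq> b_radical UNIV"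
proof -
  have U: "b_subalgebra UNIV UNIV"
    using weight_nonzero unfolding b_subalgebra_def subalgebra_def by auto
  have sqJ: "square J \<subseteq> J" unfolding square_def
    by (rule span_minimal) (use J_mult subspace_J in auto)
  have "square J \<subseteq> M" if M: "maximal_null_ideal UNIV M" for M
  proof (rule ccontr)
    assume not: "\<not> square J \<subseteq> M"
    have idM: "two_sided_ideal UNIV M" and MN: "M \<subset> bar UNIV"
      and max: "\<And>L. two_sided_ideal UNIV L \<Longrightarrow> M \<subseteq> L \<Longrightarrow> L \<subset> bar UNIV \<Longrightarrow> L = M"
      using M unfolding maximal_null_ideal_def by blast+
    have sM: "subspace M" and MM: "\<And>a x. x \<in> M \<Longrightarrow> a \<star> x \<in> M" "\<And>a x. x \<in> M \<Longrightarrow> x \<star> a \<in> M"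
      using idM unfolding two_sided_ideal_def by auto
    have idQ: "two_sided_ideal UNIV (square J)" by (rule square_of_ideal[OF ideal_J])
    have sQ: "subspace (square J)" and QM: "\<And>a x. x \<in> square J \<Longrightarrow> a \<star> x \<in> square J"
      "\<And>a x. x \<in> square J \<Longrightarrow> x \<star> a \<in> square J"
      using idQ unfolding two_sided_ideal_def by auto
    define L where "L = {x + y | x y. x \<in> M \<and> y \<in> square J}"
    have "two_sided_ideal UNIV L"
      unfolding two_sided_ideal_def
    proof (intro conjI ballI)
      show "subspace L" unfolding L_def by (rule subspace_sums[OF sM sQ])
      fix a z assume "z \<in> L"
      then obtain x y where z: "z = x + y" "x \<in> M" "y \<in> square J" unfolding L_def by blast
      have "a \<star> z = a \<star> x + a \<star> y" "z \<star> a = x \<star> a + y \<star> a" by (simp_all add: z mult_simps)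
      then show "a \<star> z \<in> L" "z \<star> a \<in> L" unfolding L_def using z MM QM by blast+
    qed simp
    moreover have M_sub: "M \<subseteq> L" "square J \<subseteq> L"
      unfolding L_def using subspace_0[OF sM] subspace_0[OF sQ] by force+
    moreover have "L \<subseteq> bar UNIV"
    proof
      fix z assume "z \<in> L"
      then obtain x y where z: "z = x + y" "x \<in> M" "y \<in> square J" unfolding L_def by blast
      then have "\<omega> x = 0" "\<omega> y = 0" using MN sqJ J_weight unfolding bar_def by blast+
      then show "z \<in> bar UNIV" by (simp add: z bar_def weight_add)
    qed
    ultimately have N: "bar UNIV = L" using max[of L] not by blast
    have "bar UNIV \<subseteq> descent J UNIV M k" for k
    proof (induction k)
      case (Suc k)
      have "M \<subseteq> descent J UNIV M (Suc k)" by (auto intro: span_base)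
      moreover have "square J \<subseteq> descent J UNIV M (Suc k)"
        unfolding square_def descent.simps using Suc J_weight by (intro span_mono) blast
      ultimately show ?case unfolding N L_def
        using subspace_add[OF subspace_descent[OF subspace_UNIV]] by blast
    qed simp
    moreover have "descent J UNIV M k \<subseteq> span (M \<union> descent J UNIV {0} k)" for k
    proof (induction k)
      case 0
      show ?case by simp
    next
      case (Suc k)
      have "b \<star> m \<in> span (M \<union> descent J UNIV {0} (Suc k))" if b: "b \<in> J" and m: "m \<in> descent J UNIV M k" for b m
      proof -
        have "m \<in> span (M \<union> descent J UNIV {0} k)" using Suc m by blast
        then show ?thesis
          by (rule mult_span_right[OF _ subspace_span, rotated])
            (use MM b descent_step[of b J] in \<open>auto intro!: span_base simp del: descent.simps(2)\<close>)
      qed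
      then show ?case unfolding descent.simps(2)[of J UNIV M]
        by (intro span_minimal subspace_span) (auto intro: span_base)
    qed
    moreover obtain k where k: "descent J UNIV {0} k \<subseteq> {0}" using J_nilpotent by blast
    moreover have "span (M \<union> descent J UNIV {0} k) \<subseteq> M"
      by (rule span_minimal) (use k sM subspace_0 in auto)
    ultimately have "bar UNIV \<subseteq> M" by blast
    then show False using MN by blast
  qed
  then show ?thesis using sqJ J_weight unfolding b_radical_eq[OF U] by blast
qed

theorem wedderburn_b_decomposition_exists: "\<exists>S V. wedderburn_b_decomposition UNIV S V"
proof -
  have U: "b_subalgebra UNIV UNIV"
    using weight_nonzero unfolding b_subalgebra_def subalgebra_def by auto
  define R where "R = b_radical UNIV"
  obtain S where S: "subalgebra S" "S \<inter> J \<subseteq> {0}" and SJ: "\<And>x. \<exists>s\<in>S. x - s \<in> J"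
    by (rule wedderburn_principal) blast
  have sS: "subspace S" using S(1) unfolding subalgebra_def by blast
  have RJ: "R \<subseteq> J" unfolding R_def
  proof (rule b_radical_in_J[OF U])
    show "\<exists>s\<in>UNIV. x - s \<in> J" for x using subspace_0[OF subspace_J] by (intro bexI[of _ x]) auto
  qed
  have sR: "subspace R" unfolding R_def by (rule ideal_subspace[OF b_radical_ideal(1)[OF U]])
  obtain V where V: "subspace V" "V \<subseteq> J" "V \<inter> R \<subseteq> {0}" and VR: "\<And>x. x \<in> J \<Longrightarrow> \<exists>v\<in>V. x - v \<in> R"
    using subspace_complement[OF sR subspace_J RJ] by blast
  obtain x where x: "\<omega> x \<noteq> 0" using weight_nonzero by blast
  obtain s where s: "s \<in> S" "x - s \<in> J" using SJ by blast
  have "\<omega> s \<noteq> 0" using J_weight x s(2) by (auto simp: bar_def weight_diff)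
  then have bS: "b_subalgebra UNIV S" using S(1) s(1) unfolding b_subalgebra_def by blast
  have "b_radical S \<subseteq> J" by (rule b_radical_in_J[OF bS SJ])
  then have "b_radical S \<subseteq> {0}"
    using b_radical_ideal[OF bS] S(2) unfolding two_sided_ideal_def by blast
  moreover have "0 \<in> b_radical S"
    by (rule ideal_zero[OF b_radical_ideal(1)[OF bS]])
  ultimately have ss: "b_semisimple S" unfolding b_semisimple_def by blast
  have VU: "V \<subseteq> bar UNIV" using V(2) J_weight by blast
  have "square V \<subseteq> square J" unfolding square_def using V(2) by (intro span_mono) blast
  then have sq: "square V \<subseteq> R" using square_J_in_b_radical unfolding R_def by blast
  have "direct_sum3 UNIV S V R"
    unfolding direct_sum3_def
  proof (intro conjI ballI sS sR V(1))
    fix x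
    obtain s where s: "s \<in> S" "x - s \<in> J" using SJ by blast
    obtain v where v: "v \<in> V" "x - s - v \<in> R" using VR[OF s(2)] by blast
    have uniq: "p = s \<and> q = v \<and> r = x - s - v"
      if "p \<in> S" "q \<in> V" "r \<in> R" "x = p + q + r" for p q r
    proof -
      have "p - s = (x - s) - (q + r)" using that(4) by simp
      moreover have "(x - s) - (q + r) \<in> J"
        by (rule subspace_diff[OF subspace_J s(2) subspace_add[OF subspace_J]])
          (use that V(2) RJ in auto)
      moreover have "p - s \<in> S" using that s subspace_diff[OF sS] by blast
      ultimately have "p - s = 0" using S(2) by (metis IntI singletonD subsetD)
      then have ps: "p = s" by simp
      have "q - v = (x - s - v) - r" using that(4) ps by simp
      moreover have "(x - s - v) - r \<in> R" using v(2) that subspace_diff[OF sR] by blast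
      moreover have "q - v \<in> V" using that v subspace_diff[OF V(1)] by blast
      ultimately have "q - v = 0" using V(3) by (metis IntI singletonD subsetD)
      then show ?thesis using ps that(4) by simp
    qed
    show "\<exists>!(a, b, c). a \<in> S \<and> b \<in> V \<and> c \<in> R \<and> x = a + b + c"
    proof (rule ex1I[of _ "(s, v, x - s - v)"])
      show "case (s, v, x - s - v) of (a, b, c) \<Rightarrow> a \<in> S \<and> b \<in> V \<and> c \<in> R \<and> x = a + b + c"
        using s(1) v by simp
      fix t assume t: "case t of (a, b, c) \<Rightarrow> a \<in> S \<and> b \<in> V \<and> c \<in> R \<and> x = a + b + c"
      obtain p q r where pqr: "t = (p, q, r)" by (cases t)
      with t have "p = s \<and> q = v \<and> r = x - s - v" by (intro uniq) auto
      then show "t = (s, v, x - s - v)" by (simp only: pqr)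
    qed
  qed auto
  then have "wedderburn_b_decomposition UNIV S V"
    unfolding wedderburn_b_decomposition_def using bS ss VU sq R_def by simp
  then show ?thesis by blast
qed

end

theorem theorem3p2:
  fixes scale :: "'f::alg_closed_field \<Rightarrow> 'u::ab_group_add \<Rightarrow> 'u"
    and mult :: "'u \<Rightarrow> 'u \<Rightarrow> 'u"
    and \<omega> :: "'u \<Rightarrow> 'f"
    and Basis :: "'u set"
  assumes "CHAR('f) \<noteq> 2" and "CHAR('f) \<noteq> 3" and "CHAR('f) \<noteq> 5"
    and "b_alternative_algebra scale mult \<omega>"
    and "finite_dimensional_vector_space scale Basis"
  shows "\<exists>S V. b_algebra.wedderburn_b_decomposition scale mult \<omega> UNIV S V"
proof -
  interpret U: b_alternative_algebra scale mult \<omega> by fact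
  interpret fd: finite_dimensional_vector_space scale Basis by fact
  have "(2::'f) \<noteq> 0"
  proof
    assume "(2::'f) = 0"
    then have "CHAR('f) dvd 2" using of_nat_eq_0_iff_char_dvd[of 2, where ?'a = 'f] by simp
    then have "CHAR('f) \<le> 2" "CHAR('f) \<noteq> 0"
      by (simp add: dvd_imp_le, metis dvd_0_left zero_neq_numeral)
    then show False using assms(1) CHAR_not_1'[where ?'a = 'f] by linarith
  qed
  then interpret alg_closed_alternative_algebra scale mult Basis
    by unfold_locales (use U.left_alternative U.right_alternative in auto)
  obtain E where E: "orthogonal_idempotents E" "\<And>D. orthogonal_idempotents D \<Longrightarrow> card D \<le> card E"
    using maximal_orthogonal_idempotents by blast
  interpret b_frame scale mult Basis E \<omega>
    by unfold_locales (use E in auto)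
  show ?thesis by (rule wedderburn_b_decomposition_exists)
qed

end
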